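(* Let $t=t(n)$ be a sequence of positive integers such that $\lceil \frac{n}{2}\rceil + t\leq \lceil \frac{4n}{5}\rceil$, and define $p(n,t)=\min\{n^{-2/3}, t^{-1}\}$. Then the following statements hold. (0) There exist sets $A=A_n \subseteq [n]$ with $|A|=\lceil \frac{n}{2}\rceil + t$ such that, for every sequence of probabilities $p=p(n)$ with $p=o(p(n,t))$, whp $A\cup[n]_p$ is not Schur. (1) For all sets $A=A_n \subseteq [n]$ with $|A|=\lceil \frac{n}{2}\rceil + t$ and every sequence of probabilities $p=p(n)$ with $p=\omega(p(n,t))$, whp $A\cup[n]_p$ is Schur.
   Context: $[n]=\{1,\dots,n\}$. For $p\in[0,1]$, $[n]_p$ denotes the random subset of $[n]$ obtained by including each element independently with probability $p$. A Schur triple in a set $A\subseteq\mathbb{N}$ is a triple $(x,y,z)\in A^3$ with $x+y=z$ (the case $x=y$ is allowed). A set $A\subseteq\mathbb{N}$ is called Schur if every colouring of the elements of $A$ with two colours contains a monochromatic Schur triple. All quantities depend on $n$ and asymptotics are as $n\to\infty$ (so conditions need only hold for all sufficiently large $n$); $f=o(g)$ means $f/g\to0$ and $f=\omega(g)$ means $f/g\to\infty$. An event (sequence of events indexed by $n$) holds whp (with high probability) if its probability tends to $1$ as $n\to\infty$. *)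

theory Defs
  imports "HOL-Probability.Product_PMF" "HOL-Library.Landau_Symbols"
begin

definition schur_triple :: "nat set \<Rightarrow> nat \<Rightarrow> nat \<Rightarrow> nat \<Rightarrow> bool" where
  "schur_triple A x y z \<longleftrightarrow> x \<in> A \<and> y \<in> A \<and> z \<in> A \<and> x + y = z"

text \<open>A two-colouring of \<open>A\<close> is given by a total function into \<open>bool\<close>; only its values on \<open>A\<close> matter.\<close>

definition is_schur :: "nat set \<Rightarrow> bool" where
  "is_schur A \<longleftrightarrow>
     (\<forall>c :: nat \<Rightarrow> bool. \<exists>x y z. schur_triple A x y z \<and> c x = c y \<and> c y = c z)"

text \<open>The random set \<open>[n]\<^sub>p\<close>, where \<open>[n] = {1..n}\<close>; intended for \<open>0 \<le> p \<le> 1\<close>.\<close>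

definition random_subset :: "nat \<Rightarrow> real \<Rightarrow> nat set pmf" where
  "random_subset n p =
     map_pmf (\<lambda>f. {i \<in> {1..n}. f i}) (Pi_pmf {1..n} False (\<lambda>_. bernoulli_pmf p))"

definition whp :: "(nat \<Rightarrow> 'a pmf) \<Rightarrow> (nat \<Rightarrow> 'a \<Rightarrow> bool) \<Rightarrow> bool" where
  "whp M E \<longleftrightarrow> (\<lambda>n. measure_pmf.prob (M n) {x. E n x}) \<longlonglongrightarrow> 1"

definition schur_threshold :: "nat \<Rightarrow> nat \<Rightarrow> real" where
  "schur_threshold n t = min (real n powr (- 2 / 3)) (inverse (real t))"

definition prob_seq :: "(nat \<Rightarrow> real) \<Rightarrow> bool" where
  "prob_seq p \<longleftrightarrow> (\<forall>n. 0 \<le> p n \<and> p n \<le> 1)"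

text \<open>
  The conditions on \<open>A\<^sub>n\<close> are only required for all large \<open>n\<close>: for \<open>n \<le> 1\<close> and \<open>t n > 0\<close>
  no subset of \<open>[n]\<close> has the prescribed size.
\<close>

definition admissible_sets :: "(nat \<Rightarrow> nat) \<Rightarrow> (nat \<Rightarrow> nat set) \<Rightarrow> bool" where
  "admissible_sets t A \<longleftrightarrow>
     (\<forall>\<^sub>F n in sequentially.
        A n \<subseteq> {1..n} \<and> int (card (A n)) = \<lceil>real n / 2\<rceil> + int (t n))"

end

theory Submission
  imports Defs
begin

text \<open>
  For part (0) take \<open>A = [a, n]\<close>. With high probability no random element is at most \<open>2t\<close> and the
  random elements contain no Schur triple; then it is safe to colour \<open>[2a, 4a)\<close> and everything
  below \<open>a\<close> blue, and the rest red.

  For part (1) with \<open>t \<le> n\<^sup>2\<^sup>/\<^sup>3\<close> the random set contains, by the second moment method, a Schur triple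
  \<open>x, y, x + y\<close> such that \<open>b, b + x, b + y, b + x + y\<close> all lie in \<open>A\<close> for linearly many \<open>b\<close>.
  It forces a monochromatic translate of the set of these \<open>b\<close>, and a second random Schur triple among
  the differences of this set finishes the argument.

  For larger \<open>t\<close> only boundedly many random elements are used. If the Schur triples of \<open>A\<close> are dense
  (at some scale), then three random elements and a cube of Schur triples of \<open>A\<close>
  suffice. Otherwise \<open>A\<close> is close to the odd numbers or to the upper half of \<open>[n]\<close>. The at least
  \<open>t\<close> exceptional elements of \<open>A\<close> then contain \<open>u\<^sub>1 < u\<^sub>2 < u\<^sub>3\<close> whose consecutive differences
  are random elements, and together with one more random element they cannot be coloured, unless they cluster
  just below \<open>n / 2\<close>, in which case their sums yield a dense set of Schur triples.
\<close>

section \<open>Finite configurations that force the Schur property\<close>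

text \<open>Each term of the threshold has its own origin. The order of the expected number of
  random Schur triples is \<open>n^2 p^3\<close>, which grows once \<open>p\<close> is far above
  \<open>n powr (- 2 / 3)\<close>. If \<open>p * t\<close> is large, the random set hits any
  prescribed subset of \<open>[n]\<close> whose size is proportional to \<open>t\<close>. When
  \<open>1 / t\<close> is the smaller term, \<open>p\<close> may be too small for any random Schur
  triple to exist. Each random element must then come from a target set of order \<open>t\<close>
  that is prepared in advance or from elements exposed earlier; hence the counts of popular
  differences and the splitting into rounds. The obstacle near the two extremal sets is that
  \<open>A\<close> may have far more than \<open>t\<close> holes in them. Its size compensates: the
  exceptional elements number exactly \<open>t\<close> plus the number of holes. A ladder keeps a
  free base point \<open>a\<close>, which ranges over more values than a bounded number of
  conditions "not a hole" can exclude.\<close>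

lemma is_schurI:
  assumes "\<And>c :: nat \<Rightarrow> bool.
    (\<And>x y z. x \<in> V \<Longrightarrow> y \<in> V \<Longrightarrow> z \<in> V \<Longrightarrow> x + y = z \<Longrightarrow> \<not> (c x = c y \<and> c y = c z)) \<Longrightarrow> False"
  shows "is_schur V"
  unfolding is_schur_def schur_triple_def
proof (intro allI, rule ccontr)
  fix c :: "nat \<Rightarrow> bool"
  assume "\<not> (\<exists>x y z. (x \<in> V \<and> y \<in> V \<and> z \<in> V \<and> x + y = z) \<and> c x = c y \<and> c y = c z)"
  then show False using assms[of c] by blast
qed

text \<open>Consider a colouring without monochromatic triples. If \<open>d\<close> and \<open>e\<close> have the same colour, then exactly
  one of the sums \<open>x + y + g + {0, d} + {0, e}\<close> has this colour too, and it singles out a vertex of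
  \<open>{x, x + d} \<times> {y + g, y + e + g}\<close> as well as of \<open>{x + g, x + d + g} \<times> {y, y + e}\<close>. Comparing the two
  along \<open>g\<close> gives a contradiction. If \<open>d\<close> and \<open>e\<close> have different colours, then \<open>x, x + g\<close> share the
  colour of \<open>e\<close> and \<open>y, y + g\<close> that of \<open>d\<close>, which leaves no colour for \<open>g\<close>.\<close>

lemma is_schur_cube:
  fixes x y d e g :: nat
  assumes "d \<in> V" "e \<in> V" "g \<in> V"
    and "x \<in> V" "x + d \<in> V" "x + g \<in> V" "x + d + g \<in> V"
    and "y \<in> V" "y + e \<in> V" "y + g \<in> V" "y + e + g \<in> V"
    and "x + y + g \<in> V" "x + y + d + g \<in> V" "x + y + e + g \<in> V" "x + y + d + e + g \<in> V"
  shows "is_schur V"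
proof (rule is_schurI)
  fix c :: "nat \<Rightarrow> bool"
  assume N: "\<And>x y z. x \<in> V \<Longrightarrow> y \<in> V \<Longrightarrow> z \<in> V \<Longrightarrow> x + y = z \<Longrightarrow> \<not> (c x = c y \<and> c y = c z)"
  note n = N[OF assms(4) assms(1) assms(5)] N[OF assms(6) assms(1) assms(7)]
    N[OF assms(4) assms(3) assms(6)] N[OF assms(5) assms(3) assms(7)]
    N[OF assms(8) assms(2) assms(9)] N[OF assms(10) assms(2) assms(11)]
    N[OF assms(8) assms(3) assms(10)] N[OF assms(9) assms(3) assms(11)]
    N[OF assms(4) assms(10) assms(12)] N[OF assms(5) assms(10) assms(13)]
    N[OF assms(4) assms(11) assms(14)] N[OF assms(5) assms(11) assms(15)]
    N[OF assms(6) assms(8) assms(12)] N[OF assms(7) assms(8) assms(13)]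
    N[OF assms(6) assms(9) assms(14)] N[OF assms(7) assms(9) assms(15)]
    N[OF assms(12) assms(1) assms(13)] N[OF assms(14) assms(1) assms(15)]
    N[OF assms(12) assms(2) assms(14)] N[OF assms(13) assms(2) assms(15)]
  have eqs: "x + d + g = x + g + d" "y + e + g = y + g + e" "x + (y + g) = x + y + g"
    "x + d + (y + g) = x + y + d + g" "x + (y + e + g) = x + y + e + g"
    "x + d + (y + e + g) = x + y + d + e + g" "x + g + y = x + y + g"
    "x + d + g + y = x + y + d + g" "x + g + (y + e) = x + y + e + g"
    "x + d + g + (y + e) = x + y + d + e + g" "x + y + g + d = x + y + d + g"
    "x + y + e + g + d = x + y + d + e + g" "x + y + g + e = x + y + e + g"
    "x + y + d + g + e = x + y + d + e + g"
    by simp_all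
  show False using n[simplified add_ac simp_thms] by sat
qed

definition sum_triple :: "nat \<Rightarrow> nat \<Rightarrow> nat \<Rightarrow> bool" where
  "sum_triple x y z \<longleftrightarrow> x + y = z \<or> x + z = y \<or> y + z = x"

text \<open>The points \<open>p, r\<^sub>i, q\<^sub>i\<close> stand for \<open>a, a + u\<^sub>i, a + d\<^sub>i\<close> or for
  \<open>a, u\<^sub>i - a, \<bar>d\<^sub>i - a\<bar>\<close>, the primed ones for the same with \<open>a + f\<close> in place of \<open>a\<close>.
  If \<open>f\<close> is blue, then avoiding monochromatic triples forces \<open>u\<^sub>2\<close> to be red because of \<open>u\<^sub>1\<close>,
  and to be blue because of \<open>u\<^sub>3\<close>.\<close>

lemma is_schur_ladder:
  fixes u1 u2 u3 d1 d2 f p r1 r2 r3 q1 q2 p' r1' r2' r3' q1' q2' :: nat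
  assumes V: "{u1, u2, u3, d1, d2, f, p, r1, r2, r3, q1, q2, p', r1', r2', r3', q1', q2'} \<subseteq> V"
    and "sum_triple u1 d1 u2"
    and "sum_triple u1 p r1" "sum_triple u2 p r2" "sum_triple u3 p r3"
    and "sum_triple d1 r1 r2" "sum_triple d2 r2 r3" "sum_triple d1 p q1" "sum_triple u1 q1 r2"
    and "sum_triple d2 p q2" "sum_triple u2 q2 r3"
    and "sum_triple u1 p' r1'" "sum_triple u2 p' r2'" "sum_triple u3 p' r3'"
    and "sum_triple d1 r1' r2'" "sum_triple d2 r2' r3'" "sum_triple d1 p' q1'" "sum_triple u1 q1' r2'"
    and "sum_triple d2 p' q2'" "sum_triple u2 q2' r3'"
    and "sum_triple f p p'" "sum_triple f r1 r1'" "sum_triple f r2 r2'" "sum_triple f r3 r3'"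
  shows "is_schur V"
proof (rule is_schurI)
  fix c :: "nat \<Rightarrow> bool"
  assume N: "\<And>x y z. x \<in> V \<Longrightarrow> y \<in> V \<Longrightarrow> z \<in> V \<Longrightarrow> x + y = z \<Longrightarrow> \<not> (c x = c y \<and> c y = c z)"
  have A: "\<not> (c x = c y \<and> c y = c z)" if "sum_triple x y z" "x \<in> V" "y \<in> V" "z \<in> V" for x y z
    using that N[of x y z] N[of x z y] N[of y z x] unfolding sum_triple_def by auto
  note n = assms(2-)[THEN A]
  show False using n V unfolding insert_subset by sat
qed

text \<open>If \<open>x, y, x + y\<close> are not all of the same colour, then either all three points \<open>b\<close> or all three
  points \<open>b + x\<close> must take the minority colour. Their differences are \<open>f, g, f + g\<close>, which
  are thereby forced to be of the other colour.\<close>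

lemma is_schur_two_triples:
  fixes x y f g :: nat
  assumes V: "{x, y, x + y, f, g, f + g} \<subseteq> V"
    and sq: "\<And>b. b \<in> {a, a + f, a + f + g} \<Longrightarrow> {b, b + x, b + y, b + x + y} \<subseteq> V"
  shows "is_schur V"
proof (rule is_schurI)
  fix c :: "nat \<Rightarrow> bool"
  assume N: "\<And>x y z. x \<in> V \<Longrightarrow> y \<in> V \<Longrightarrow> z \<in> V \<Longrightarrow> x + y = z \<Longrightarrow> \<not> (c x = c y \<and> c y = c z)"
  define b1 b2 where "b1 = a + f" and "b2 = a + f + g"
  have k: "(\<not> (c x = c b \<and> c b = c (b + x))) \<and> (\<not> (c y = c b \<and> c b = c (b + y))) \<and>
      (\<not> (c (x + y) = c b \<and> c b = c (b + x + y))) \<and>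
      (\<not> (c x = c (b + y) \<and> c (b + y) = c (b + x + y))) \<and> (\<not> (c y = c (b + x) \<and> c (b + x) = c (b + x + y)))"
    if "b \<in> {a, b1, b2}" for b
  proof -
    have m: "b \<in> V" "b + x \<in> V" "b + y \<in> V" "b + x + y \<in> V"
      using sq[of b] that unfolding b1_def b2_def by auto
    show ?thesis using V by (intro conjI N m) auto
  qed
  have "b1 \<in> V" "b2 \<in> V" "a \<in> V" "b1 + x \<in> V" "b2 + x \<in> V" "a + x \<in> V"
    using sq unfolding b1_def b2_def by auto
  then have "\<not> (c f = c a \<and> c a = c b1) \<and> \<not> (c g = c b1 \<and> c b1 = c b2) \<and>
      \<not> (c (f + g) = c a \<and> c a = c b2) \<and> \<not> (c f = c (a + x) \<and> c (a + x) = c (b1 + x)) \<and>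
      \<not> (c g = c (b1 + x) \<and> c (b1 + x) = c (b2 + x)) \<and> \<not> (c (f + g) = c (a + x) \<and> c (a + x) = c (b2 + x))"
    using V by (intro conjI N) (auto simp: b1_def b2_def)
  moreover have "\<not> (c x = c y \<and> c y = c (x + y))" "\<not> (c f = c g \<and> c g = c (f + g))"
    using N[of x y "x + y"] N[of f g "f + g"] V by auto
  ultimately show False using k[OF insertI1] k[OF insertI2[OF insertI1]] k[OF insertI2[OF insertI2[OF insertI1]]]
    by sat
qed

section \<open>The colouring for the interval construction\<close>

text \<open>Red is \<open>[a, 2a)\<close> together with \<open>[4a, n]\<close>: two red numbers
  below \<open>2a\<close> have a blue sum, and a red number from \<open>4a\<close> on pushes the sum
  to \<open>5a > n\<close>. Two blue numbers below \<open>a\<close> have a sum below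
  \<open>2a\<close>, which is blue only below \<open>a\<close>, where \<open>free\<close> applies.
  Two from \<open>[2a, 4a)\<close> sum to at least \<open>4a\<close>. In the mixed case
  \<open>small\<close> lifts the sum above \<open>2a + 2t\<close>, hence above
  \<open>n\<close>.\<close>

lemma not_schur_interval:
  fixes a n t :: nat
  assumes a: "n < 5 * a" "n \<le> 2 * a + 2 * t" and S: "S \<subseteq> {1..n}"
    and small: "S \<inter> {1..2 * t} = {}"
    and free: "\<And>x y. x \<in> S \<Longrightarrow> y \<in> S \<Longrightarrow> x + y \<notin> S"
  shows "\<not> is_schur ({a..n} \<union> S)"
proof
  assume "is_schur ({a..n} \<union> S)"
  then obtain x y z where V: "x \<in> {a..n} \<union> S" "y \<in> {a..n} \<union> S" "z \<in> {a..n} \<union> S" "x + y = z"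
    and c: "(x < a \<or> 2 * a \<le> x \<and> x < 4 * a) = (y < a \<or> 2 * a \<le> y \<and> y < 4 * a)"
      "(y < a \<or> 2 * a \<le> y \<and> y < 4 * a) = (z < a \<or> 2 * a \<le> z \<and> z < 4 * a)"
    unfolding is_schur_def schur_triple_def
    by (elim allE[where x = "\<lambda>v. v < a \<or> 2 * a \<le> v \<and> v < 4 * a"]) blast
  have S': "v \<in> S" "2 * t < v" if "v \<in> {a..n} \<union> S" "v < a" for v
  proof -
    show "v \<in> S" using that by auto
    then show "2 * t < v" using small S by fastforce
  qed
  have le: "x \<le> n" "y \<le> n" "z \<le> n" using V S by auto
  show False
  proof (cases "x < a \<or> 2 * a \<le> x \<and> x < 4 * a")
    case False
    then show False using c V le a by auto
  next
    case True
    show False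
    proof (cases "x < a \<and> y < a \<and> z < a")
      case True
      then show False using S'(1)[OF V(1)] S'(1)[OF V(2)] S'(1)[OF V(3)] free V(4) by blast
    next
      case False
      then show False using True c V(4) le a S'(2)[OF V(1)] S'(2)[OF V(2)] by linarith
    qed
  qed
qed

section \<open>Random subsets\<close>

lemma finite_set_pmf_random_subset: "finite (set_pmf (random_subset n p))"
  and set_pmf_random_subset: "S \<in> set_pmf (random_subset n p) \<Longrightarrow> S \<subseteq> {1..n}"
proof -
  have *: "set_pmf (random_subset n p) \<subseteq> Pow {1..n}"
    unfolding random_subset_def by auto
  then show "finite (set_pmf (random_subset n p))"
    by (rule finite_subset) simp
  show "S \<in> set_pmf (random_subset n p) \<Longrightarrow> S \<subseteq> {1..n}" using * by auto
qed

lemma prob_random_superset: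
  assumes "0 \<le> p" "p \<le> 1" "K \<subseteq> {1..n}"
  shows "measure_pmf.prob (random_subset n p) {S. K \<subseteq> S} = p ^ card K"
proof -
  have "(\<lambda>f. {i \<in> {1..n}. f i}) -` {S. K \<subseteq> S} = Pi {1..n} (\<lambda>i. if i \<in> K then {True} else UNIV)"
    using assms(3) by (auto simp: Pi_iff split: if_splits)
  then have "measure_pmf.prob (random_subset n p) {S. K \<subseteq> S} =
      (\<Prod>i\<in>{1..n}. measure_pmf.prob (bernoulli_pmf p) (if i \<in> K then {True} else UNIV))"
    unfolding random_subset_def by (simp add: measure_Pi_pmf_Pi)
  also have "\<dots> = (\<Prod>i\<in>{1..n}. if i \<in> K then p else 1)"
    using assms by (intro prod.cong) (auto simp: measure_pmf_single)
  also have "\<dots> = p ^ card K"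
    using assms(3) by (subst prod.inter_restrict[symmetric]) (auto simp: Int_absorb1)
  finally show ?thesis .
qed

lemma prob_random_disjoint:
  assumes "0 \<le> p" "p \<le> 1" "D \<subseteq> {1..n}"
  shows "measure_pmf.prob (random_subset n p) {S. S \<inter> D = {}} = (1 - p) ^ card D"
proof -
  have "(\<lambda>f. {i \<in> {1..n}. f i}) -` {S. S \<inter> D = {}} = Pi {1..n} (\<lambda>i. if i \<in> D then {False} else UNIV)"
    using assms(3) by (auto simp: Pi_iff split: if_splits)
  then have "measure_pmf.prob (random_subset n p) {S. S \<inter> D = {}} =
      (\<Prod>i\<in>{1..n}. measure_pmf.prob (bernoulli_pmf p) (if i \<in> D then {False} else UNIV))"
    unfolding random_subset_def by (simp add: measure_Pi_pmf_Pi)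
  also have "\<dots> = (\<Prod>i\<in>{1..n}. if i \<in> D then 1 - p else 1)"
    using assms by (intro prod.cong) (auto simp: measure_pmf_single)
  also have "\<dots> = (1 - p) ^ card D"
    using assms(3) by (subst prod.inter_restrict[symmetric]) (auto simp: Int_absorb1)
  finally show ?thesis .
qed

lemma prob_random_disjoint_le:
  assumes "0 \<le> p" "p \<le> 1" "D \<subseteq> {1..n}"
  shows "measure_pmf.prob (random_subset n p) {S. S \<inter> D = {}} \<le> exp (- p * card D)"
proof -
  have "(1 - p) ^ card D \<le> exp (- p) ^ card D"
    using assms exp_ge_add_one_self[of "-p"] by (intro power_mono) auto
  also have "\<dots> = exp (- p * card D)"
    by (metis exp_of_nat2_mult)
  finally show ?thesis using prob_random_disjoint[OF assms] by simp
qed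

lemma random_subset_two_rounds:
  assumes "0 \<le> q" "q \<le> 1" "0 \<le> r" "r \<le> 1"
  shows "random_subset n (q + r - q * r) =
    bind_pmf (random_subset n q) (\<lambda>S. map_pmf (\<lambda>S'. S \<union> S') (random_subset n r))"
proof -
  \<comment> \<open>\<open>B b\<close> is the law of the final bit given the first-round bit
    \<open>b\<close>: once set, a bit stays set.\<close>
  define B where "B = (\<lambda>b. if b then return_pmf True else bernoulli_pmf r)"
  have le: "q + r - q * r \<le> 1" "0 \<le> q + r - q * r"
    using assms mult_nonneg_nonneg[of "1 - q" "1 - r"] mult_right_le_one_le[of q r] by (auto simp: algebra_simps)
  have "bernoulli_pmf (q + r - q * r) = bind_pmf (bernoulli_pmf q) B"
  proof (rule pmf_eqI)
    fix b :: bool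
    show "pmf (bernoulli_pmf (q + r - q * r)) b = pmf (bind_pmf (bernoulli_pmf q) B) b"
      using assms le by (cases b) (auto simp: pmf_bind B_def algebra_simps)
  qed
  then have "Pi_pmf {1..n} False (\<lambda>_. bernoulli_pmf (q + r - q * r)) =
    Pi_pmf {1..n} False (\<lambda>_. bind_pmf (bernoulli_pmf q) B)" by simp
  also have "\<dots> = bind_pmf (Pi_pmf {1..n} False (\<lambda>_. bernoulli_pmf q))
      (\<lambda>f. Pi_pmf {1..n} False (\<lambda>x. B (f x)))"
    by (subst Pi_pmf_bind[where d' = False]) simp_all
  also have "(\<lambda>f. Pi_pmf {1..n} False (\<lambda>x. B (f x))) =
      (\<lambda>f. map_pmf (\<lambda>g x. if x \<in> {1..n} then f x \<or> g x else False) (Pi_pmf {1..n} False (\<lambda>_. bernoulli_pmf r)))"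
  proof
    fix f :: "nat \<Rightarrow> bool"
    have "B (f x) = map_pmf (\<lambda>b. f x \<or> b) (bernoulli_pmf r)" for x
      by (cases "f x") (auto simp: B_def map_pmf_const)
    then have "Pi_pmf {1..n} False (\<lambda>x. B (f x)) =
      Pi_pmf {1..n} False (\<lambda>x. map_pmf (\<lambda>b. f x \<or> b) (bernoulli_pmf r))" by simp
    also have "\<dots> = map_pmf (\<lambda>g x. if x \<in> {1..n} then f x \<or> g x else False)
      (Pi_pmf {1..n} False (\<lambda>_. bernoulli_pmf r))"
      unfolding map_pmf_def by (subst Pi_pmf_bind[where d' = False]) simp_all
    finally show "Pi_pmf {1..n} False (\<lambda>x. B (f x)) = \<dots>" .
  qed
  finally have *: "Pi_pmf {1..n} False (\<lambda>_. bernoulli_pmf (q + r - q * r)) =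
    bind_pmf (Pi_pmf {1..n} False (\<lambda>_. bernoulli_pmf q))
      (\<lambda>f. map_pmf (\<lambda>g x. if x \<in> {1..n} then f x \<or> g x else False) (Pi_pmf {1..n} False (\<lambda>_. bernoulli_pmf r)))" .
  show ?thesis
    unfolding random_subset_def * map_bind_pmf bind_map_pmf
    by (intro bind_pmf_cong refl) (auto simp: pmf.map_comp o_def intro!: map_pmf_cong)
qed

text \<open>The random set of density \<open>p\<close> is the union of two independent ones of densities at least \<open>p / 2\<close>.\<close>

lemma prob_two_rounds:
  assumes pq: "0 < p" "p \<le> 1" and e2: "0 \<le> e2"
    and 1: "\<And>q. p / 2 \<le> q \<Longrightarrow> q \<le> 1 \<Longrightarrow> measure_pmf.prob (random_subset n q) {S. \<not> P S} \<le> e1"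
    and 2: "\<And>S q. S \<subseteq> {1..n} \<Longrightarrow> P S \<Longrightarrow> p / 2 \<le> q \<Longrightarrow> q \<le> 1 \<Longrightarrow>
      measure_pmf.prob (random_subset n q) {S'. \<not> Q (S \<union> S')} \<le> e2"
  shows "measure_pmf.prob (random_subset n p) {S. \<not> Q S} \<le> e1 + e2"
proof -
  define q where "q = p / 2"
  \<comment> \<open>The solution of \<open>q + r - q * r = p\<close>; dividing by
    \<open>1 - q \<le> 1\<close> keeps \<open>r\<close> at least \<open>p / 2\<close>.\<close>
  define r where "r = (p - q) / (1 - q)"
  have q: "0 \<le> q" "q \<le> 1" "q < 1" using pq unfolding q_def by auto
  have r: "p / 2 \<le> r" "r \<le> 1" using pq unfolding r_def q_def by (auto simp: field_simps)
  have "r * (1 - q) = p - q" using q unfolding r_def by simp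
  then have pe: "q + r - q * r = p" by (simp add: algebra_simps)
  let ?M = "random_subset n q"
  let ?g = "\<lambda>S. measure_pmf.prob (map_pmf (\<lambda>S'. S \<union> S') (random_subset n r)) {S. \<not> Q S}"
  have b: "?g S \<le> indicator {S. \<not> P S} S + e2" if "S \<in> set_pmf ?M" for S
  proof (cases "P S")
    case True
    then show ?thesis using 2[of S r] r set_pmf_random_subset[OF that]
      by (simp add: vimage_def)
  next
    case False
    then show ?thesis using e2 by (simp add: add_increasing2)
  qed
  have "measure_pmf.prob (random_subset n p) {S. \<not> Q S} = measure_pmf.expectation ?M ?g"
  proof -
    have rs: "random_subset n p = bind_pmf ?M (\<lambda>S. map_pmf (\<lambda>S'. S \<union> S') (random_subset n r))"
      using q r pq random_subset_two_rounds[of q r n] by (simp add: pe)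
    have "integrable (measure_pmf ?M) ?g"
      by (intro integrable_measure_pmf_finite finite_set_pmf_random_subset)
    then have "ennreal (measure_pmf.expectation ?M ?g) = (\<integral>\<^sup>+S. ennreal (?g S) \<partial>?M)"
      by (intro nn_integral_eq_integral[symmetric]) auto
    also have "\<dots> = emeasure (random_subset n p) {S. \<not> Q S}"
      unfolding rs emeasure_bind_pmf by (simp only: measure_pmf.emeasure_eq_measure)
    also have "\<dots> = ennreal (measure_pmf.prob (random_subset n p) {S. \<not> Q S})"
      by (rule measure_pmf.emeasure_eq_measure)
    finally show ?thesis by (simp add: integral_nonneg_AE)
  qed
  also have "\<dots> \<le> measure_pmf.expectation ?M (\<lambda>S. indicator {S. \<not> P S} S + e2)"
    by (intro integral_mono_AE integrable_measure_pmf_finite finite_set_pmf_random_subset)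
      (use b in \<open>auto simp: AE_measure_pmf_iff\<close>)
  also have "\<dots> = measure_pmf.prob ?M {S. \<not> P S} + e2"
    by (subst Bochner_Integration.integral_add)
      (auto intro!: integrable_measure_pmf_finite finite_set_pmf_random_subset)
  also have "\<dots> \<le> e1 + e2" using 1[of q] q by (simp add: q_def)
  finally show ?thesis .
qed

text \<open>Chebyshev's inequality for the number of triples of \<open>F\<close> inside the random
  set. Disjoint triples contribute nothing to the variance. A given triple meets at most
  \<open>9 * n\<close> others (its element, the role of that element, one free summand), at
  \<open>p ^ 5\<close> each if one element is shared, and shares two or more elements with at most
  27, at \<open>p ^ 3\<close> or less each. The condition \<open>x \<noteq> y\<close> gives every
  triple exactly three elements.\<close>

lemma prob_no_triple:
  fixes F :: "(nat \<times> nat) set" and c p :: real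
  assumes p: "0 < p" "p \<le> 1" and c: "0 < c" and n: "0 < n"
    and F: "F \<subseteq> {(x, y). 1 \<le> x \<and> 1 \<le> y \<and> x \<noteq> y \<and> x + y \<le> n}"
    and card: "c * (real n)\<^sup>2 \<le> card F"
  shows "measure_pmf.prob (random_subset n p) {S. \<not> (\<exists>(x, y)\<in>F. {x, y, x + y} \<subseteq> S)}
    \<le> (9 / (n * p) + 27 / ((real n)\<^sup>2 * p ^ 3)) / c"
proof -
  let ?M = "random_subset n p"
  define K where "K = (\<lambda>(x::nat, y). {x, y, x + y})"
  define X where "X = (\<lambda>S. \<Sum>f\<in>F. indicator {S. K f \<subseteq> S} S :: real)"
  define \<mu> where "\<mu> = card F * p ^ 3"
  have finF: "finite F"
    by (rule finite_subset[of _ "{..n} \<times> {..n}"]) (use F in auto)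
  have K: "K f \<subseteq> {1..n}" "card (K f) = 3" "finite (K f)" if "f \<in> F" for f
    using that F by (auto simp: K_def card_insert_if)
  have int: "integrable ?M (h :: _ \<Rightarrow> real)" for h
    by (intro integrable_measure_pmf_finite finite_set_pmf_random_subset)
  have EK: "measure_pmf.expectation ?M (indicator {S. W \<subseteq> S}) = p ^ card W" if "W \<subseteq> {1..n}" for W
    using prob_random_superset[of p W n] p that by simp
  have EK': "measure_pmf.prob ?M (Collect ((\<subseteq>) W)) = p ^ card W" if "W \<subseteq> {1..n}" for W
    using prob_random_superset[of p W n] p that by simp
  have EX: "measure_pmf.expectation ?M X = \<mu>"
    unfolding X_def by (subst Bochner_Integration.integral_sum) (use int K in \<open>simp_all add: EK' \<mu>_def\<close>)
  have "(X S)\<^sup>2 = (\<Sum>f\<in>F. \<Sum>g\<in>F. indicator {S. K f \<union> K g \<subseteq> S} S)" for S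
    unfolding X_def power2_eq_square sum_product
    by (intro sum.cong refl) (auto simp: indicator_def)
  then have EX2: "measure_pmf.expectation ?M (\<lambda>S. (X S)\<^sup>2) = (\<Sum>f\<in>F. \<Sum>g\<in>F. p ^ card (K f \<union> K g))"
    by (simp only:) (subst Bochner_Integration.integral_sum; use int K in \<open>simp add: EK'\<close>)+
  have "measure_pmf.expectation ?M (\<lambda>S. (X S - \<mu>)\<^sup>2) = measure_pmf.expectation ?M (\<lambda>S. (X S)\<^sup>2 + \<mu>\<^sup>2 - 2 * \<mu> * X S)"
    by (simp add: power2_diff algebra_simps)
  also have "\<dots> = measure_pmf.expectation ?M (\<lambda>S. (X S)\<^sup>2) - \<mu>\<^sup>2"
    by (subst Bochner_Integration.integral_diff Bochner_Integration.integral_add; use int EX in \<open>simp add: power2_eq_square\<close>)+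
  finally have V: "measure_pmf.expectation ?M (\<lambda>S. (X S - \<mu>)\<^sup>2) = (\<Sum>f\<in>F. \<Sum>g\<in>F. p ^ card (K f \<union> K g)) - \<mu>\<^sup>2"
    unfolding EX2 .
  have "\<mu>\<^sup>2 * measure_pmf.prob ?M {S. \<not> (\<exists>f\<in>F. K f \<subseteq> S)} =
      measure_pmf.expectation ?M (\<lambda>S. \<mu>\<^sup>2 * indicator {S. \<not> (\<exists>f\<in>F. K f \<subseteq> S)} S)"
    by simp
  also have "\<dots> \<le> measure_pmf.expectation ?M (\<lambda>S. (X S - \<mu>)\<^sup>2)"
  proof (intro integral_mono int)
    fix S
    show "\<mu>\<^sup>2 * indicator {S. \<not> (\<exists>f\<in>F. K f \<subseteq> S)} S \<le> (X S - \<mu>)\<^sup>2"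
      by (cases "\<exists>f\<in>F. K f \<subseteq> S") (auto simp: X_def)
  qed
  finally have A: "\<mu>\<^sup>2 * measure_pmf.prob ?M {S. \<not> (\<exists>f\<in>F. K f \<subseteq> S)} \<le> (\<Sum>f\<in>F. \<Sum>g\<in>F. p ^ card (K f \<union> K g)) - \<mu>\<^sup>2"
    unfolding V .
  have "\<mu>\<^sup>2 = (\<Sum>f\<in>F. \<Sum>g\<in>F. p ^ 6)"
    by (simp add: \<mu>_def power2_eq_square flip: power_add)
  then have "(\<Sum>f\<in>F. \<Sum>g\<in>F. p ^ card (K f \<union> K g)) - \<mu>\<^sup>2 = (\<Sum>f\<in>F. \<Sum>g\<in>F. p ^ card (K f \<union> K g) - p ^ 6)"
    by (simp add: sum_subtractf)
  also have "\<dots> \<le> (\<Sum>f\<in>F. (9 * n) * p ^ 5 + 27 * p ^ 3)"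
  proof (rule sum_mono)
    fix f assume f: "f \<in> F"
    define G1 where "G1 = {g \<in> F. K f \<inter> K g \<noteq> {}}"
    define G2 where "G2 = {g \<in> F. 2 \<le> card (K f \<inter> K g)}"
    have fin: "finite G1" "finite G2" unfolding G1_def G2_def using finF by auto
    have "(\<Sum>g\<in>F. p ^ card (K f \<union> K g) - p ^ 6) \<le>
      (\<Sum>g\<in>F. (if g \<in> G1 then p ^ 5 else 0) + (if g \<in> G2 then p ^ 3 else 0))"
    proof (rule sum_mono)
      fix g assume g: "g \<in> F"
      have i: "card (K f \<union> K g) + card (K f \<inter> K g) = 6"
        using card_Un_Int[of "K f" "K g"] K[OF f] K[OF g] by simp
      have l: "card (K f \<inter> K g) \<le> 3"
        using card_mono[of "K f" "K f \<inter> K g"] K[OF f] by auto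
      consider "card (K f \<inter> K g) = 0" | "card (K f \<inter> K g) = 1" | "2 \<le> card (K f \<inter> K g)" by linarith
      then show "p ^ card (K f \<union> K g) - p ^ 6 \<le> (if g \<in> G1 then p ^ 5 else 0) + (if g \<in> G2 then p ^ 3 else 0)"
      proof cases
        case 1
        then have "card (K f \<union> K g) = 6" using i by simp
        then show ?thesis using p by simp
      next
        case 2
        then have "K f \<inter> K g \<noteq> {}" by force
        then have "g \<in> G1" using g by (simp add: G1_def)
        moreover have "card (K f \<union> K g) = 5" using 2 i by simp
        moreover have "0 \<le> (if g \<in> G2 then p ^ 3 else 0)" "0 \<le> p ^ 6" using p by auto
        ultimately show ?thesis by (smt (verit))
      next
        case 3
        then have "g \<in> G2" using g by (simp add: G2_def)
        moreover have "p ^ card (K f \<union> K g) \<le> p ^ 3" using i l p by (intro power_decreasing) auto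
        moreover have "0 \<le> (if g \<in> G1 then p ^ 5 else 0)" "0 \<le> p ^ 6" using p by auto
        ultimately show ?thesis by (smt (verit))
      qed
    qed
    also have "\<dots> = card G1 * p ^ 5 + card G2 * p ^ 3"
      using finF by (simp add: sum.distrib sum.If_cases G1_def G2_def Int_def conj_commute cong: conj_cong)
    also have "\<dots> \<le> (9 * n) * p ^ 5 + 27 * p ^ 3"
    proof (intro add_mono mult_right_mono)
      \<comment> \<open>A triple \<open>g\<close> meeting \<open>K f\<close> is decoded from the
        shared element \<open>v\<close>, its role \<open>i\<close> in \<open>g\<close> and one
        further summand \<open>z\<close>. Below, \<open>H2\<close> decodes \<open>g\<close> from two
        shared elements and their roles.\<close>
      define H1 where "H1 = (\<lambda>(v::nat, i::nat, z::nat). if i = 0 then (v, z) else if i = 1 then (z, v) else (z, v - z))"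
      have "G1 \<subseteq> H1 ` (K f \<times> {0..<3} \<times> {1..n})"
      proof
        fix g assume "g \<in> G1"
        then obtain x y v where g: "g = (x, y)" "v \<in> K f" "v \<in> {x, y, x + y}" "(x, y) \<in> F"
          unfolding G1_def by (cases g) (auto simp: K_def)
        have xy: "x \<in> {1..n}" "y \<in> {1..n}" using g F by auto
        consider "v = x" | "v = y" | "v = x + y" using g by auto
        then show "g \<in> H1 ` (K f \<times> {0..<3} \<times> {1..n})"
        proof cases
          case 1 then show ?thesis using g xy by (intro image_eqI[of _ _ "(v, 0, y)"]) (auto simp: H1_def)
        next
          case 2 then show ?thesis using g xy by (intro image_eqI[of _ _ "(v, 1, x)"]) (auto simp: H1_def)
        next
          case 3 then show ?thesis using g xy by (intro image_eqI[of _ _ "(v, 2, x)"]) (auto simp: H1_def)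
        qed
      qed
      then have "card G1 \<le> card (H1 ` (K f \<times> {0..<3} \<times> {1..n}))"
        using K[OF f] by (intro card_mono) auto
      also have "\<dots> \<le> card (K f \<times> {0..<3::nat} \<times> {1..n})"
        using K[OF f] by (intro card_image_le) auto
      also have "\<dots> = 9 * n" using K[OF f] by (simp add: card_cartesian_product)
      finally show "real (card G1) \<le> real (9 * n)" by (rule of_nat_mono)
      define H2 where "H2 = (\<lambda>(v::nat, i::nat, w::nat). if i = 0 then (v, w) else if i = 1 then (v, w - v) else (w - v, v))"
      have "G2 \<subseteq> H2 ` (K f \<times> {0..<3} \<times> K f)"
      proof
        fix g assume "g \<in> G2"
        then obtain x y where g: "g = (x, y)" "2 \<le> card (K f \<inter> {x, y, x + y})" "(x, y) \<in> F"
          unfolding G2_def by (cases g) (auto simp: K_def)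
        have xy: "x \<in> {1..n}" "y \<in> {1..n}" using g F by auto
        obtain W where "W \<subseteq> K f \<inter> {x, y, x + y}" "card W = 2"
          using obtain_subset_with_card_n[OF g(2)] by metis
        then obtain v w where "v \<in> K f \<inter> {x, y, x + y}" "w \<in> K f \<inter> {x, y, x + y}" "v \<noteq> w"
          unfolding card_2_iff by auto
        then consider "x \<in> K f" "y \<in> K f" | "x \<in> K f" "x + y \<in> K f" | "y \<in> K f" "x + y \<in> K f" by auto
        then show "g \<in> H2 ` (K f \<times> {0..<3} \<times> K f)"
        proof cases
          case 1 then show ?thesis using g by (intro image_eqI[of _ _ "(x, 0, y)"]) (auto simp: H2_def)
        next
          case 2 then show ?thesis using g by (intro image_eqI[of _ _ "(x, 1, x + y)"]) (auto simp: H2_def)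
        next
          case 3 then show ?thesis using g by (intro image_eqI[of _ _ "(y, 2, x + y)"]) (auto simp: H2_def)
        qed
      qed
      then have "card G2 \<le> card (H2 ` (K f \<times> {0..<3} \<times> K f))"
        using K[OF f] by (intro card_mono) auto
      also have "\<dots> \<le> card (K f \<times> {0..<3::nat} \<times> K f)"
        using K[OF f] by (intro card_image_le) auto
      also have "\<dots> = 27" using K[OF f] by (simp add: card_cartesian_product)
      finally show "real (card G2) \<le> 27" by simp
    qed (use p in auto)
    finally show "(\<Sum>g\<in>F. p ^ card (K f \<union> K g) - p ^ 6) \<le> (9 * n) * p ^ 5 + 27 * p ^ 3" .
  qed
  also have "\<dots> = card F * ((9 * n) * p ^ 5 + 27 * p ^ 3)" by simp
  finally have B: "\<mu>\<^sup>2 * measure_pmf.prob ?M {S. \<not> (\<exists>f\<in>F. K f \<subseteq> S)} \<le> card F * ((9 * n) * p ^ 5 + 27 * p ^ 3)"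
    using A by linarith
  have Fpos: "0 < real (card F)" using card c n by (smt (verit) mult_pos_pos of_nat_0_less_iff zero_less_power)
  define P0 where "P0 = measure_pmf.prob ?M {S. \<not> (\<exists>f\<in>F. K f \<subseteq> S)}"
  have "card F * (card F * p ^ 6 * P0) \<le> card F * ((9 * n) * p ^ 5 + 27 * p ^ 3)"
    using B by (simp add: \<mu>_def P0_def power2_eq_square algebra_simps flip: power_add)
  then have "card F * p ^ 6 * P0 \<le> (9 * n) * p ^ 5 + 27 * p ^ 3" using Fpos by simp
  moreover have "c * (real n)\<^sup>2 * p ^ 6 * P0 \<le> card F * p ^ 6 * P0"
    using card p by (intro mult_right_mono) (auto simp: P0_def)
  ultimately have "c * (real n)\<^sup>2 * p ^ 6 * P0 \<le> (9 * n) * p ^ 5 + 27 * p ^ 3" by linarith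
  then have "P0 \<le> ((9 * n) * p ^ 5 + 27 * p ^ 3) / (c * (real n)\<^sup>2 * p ^ 6)"
    using c n p by (simp add: pos_le_divide_eq mult.commute)
  also have "\<dots> = (9 / (n * p) + 27 / ((real n)\<^sup>2 * p ^ 3)) / c"
    using c n p by (simp add: field_simps power2_eq_square eval_nat_numeral)
  finally show ?thesis unfolding P0_def K_def by (simp add: case_prod_beta)
qed

section \<open>Popular differences\<close>

text \<open>Cauchy-Schwarz over at most \<open>m\<close> fibres of \<open>\<pi>\<close> yields at
  least \<open>(card T)^2 / m\<close> ordered pairs within a fibre; by \<open>2 \<le> c * L\<close>
  the diagonal is at most half of this. The other pairs have a difference in \<open>{1..L}\<close>
  up to order. If too few differences were popular, those would account for at most
  \<open>card T\<close> pairs each and the rest for little each, which is too few in total; the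
  count would already fail with 8 in place of 12. The fibres will be rows, columns and antidiagonals
  of a set of pairs, or a single fibre.\<close>

lemma popular_differences:
  fixes T :: "'a set" and \<pi> :: "'a \<Rightarrow> 'b" and q :: "'a \<Rightarrow> nat" and c :: real and m L :: nat
  assumes fin: "finite T" and m: "card (\<pi> ` T) \<le> m" "0 < m"
    and inj: "\<And>P Q. P \<in> T \<Longrightarrow> Q \<in> T \<Longrightarrow> \<pi> P = \<pi> Q \<Longrightarrow> q P = q Q \<Longrightarrow> P = Q"
    and spread: "\<And>P Q. P \<in> T \<Longrightarrow> Q \<in> T \<Longrightarrow> \<pi> P = \<pi> Q \<Longrightarrow> q Q \<le> q P + L"
    and big: "c * m * L \<le> card T" "2 \<le> c * L" and c: "0 < c" "c \<le> 1"
  shows "c\<^sup>2 / 12 * L \<le> card {d \<in> {1..L}. c\<^sup>2 / 12 * m * L \<le> card {P \<in> T. \<exists>Q\<in>T. \<pi> Q = \<pi> P \<and> q Q = q P + d}}"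
proof (rule ccontr)
  define N where "N = (\<lambda>d. {P \<in> T. \<exists>Q\<in>T. \<pi> Q = \<pi> P \<and> q Q = q P + d})"
  define c1 where "c1 = c\<^sup>2 / 12"
  define D where "D = {d \<in> {1..L}. c1 * m * L \<le> card (N d)}"
  define K where "K = real (card T)"
  assume "\<not> ?thesis"
  then have D: "card D < c1 * L" unfolding D_def N_def c1_def by simp
  have c1: "c1 > 0" using c unfolding c1_def by simp
  have finN: "finite (N d)" for d using fin unfolding N_def by simp
  define F where "F = (\<lambda>f. {P \<in> T. \<pi> P = f})"
  define S where "S = (SIGMA P:T. F (\<pi> P))"
  define R where "R = {(P, Q). P \<in> T \<and> Q \<in> T \<and> \<pi> P = \<pi> Q \<and> q P < q Q}"
  have finR: "finite R" unfolding R_def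
    by (rule finite_subset[of _ "T \<times> T"]) (use fin in auto)
  have "K = (\<Sum>f\<in>\<pi> ` T. real (card (F f)))"
    unfolding K_def F_def using card_eq_sum[of T] sum.group[OF fin, of "\<pi> ` T" \<pi> "\<lambda>_. 1::real"] fin
    by simp
  then have "K\<^sup>2 \<le> (\<Sum>f\<in>\<pi> ` T. (real (card (F f)))\<^sup>2) * card (\<pi> ` T)"
    using sum_squared_le_sum_of_squares[of "\<lambda>f. real (card (F f))" "\<pi> ` T"] by simp
  also have "\<dots> \<le> (\<Sum>f\<in>\<pi> ` T. (real (card (F f)))\<^sup>2) * m"
    using m by (intro mult_left_mono) (auto intro: sum_nonneg)
  also have "(\<Sum>f\<in>\<pi> ` T. (real (card (F f)))\<^sup>2) = card S"
  proof -
    have "real (card S) = (\<Sum>P\<in>T. real (card (F (\<pi> P))))"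
      unfolding S_def F_def using fin by (simp add: card_SigmaI)
    also have "\<dots> = (\<Sum>f\<in>\<pi> ` T. \<Sum>P\<in>{P\<in>T. \<pi> P = f}. real (card (F (\<pi> P))))"
      using fin by (intro sum.group[symmetric]) auto
    also have "\<dots> = (\<Sum>f\<in>\<pi> ` T. (real (card (F f)))\<^sup>2)"
      by (intro sum.cong refl) (simp add: F_def power2_eq_square)
    finally show ?thesis by simp
  qed
  finally have KS: "K\<^sup>2 \<le> real (card S) * real m" by simp
  have "S \<subseteq> (\<lambda>P. (P, P)) ` T \<union> R \<union> prod.swap ` R"
  proof
    fix z assume "z \<in> S"
    then obtain P Q where z: "z = (P, Q)" "P \<in> T" "Q \<in> T" "\<pi> Q = \<pi> P" unfolding S_def F_def by auto
    consider "q P = q Q" | "q P < q Q" | "q Q < q P" by (rule linorder_cases)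
    then consider "P = Q" | "(P, Q) \<in> R" | "(Q, P) \<in> R"
    proof cases
      case 1
      then show ?thesis using that(1) inj[OF z(2,3) z(4)[symmetric]] by blast
    next
      case 2
      then show ?thesis using that(2) z by (simp add: R_def)
    next
      case 3
      then show ?thesis using that(3) z by (simp add: R_def)
    qed
    then show "z \<in> (\<lambda>P. (P, P)) ` T \<union> R \<union> prod.swap ` R"
    proof cases
      case 3
      then have "prod.swap (Q, P) \<in> prod.swap ` R" by (rule imageI)
      then show ?thesis using z by simp
    qed (use z in auto)
  qed
  then have "card S \<le> card ((\<lambda>P. (P, P)) ` T \<union> R \<union> prod.swap ` R)"
    using fin finR by (intro card_mono) auto
  also have "\<dots> \<le> card ((\<lambda>P. (P, P)) ` T) + card R + card (prod.swap ` R)"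
    by (meson add_le_mono card_Un_le le_refl le_trans)
  also have "\<dots> \<le> card T + card R + card R"
    by (intro add_mono card_image_le fin finR) auto
  finally have SR: "real (card S) \<le> K + 2 * real (card R)" unfolding K_def by linarith
  have "card R \<le> card (SIGMA d:{1..L}. N d)"
  proof (rule card_inj_on_le[where f = "\<lambda>(P, Q). (q Q - q P, P)"])
    show "inj_on (\<lambda>(P, Q). (q Q - q P, P)) R"
    proof (rule inj_onI, clarsimp)
      fix P Q Q' assume "(P, Q) \<in> R" "(P, Q') \<in> R" "q Q - q P = q Q' - q P"
      then show "Q = Q'" using inj[of Q Q'] unfolding R_def by auto
    qed
    show "(\<lambda>(P, Q). (q Q - q P, P)) ` R \<subseteq> (SIGMA d:{1..L}. N d)"
    proof clarsimp
      fix P Q assume "(P, Q) \<in> R"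
      then show "Suc 0 \<le> q Q - q P \<and> q Q - q P \<le> L \<and> P \<in> N (q Q - q P)"
        using spread[of P Q] unfolding R_def N_def by (auto intro!: bexI[of _ Q])
    qed
  qed (use finN in auto)
  also have "\<dots> = (\<Sum>d\<in>{1..L}. card (N d))" using finN by (simp add: card_SigmaI)
  finally have "real (card R) \<le> (\<Sum>d\<in>{1..L}. real (card (N d)))" by (metis of_nat_mono of_nat_sum)
  also have "\<dots> \<le> (\<Sum>d\<in>{1..L}. (if d \<in> D then K else 0) + c1 * m * L)"
  proof (rule sum_mono)
    fix d assume d: "d \<in> {1..L}"
    have "card (N d) \<le> card T" unfolding N_def using fin by (intro card_mono) auto
    then show "real (card (N d)) \<le> (if d \<in> D then K else 0) + c1 * m * L"
      using d mult_nonneg_nonneg[of "c1 * m" L] c1 unfolding D_def K_def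
      by (auto simp: not_le less_imp_le intro: add_increasing2)
  qed
  also have "\<dots> = real (card D) * K + L * (c1 * m * L)"
    by (subst sum.distrib) (simp add: sum.If_cases D_def Int_def conj_commute cong: conj_cong)
  finally have R: "real (card R) \<le> real (card D) * K + L * (c1 * m * L)" .
  have K: "c * m * L \<le> K" using big unfolding K_def by simp
  have L: "L > 0" using big c by (cases "L = 0") auto
  have Kpos: "K > 0" using K L c m by (smt (verit) mult_pos_pos of_nat_0_less_iff)
  have "real (card D) * K < c1 * L * K" using D Kpos by simp
  moreover have "L * (c1 * m * L) * c \<le> c1 * L * K"
  proof -
    have "L * (c1 * m * L) * c = (c1 * L) * (c * m * L)" by (simp add: algebra_simps)
    also have "\<dots> \<le> (c1 * L) * K" using K c1 by (intro mult_left_mono) auto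
    finally show ?thesis .
  qed
  moreover have "K\<^sup>2 - K * m \<le> 2 * real (card R) * m"
  proof -
    have "K\<^sup>2 \<le> (K + 2 * real (card R)) * m" using KS mult_right_mono[OF SR of_nat_0_le_iff[of m]] by simp
    then show ?thesis by (simp add: algebra_simps)
  qed
  moreover have "K * m \<le> K\<^sup>2 / 2"
  proof -
    have "2 * real m \<le> c * L * m" using big m by (intro mult_right_mono) auto
    then have "2 * real m \<le> K" using K by (simp add: algebra_simps)
    then have "K * (2 * real m) \<le> K * K" using Kpos by (intro mult_left_mono) auto
    then show ?thesis by (simp add: power2_eq_square)
  qed
  ultimately have 1: "K\<^sup>2 / 2 \<le> 2 * real (card R) * m" and 2: "c * real (card R) < c * (c1 * L * K) + c1 * L * K"
  proof -
    assume a: "real (card D) * K < c1 * L * K" "L * (c1 * m * L) * c \<le> c1 * L * K"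
      "K\<^sup>2 - K * m \<le> 2 * real (card R) * m" "K * m \<le> K\<^sup>2 / 2"
    show "K\<^sup>2 / 2 \<le> 2 * real (card R) * m" using a by linarith
    have "c * real (card R) \<le> c * (real (card D) * K) + L * (c1 * m * L) * c"
      using R c mult_left_mono[OF R, of c] by (simp add: algebra_simps)
    also have "\<dots> < c * (c1 * L * K) + c1 * L * K"
      using a c by (intro add_less_le_mono mult_strict_left_mono) auto
    finally show "c * real (card R) < c * (c1 * L * K) + c1 * L * K" .
  qed
  have "c * (c1 * L * K) \<le> 1 * (c1 * L * K)"
    using c c1 Kpos by (intro mult_right_mono) auto
  then have "c * real (card R) < 2 * (c1 * L * K)" using 2 by linarith
  then have "c * real (card R) * m < 2 * (c1 * L * K) * m" using m by (intro mult_strict_right_mono) auto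
  moreover have "c * (K\<^sup>2 / 2) \<le> c * (2 * real (card R) * m)" using 1 c by (intro mult_left_mono) auto
  ultimately have "c * K * K < (c1 * 8) * (real m * real L) * K" by (simp add: power2_eq_square algebra_simps)
  then have "c * K < (c1 * 8) * (real m * real L)" using Kpos by simp
  moreover have "c * (c * m * L) \<le> c * K" using K c by (intro mult_left_mono) auto
  ultimately have "c\<^sup>2 * (real m * real L) < (c\<^sup>2 * (8 / 12)) * (real m * real L)"
    unfolding c1_def by (simp add: power2_eq_square algebra_simps)
  moreover have "(c\<^sup>2 * (8 / 12)) * (real m * real L) \<le> c\<^sup>2 * (real m * real L)"
    by (intro mult_right_mono) auto
  ultimately show False by linarith
qed

section \<open>Random elements taken from sets of popular differences\<close>

lemma prob_miss_le:
  assumes q: "0 \<le> r" "r \<le> q" "q \<le> 1" and D: "D \<subseteq> {1..n}" "k \<le> real (card D)"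
    and E: "\<And>S. E S \<Longrightarrow> S \<inter> D = {}"
  shows "measure_pmf.prob (random_subset n q) {S. E S} \<le> exp (- r * k)"
proof -
  have "measure_pmf.prob (random_subset n q) {S. E S} \<le> measure_pmf.prob (random_subset n q) {S. S \<inter> D = {}}"
    using E by (intro measure_pmf.finite_measure_mono) auto
  also have "\<dots> \<le> exp (- q * card D)"
    using q D by (intro prob_random_disjoint_le) auto
  also have "\<dots> \<le> exp (- r * k)"
  proof -
    have "r * k \<le> r * card D" using q D by (intro mult_left_mono) auto
    also have "\<dots> \<le> q * card D" using q by (intro mult_right_mono) auto
    finally show ?thesis by simp
  qed
  finally show ?thesis .
qed

text \<open>The elements \<open>d\<close>, \<open>e\<close>, \<open>g\<close> are exposed one after
  another, each popular for what the previous ones leave: \<open>d\<close> along the rows of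
  \<open>T\<close>, \<open>e\<close> along the columns of the pairs that extend by \<open>d\<close>,
  and \<open>g\<close> along the antidiagonals of the corners of the resulting rectangles. The
  window has side \<open>L\<close> rather than \<open>n\<close> so that the result also applies to a
  small cluster of elements just below \<open>n / 2\<close>.\<close>

lemma prob_schur_dense:
  fixes c :: real
  assumes c: "0 < c" "c \<le> 1"
  shows "\<exists>\<delta>>0. \<forall>n L s s' p A T. 0 < p \<longrightarrow> p \<le> 1 \<longrightarrow> L \<le> n \<longrightarrow> 1 \<le> \<delta> * p * L \<longrightarrow>
    T \<subseteq> {(x, y). x \<in> A \<and> y \<in> A \<and> x + y \<in> A} \<longrightarrow> T \<subseteq> {s<..s + L} \<times> {s'<..s' + L} \<longrightarrow>
    c * (real L)\<^sup>2 \<le> card T \<longrightarrow>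
    measure_pmf.prob (random_subset n p) {S. \<not> is_schur (A \<union> S)} \<le> 3 * exp (- \<delta> * p * L)"
proof -
  define c1 where "c1 = c\<^sup>2 / 12"
  define c2 where "c2 = c1\<^sup>2 / 12"
  \<comment> \<open>Up to \<open>2 * L\<close> antidiagonals meet the window, against
    \<open>L\<close> rows or columns, which halves the density.\<close>
  define c3 where "c3 = (c2 / 2)\<^sup>2 / 12"
  \<comment> \<open>Splitting the random set twice leaves density at least \<open>p / 4\<close> for
    each of the three elements.\<close>
  define \<delta> where "\<delta> = c3 / 4"
  have sq: "x\<^sup>2 / 12 > 0" "x\<^sup>2 / 12 \<le> 1" "x\<^sup>2 / 12 \<le> x" if "0 < x" "x \<le> 1" for x :: real
  proof -
    have "x * x \<le> x" using that mult_left_le[of x x] by simp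
    then have *: "x * x \<le> 12" "x * x \<le> 12 * x" using that by linarith+
    show "x\<^sup>2 / 12 > 0" using that by simp
    show "x\<^sup>2 / 12 \<le> 1" "x\<^sup>2 / 12 \<le> x" unfolding power2_eq_square using * by linarith+
  qed
  have c1: "0 < c1" "c1 \<le> 1" "c1 \<le> c" using sq[OF c] by (simp_all add: c1_def)
  have c2: "0 < c2" "c2 \<le> 1" "c2 \<le> c1" using sq[OF c1(1,2)] by (simp_all add: c2_def)
  have c3: "0 < c3" "c3 \<le> c2 / 2" using sq[of "c2 / 2"] c2 by (simp_all add: c3_def)
  have \<delta>: "\<delta> > 0" using c3 by (simp add: \<delta>_def)
  show ?thesis
  proof (rule exI[of _ \<delta>], intro conjI allI impI \<delta>)
    fix n L s s' :: nat and p :: real and A :: "nat set" and T :: "(nat \<times> nat) set"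
    assume p: "0 < p" "p \<le> 1" and Ln: "L \<le> n" and big: "1 \<le> \<delta> * p * L"
      and TA: "T \<subseteq> {(x, y). x \<in> A \<and> y \<in> A \<and> x + y \<in> A}"
      and TL: "T \<subseteq> {s<..s + L} \<times> {s'<..s' + L}" and cT: "c * (real L)\<^sup>2 \<le> card T"
    have finT: "finite T" by (rule finite_subset[OF TL]) simp
    have "\<delta> * p * L \<le> \<delta> * 1 * L" using p \<delta> by (intro mult_right_mono mult_left_mono) auto
    then have "1 \<le> \<delta> * L" using big by simp
    then have L4: "4 \<le> c3 * L" by (simp add: \<delta>_def)
    have mono: "4 \<le> x * L" if "c3 \<le> x" for x
      using L4 mult_right_mono[OF that, of "real L"] by simp
    have Lc: "2 \<le> c * L" "2 \<le> c1 * L" "2 \<le> c2 / 2 * L"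
      using mono[of c] mono[of c1] mono[of "c2 / 2"] c1 c2 c3 by auto
    have L0: "0 < L" using L4 by (cases "L = 0") auto
    have inT: "s < fst P \<and> fst P \<le> s + L \<and> s' < snd P \<and> snd P \<le> s' + L" if "P \<in> T" for P
      using TL that by (cases P) auto
    define T1 where "T1 = (\<lambda>d. {P \<in> T. \<exists>Q\<in>T. snd Q = snd P \<and> fst Q = fst P + d})"
    define D1 where "D1 = {d \<in> {1..L}. c1 * L * L \<le> card (T1 d)}"
    have D1: "c1 * L \<le> card D1"
      unfolding D1_def T1_def c1_def
    proof (rule popular_differences[OF finT])
      show "card (snd ` T) \<le> L" using card_mono[of "{s'<..s' + L}" "snd ` T"] TL by force
      show "c * L * L \<le> card T" using cT by (simp add: power2_eq_square)
      fix P Q assume "P \<in> T" "Q \<in> T" "snd P = snd Q"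
      then show "fst Q \<le> fst P + L"
        using inT[of P] inT[of Q] by auto
    qed (use L0 Lc c in \<open>auto simp: prod_eq_iff\<close>)
    define T2 where "T2 = (\<lambda>d e. {P \<in> T1 d. \<exists>Q\<in>T1 d. fst Q = fst P \<and> snd Q = snd P + e})"
    define D2 where "D2 = (\<lambda>d. {e \<in> {1..L}. c2 * L * L \<le> card (T2 d e)})"
    have T1T: "T1 d \<subseteq> T" for d unfolding T1_def by auto
    have fin1: "finite (T1 d)" for d using T1T finT finite_subset by blast
    have D2: "c2 * L \<le> card (D2 d)" if "d \<in> D1" for d
      unfolding D2_def T2_def c2_def
    proof (rule popular_differences[OF fin1])
      show "card (fst ` T1 d) \<le> L"
        using card_mono[of "{s<..s + L}" "fst ` T1 d"] TL T1T[of d] by force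
      show "c1 * L * L \<le> card (T1 d)" using that by (simp add: D1_def)
      fix P Q assume "P \<in> T1 d" "Q \<in> T1 d" "fst P = fst Q"
      then show "snd Q \<le> snd P + L"
        using inT[OF subsetD[OF T1T, of P d]] inT[OF subsetD[OF T1T, of Q d]] by auto
    qed (use L0 Lc c1 in \<open>auto simp: prod_eq_iff\<close>)
    define D3 where "D3 = (\<lambda>d e. {g \<in> {1..L}. c3 * (2 * L)* L \<le>
      card {P \<in> T2 d e. \<exists>Q\<in>T2 d e. fst Q + snd Q = fst P + snd P \<and> fst Q = fst P + g}})"
    have T2T: "T2 d e \<subseteq> T" for d e using T1T unfolding T2_def by auto
    have fin2: "finite (T2 d e)" for d e using T2T finT finite_subset by blast
    have D3: "c3 * L \<le> card (D3 d e)" if "e \<in> D2 d" for d e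
      unfolding D3_def c3_def
    proof (rule popular_differences[OF fin2])
      have "card ((\<lambda>P. fst P + snd P) ` T2 d e) \<le> card {s + s'<..s + s' + 2 * L}"
      proof (rule card_mono, simp, rule image_subsetI)
        fix P assume "P \<in> T2 d e"
        then show "fst P + snd P \<in> {s + s'<..s + s' + 2 * L}"
          using inT[OF subsetD[OF T2T, of P d e]] by auto
      qed
      then show "card ((\<lambda>P. fst P + snd P) ` T2 d e) \<le> 2 * L" by simp
      show "c2 / 2 * (2 * L) * L \<le> card (T2 d e)" using that by (simp add: D2_def)
      fix P Q assume PQ: "P \<in> T2 d e" "Q \<in> T2 d e" "fst P + snd P = fst Q + snd Q"
      then show "fst Q \<le> fst P + L"
        using inT[OF subsetD[OF T2T, of P d e]] inT[OF subsetD[OF T2T, of Q d e]] by auto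
      show "fst P = fst Q \<Longrightarrow> P = Q" using PQ by (simp add: prod_eq_iff)
    qed (use L0 Lc c2 in auto)
    have schur: "is_schur (A \<union> W)" if deg: "d \<in> W" "e \<in> W" "g \<in> W" "g \<in> D3 d e" for d e g W
    proof -
      have "c3 * (2 * L)* L > 0" using c3 L0 by simp
      then obtain P where "P \<in> {P \<in> T2 d e. \<exists>Q\<in>T2 d e. fst Q + snd Q = fst P + snd P \<and> fst Q = fst P + g}"
        using deg(4) unfolding D3_def by (smt (verit) card.empty equals0I mem_Collect_eq of_nat_0)
      then obtain Q where PQ: "P \<in> T2 d e" "Q \<in> T2 d e" "fst Q + snd Q = fst P + snd P" "fst Q = fst P + g"
        by auto
      obtain x y x' y' where "P = (x, y)" "Q = (x', y')" by (cases P, cases Q) blast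
      then have xy: "(x, y) \<in> T2 d e" "(x', y') \<in> T2 d e" "x' + y' = x + y" "x' = x + g"
        using PQ by auto
      then have y: "y = y' + g" by simp
      have T1s: "(u, v) \<in> T \<and> (u + d, v) \<in> T" if "(u, v) \<in> T1 d" for u v using that unfolding T1_def by auto
      have T2s: "(u, v) \<in> T1 d \<and> (u, v + e) \<in> T1 d" if "(u, v) \<in> T2 d e" for u v
        using that unfolding T2_def by auto
      have TV: "u \<in> A \<and> v \<in> A \<and> u + v \<in> A" if "(u, v) \<in> T" for u v using TA that by auto
      have k: "u \<in> A" "u + d \<in> A" "v \<in> A" "v + e \<in> A" "u + v \<in> A" "u + d + v \<in> A"
        "u + (v + e) \<in> A" "u + d + (v + e) \<in> A" if "(u, v) \<in> T2 d e" for u v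
        using TV T1s T2s[OF that] by blast+
      \<comment> \<open>As \<open>y = y' + g\<close>, the second corner is
        \<open>(x + g, y')\<close>: the two rectangles share their four sums, which is the cube
        required.\<close>
      show ?thesis
        by (rule is_schur_cube[of d _ e g x y'])
          (use deg k[OF xy(1)] k[OF xy(2)] xy(4) y in \<open>auto simp: ac_simps\<close>)
    qed
    define E where "E = exp (- \<delta> * p * L)"
    have hit: "measure_pmf.prob (random_subset n q) {S. B S} \<le> E"
      if "p / 4 \<le> q" "q \<le> 1" "D \<subseteq> {1..L}" "c3 * L \<le> card D" "\<And>S. B S \<Longrightarrow> S \<inter> D = {}" for q D B
    proof -
      have "measure_pmf.prob (random_subset n q) {S. B S} \<le> exp (- (p / 4) * (c3 * L))"
        using that Ln p by (intro prob_miss_le[where D = D]) auto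
      then show ?thesis by (simp add: E_def \<delta>_def algebra_simps)
    qed
    have E0: "0 \<le> E" by (simp add: E_def)
    have cc: "c3 * L \<le> c1 * L" "c3 * L \<le> c2 * L" using c1 c2 c3 by (intro mult_right_mono; simp)+
    have "measure_pmf.prob (random_subset n p) {S. \<not> is_schur (A \<union> S)} \<le> E + (E + E)"
    proof (rule prob_two_rounds[where P = "\<lambda>S. S \<inter> D1 \<noteq> {}"])
      fix q assume "p / 2 \<le> q" "q \<le> 1"
      then show "measure_pmf.prob (random_subset n q) {S. \<not> S \<inter> D1 \<noteq> {}} \<le> E"
        using p D1 cc by (intro hit[of _ D1]) (auto simp: D1_def)
    next
      fix S q assume S: "S \<inter> D1 \<noteq> {}" and q: "p / 2 \<le> q" "q \<le> 1"
      then obtain d where d: "d \<in> S" "d \<in> D1" by auto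
      show "measure_pmf.prob (random_subset n q) {S'. \<not> is_schur (A \<union> (S \<union> S'))} \<le> E + E"
      proof (rule prob_two_rounds[where P = "\<lambda>S. S \<inter> D2 d \<noteq> {}"])
        fix q' assume "q / 2 \<le> q'" "q' \<le> 1"
        then show "measure_pmf.prob (random_subset n q') {S. \<not> S \<inter> D2 d \<noteq> {}} \<le> E"
          using p q D2[OF d(2)] cc by (intro hit[of _ "D2 d"]) (auto simp: D2_def)
      next
        fix S1 q' assume S1: "S1 \<inter> D2 d \<noteq> {}" and q': "q / 2 \<le> q'" "q' \<le> 1"
        then obtain e where e: "e \<in> S1" "e \<in> D2 d" by auto
        show "measure_pmf.prob (random_subset n q') {S'. \<not> is_schur (A \<union> (S \<union> (S1 \<union> S')))} \<le> E"
        proof (rule hit[of _ "D3 d e"])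
          fix S' assume n: "\<not> is_schur (A \<union> (S \<union> (S1 \<union> S')))"
          show "S' \<inter> D3 d e = {}"
            using schur[of d "S \<union> (S1 \<union> S')" e] n d e by blast
        qed (use q q' D3[OF e(2)] in \<open>auto simp: D3_def\<close>)
      qed (use p q E0 in auto)
    qed (use p E0 in auto)
    then show "measure_pmf.prob (random_subset n p) {S. \<not> is_schur (A \<union> S)} \<le> 3 * exp (- \<delta> * p * L)"
      by (simp add: E_def)
  qed
qed

section \<open>Two random Schur triples for sets of density one half\<close>

lemma card_less_pairs:
  fixes B :: "nat set"
  assumes "finite B"
  shows "card B * card B \<le> card B + 2 * card {(u, v). u \<in> B \<and> v \<in> B \<and> u < v}"
proof -
  define R where "R = {(u, v). u \<in> B \<and> v \<in> B \<and> u < v}"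
  have finR: "finite R"
    by (rule finite_subset[of _ "B \<times> B"]) (use assms in \<open>auto simp: R_def\<close>)
  have "B \<times> B \<subseteq> (\<lambda>u. (u, u)) ` B \<union> (R \<union> prod.swap ` R)"
  proof
    fix z assume "z \<in> B \<times> B"
    then obtain u v where z: "z = (u, v)" "u \<in> B" "v \<in> B" by auto
    consider "u = v" | "u < v" | "v < u" by (rule linorder_cases)
    then show "z \<in> (\<lambda>u. (u, u)) ` B \<union> (R \<union> prod.swap ` R)"
    proof cases
      case 3
      then have "prod.swap (v, u) \<in> prod.swap ` R" using z by (intro imageI) (simp add: R_def)
      then show ?thesis using z by simp
    qed (use z in \<open>auto simp: R_def\<close>)
  qed
  then have "card (B \<times> B) \<le> card ((\<lambda>u. (u, u)) ` B \<union> (R \<union> prod.swap ` R))"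
    using assms finR by (intro card_mono) auto
  also have "\<dots> \<le> card ((\<lambda>u. (u, u)) ` B) + (card R + card (prod.swap ` R))"
    by (meson add_le_mono card_Un_le le_refl le_trans)
  also have "\<dots> \<le> card B + (card R + card R)"
    by (intro add_mono card_image_le assms finR) auto
  finally show ?thesis by (simp add: R_def card_cartesian_product)
qed

lemma popular_differences_nat:
  fixes c :: real and n :: nat
  assumes A: "A \<subseteq> {1..n}" and big: "c * n \<le> card A" "2 \<le> c * n" and c: "0 < c" "c \<le> 1"
  shows "c\<^sup>2 / 12 * n \<le> card {d \<in> {1..n}. c\<^sup>2 / 12 * n \<le> card {a \<in> A. a + d \<in> A}}"
proof -
  have eq: "{a \<in> A. \<exists>b\<in>A. () = () \<and> id b = id a + d} = {a \<in> A. a + d \<in> A}" for d by auto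
  have "card ((\<lambda>_. ()) ` A) \<le> 1" by (rule order_trans[OF card_mono[of UNIV]]) auto
  moreover have "v \<le> u + n" if "u \<in> A" "v \<in> A" for u v using subsetD[OF A that(2)] by auto
  ultimately show ?thesis
    using popular_differences[of A "\<lambda>_. ()" 1 id n c] finite_subset[OF A] big c by (simp add: eq)
qed

text \<open>The bound tends to 0 as soon as \<open>n * p\<close> and \<open>n^2 * p^3\<close> tend
  to infinity. Both rounds use the second moment bound on quadratically many pairs: \<open>F\<close>
  takes a popular difference \<open>x\<close> of \<open>A\<close> and then a popular difference
  \<open>y\<close> of the starting points of \<open>x\<close>, while \<open>G\<close> takes
  differences within the set of starting points common to the triple found in
  \<open>F\<close>.\<close>

lemma prob_schur_half:
  "\<exists>C n0. 0 < C \<and> (\<forall>n A p. n0 \<le> n \<longrightarrow> A \<subseteq> {1..n} \<longrightarrow> n \<le> 2 * card A \<longrightarrow> 0 < p \<longrightarrow> p \<le> 1 \<longrightarrow>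
    measure_pmf.prob (random_subset n p) {S. \<not> is_schur (A \<union> S)} \<le> C * (1 / (n * p) + 1 / ((real n)\<^sup>2 * p ^ 3)))"
proof -
  define c1 :: real where "c1 = (1 / 2)\<^sup>2 / 12"
  define c2 where "c2 = c1\<^sup>2 / 12"
  \<comment> \<open>A common lower density for \<open>F\<close>, which has at least
    \<open>c1 * c2 / 2 * n^2\<close> pairs, and for \<open>G\<close>, which has at least
    \<open>k * k / 4\<close> pairs with \<open>k \<ge> c2 * n\<close>.\<close>
  define \<kappa> where "\<kappa> = c2\<^sup>2 / 4"
  have c: "c1 = 1 / 48" "c2 = 1 / 27648" unfolding c2_def c1_def by (simp_all add: power2_eq_square)
  have c01: "0 < c1" "c1 \<le> 1" unfolding c by simp_all
  have \<kappa>: "0 < \<kappa>" "\<kappa> \<le> c1 * c2 / 2" unfolding \<kappa>_def c by (simp_all add: power2_eq_square)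
  \<comment> \<open>Ten times \<open>1 / c2\<close>: a set of \<open>c2 * n\<close> elements then
    has at least ten, enough to absorb the linear terms below.\<close>
  define n0 :: nat where "n0 = 276480"
  show ?thesis
  proof (rule exI[of _ "432 / \<kappa>"], rule exI[of _ n0], intro conjI allI impI)
    show "0 < 432 / \<kappa>" using \<kappa> by simp
    fix n :: nat and A :: "nat set" and p :: real
    assume n: "n0 \<le> n" and A: "A \<subseteq> {1..n}" and half: "n \<le> 2 * card A" and p: "0 < p" "p \<le> 1"
    have finA: "finite A" using A finite_subset by blast
    have n1: "2 \<le> 1 / 2 * real n" "2 \<le> c1 * n" "10 \<le> c2 * n" "0 < n" using n unfolding n0_def c by auto
    define A1 where "A1 = (\<lambda>x. {a \<in> A. a + x \<in> A})"
    define D1 where "D1 = {x \<in> {1..n}. c1 * n \<le> card (A1 x)}"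
    have A1A: "A1 x \<subseteq> {1..n}" for x using A unfolding A1_def by auto
    have fin1: "finite (A1 x)" for x using finite_subset[OF A1A] by simp
    have le: "a \<le> n" "1 \<le> a" if "a \<in> A" for a using A that by auto
    have D1: "c1 * n \<le> card D1"
      unfolding D1_def A1_def c1_def using half n1 by (intro popular_differences_nat[OF A]) auto
    define A2 where "A2 = (\<lambda>x y. {a \<in> A1 x. a + y \<in> A1 x})"
    define D2 where "D2 = (\<lambda>x. {y \<in> {1..n}. c2 * n \<le> card (A2 x y)})"
    have D2: "c2 * n \<le> card (D2 x)" if "x \<in> D1" for x
      unfolding D2_def A2_def c2_def
      using that n1 c01 by (intro popular_differences_nat[OF A1A]) (auto simp: D1_def)
    have A2: "a \<in> A \<and> a + x \<in> A \<and> a + y \<in> A \<and> a + x + y \<in> A" if "a \<in> A2 x y" for a x y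
      using that unfolding A2_def A1_def by (auto simp: ac_simps)
    define F where "F = (SIGMA x:D1. D2 x - {x})"
    have FD: "F \<subseteq> {(x, y). 1 \<le> x \<and> 1 \<le> y \<and> x \<noteq> y \<and> x + y \<le> n}"
    proof clarify
      fix x y assume "(x, y) \<in> F"
      then have xy: "x \<in> D1" "y \<in> D2 x" "x \<noteq> y" by (auto simp: F_def)
      have "card (A2 x y) \<noteq> 0" using xy(2) n1 by (auto simp: D2_def)
      then obtain a where "a \<in> A2 x y" by (metis card.empty equals0I)
      then have "a + x + y \<in> A" using A2 by auto
      then show "1 \<le> x \<and> 1 \<le> y \<and> x \<noteq> y \<and> x + y \<le> n" using xy le by (fastforce simp: D1_def D2_def)
    qed
    have FC: "\<kappa> * (real n)\<^sup>2 \<le> card F"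
    proof -
      have fin: "finite D1" "finite (D2 x)" for x unfolding D1_def D2_def by auto
      have "\<kappa> * (real n)\<^sup>2 \<le> c1 * c2 / 2 * (real n)\<^sup>2" using \<kappa> by (intro mult_right_mono) auto
      also have "\<dots> = (c1 * n) * (c2 * n / 2)" by (simp add: power2_eq_square)
      also have "\<dots> \<le> card D1 * (c2 * n / 2)" using D1 n1 by (intro mult_right_mono) auto
      also have "\<dots> = (\<Sum>x\<in>D1. c2 * n / 2)" by simp
      also have "\<dots> \<le> (\<Sum>x\<in>D1. real (card (D2 x - {x})))"
      proof (rule sum_mono)
        fix x assume "x \<in> D1"
        then have "c2 * n \<le> card (D2 x)" by (rule D2)
        moreover have "card (D2 x) \<le> card (D2 x - {x}) + 1"
          using diff_card_le_card_Diff[of "{x}" "D2 x"] by simp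
        ultimately show "c2 * n / 2 \<le> real (card (D2 x - {x}))" using n1 by linarith
      qed
      also have "\<dots> = card F" unfolding F_def using fin by simp
      finally show ?thesis .
    qed
    \<comment> \<open>The bound of \<open>prob_no_triple\<close> at density \<open>p / 2\<close>: 9
      is doubled and 27 is multiplied by 8.\<close>
    define E where "E = (18 / (n * p) + 216 / ((real n)\<^sup>2 * p ^ 3)) / \<kappa>"
    have triple: "measure_pmf.prob (random_subset n q) {S. Bd S} \<le> E"
      if "p / 2 \<le> q" "q \<le> 1" "G \<subseteq> {(x, y). 1 \<le> x \<and> 1 \<le> y \<and> x \<noteq> y \<and> x + y \<le> n}"
        "\<kappa> * (real n)\<^sup>2 \<le> card G" "\<And>S. Bd S \<Longrightarrow> \<not> (\<exists>(x, y)\<in>G. {x, y, x + y} \<subseteq> S)" for q G Bd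
    proof -
      have q: "0 < q" using that p by simp
      have "measure_pmf.prob (random_subset n q) {S. Bd S} \<le>
        measure_pmf.prob (random_subset n q) {S. \<not> (\<exists>(x, y)\<in>G. {x, y, x + y} \<subseteq> S)}"
        using that(5) by (intro measure_pmf.finite_measure_mono) auto
      also have "\<dots> \<le> (9 / (n * q) + 27 / ((real n)\<^sup>2 * q ^ 3)) / \<kappa>"
        using that q \<kappa> n1 by (intro prob_no_triple) auto
      also have "\<dots> \<le> (9 / (n * (p / 2)) + 27 / ((real n)\<^sup>2 * (p / 2) ^ 3)) / \<kappa>"
        using that q p \<kappa> n1
        by (intro divide_right_mono add_mono divide_left_mono mult_left_mono power_mono mult_pos_pos) auto
      also have "\<dots> = E" unfolding E_def by (simp add: power3_eq_cube)
      finally show ?thesis .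
    qed
    have "measure_pmf.prob (random_subset n p) {S. \<not> is_schur (A \<union> S)} \<le> E + E"
    proof (rule prob_two_rounds[where P = "\<lambda>S. \<exists>(x, y)\<in>F. {x, y, x + y} \<subseteq> S"])
      fix q assume "p / 2 \<le> q" "q \<le> 1"
      then show "measure_pmf.prob (random_subset n q) {S. \<not> (\<exists>(x, y)\<in>F. {x, y, x + y} \<subseteq> S)} \<le> E"
        using FD FC by (intro triple[of _ F])
    next
      fix S q assume S: "\<exists>(x, y)\<in>F. {x, y, x + y} \<subseteq> S" and q: "p / 2 \<le> q" "q \<le> 1"
      then obtain x y where xy: "(x, y) \<in> F" "{x, y, x + y} \<subseteq> S" by auto
      define B where "B = A2 x y"
      define k where "k = card B"
      have "y \<in> D2 x" using xy by (auto simp: F_def)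
      then have k: "c2 * n \<le> k" by (simp add: k_def B_def D2_def)
      have k10: "10 \<le> k" using k n1 by linarith
      have finB: "finite B" unfolding B_def A2_def using fin1 by simp
      have "B \<noteq> {}" using k10 by (auto simp: k_def)
      then have b: "Min B \<in> B" "\<And>u. u \<in> B \<Longrightarrow> Min B \<le> u" using finB by auto
      \<comment> \<open>Taking the least element as common base point leaves quadratically many
        choices for the other two points and makes the passage to differences injective.\<close>
      define b where "b = Min B"
      have Bn: "u \<le> n" "1 \<le> u" if "u \<in> B" for u using A2[of u x y] le that by (auto simp: B_def)
      define R where "R = {(u, v). u \<in> B \<and> v \<in> B \<and> u < v}"
      \<comment> \<open>Drops the pairs with \<open>u = b\<close> and those with equal differences,
        since \<open>prob_no_triple\<close> counts triples of three distinct elements; the cost is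
        at most \<open>2 * k\<close> pairs.\<close>
      define R' where "R' = {(u, v). u \<in> B \<and> v \<in> B \<and> u < v \<and> b < u \<and> u - b \<noteq> v - u}"
      define G where "G = {(f, g). 1 \<le> f \<and> 1 \<le> g \<and> f \<noteq> g \<and> b + f \<in> B \<and> b + f + g \<in> B}"
      have GD: "G \<subseteq> {(x, y). 1 \<le> x \<and> 1 \<le> y \<and> x \<noteq> y \<and> x + y \<le> n}"
        using Bn unfolding G_def by fastforce
      have finG: "finite G" by (rule finite_subset[of _ "{..n} \<times> {..n}"]) (use GD in auto)
      have finR': "finite R'" by (rule finite_subset[of _ "B \<times> B"]) (use finB in \<open>auto simp: R'_def\<close>)
      have "card R' \<le> card G"
      proof (rule card_inj_on_le[OF _ _ finG])
        show "inj_on (\<lambda>(u, v). (u - b, v - u)) R'" by (rule inj_onI) (auto simp: R'_def)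
        show "(\<lambda>(u, v). (u - b, v - u)) ` R' \<subseteq> G" by (auto simp: R'_def G_def)
      qed
      moreover have "R \<subseteq> R' \<union> ((\<lambda>v. (b, v)) ` B \<union> (\<lambda>u. (u, u + (u - b))) ` B)"
        using b(2) unfolding R_def R'_def b_def[symmetric] by (force simp: image_iff le_less)
      then have "card R \<le> card (R' \<union> ((\<lambda>v. (b, v)) ` B \<union> (\<lambda>u. (u, u + (u - b))) ` B))"
        using finB finR' by (intro card_mono) auto
      then have "card R \<le> card R' + (card ((\<lambda>v. (b, v)) ` B) + card ((\<lambda>u. (u, u + (u - b))) ` B))"
        by (meson add_le_mono card_Un_le le_refl le_trans)
      moreover have "card ((\<lambda>v. (b, v)) ` B) \<le> k" "card ((\<lambda>u. (u, u + (u - b))) ` B) \<le> k"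
        unfolding k_def by (intro card_image_le finB)+
      moreover have "k * k \<le> k + 2 * card R"
        using card_less_pairs[OF finB] by (simp add: k_def R_def)
      ultimately have "k * k \<le> 5 * k + 2 * card G" by linarith
      moreover have "10 * k \<le> k * k" using k10 by simp
      ultimately have "k * k \<le> 4 * card G" by linarith
      then have kG: "real k * real k \<le> 4 * card G" by (metis of_nat_le_iff of_nat_mult of_nat_numeral)
      have "(c2 * n) * (c2 * n) \<le> real k * real k" using k n1 by (intro mult_mono) auto
      then have GC: "\<kappa> * (real n)\<^sup>2 \<le> card G" using kG by (simp add: \<kappa>_def power2_eq_square algebra_simps)
      show "measure_pmf.prob (random_subset n q) {S'. \<not> is_schur (A \<union> (S \<union> S'))} \<le> E"
      proof (rule triple[OF q GD GC])
        fix S' assume n: "\<not> is_schur (A \<union> (S \<union> S'))"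
        show "\<not> (\<exists>(f, g)\<in>G. {f, g, f + g} \<subseteq> S')"
        proof
          assume "\<exists>(f, g)\<in>G. {f, g, f + g} \<subseteq> S'"
          then obtain f g where fg: "(f, g) \<in> G" "{f, g, f + g} \<subseteq> S'" by auto
          have "is_schur (A \<union> (S \<union> S'))"
          proof (rule is_schur_two_triples[of x y f g _ b])
            show "{x, y, x + y, f, g, f + g} \<subseteq> A \<union> (S \<union> S')" using xy fg by auto
            fix u assume "u \<in> {b, b + f, b + f + g}"
            then have "u \<in> A2 x y" using fg b(1) by (auto simp: G_def B_def b_def)
            then show "{u, u + x, u + y, u + x + y} \<subseteq> A \<union> (S \<union> S')" using A2 by blast
          qed
          then show False using n by simp
        qed
      qed
    qed (use p \<kappa> in \<open>auto simp: E_def\<close>)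
    also have "E + E = 36 / \<kappa> * (1 / (n * p)) + 432 / \<kappa> * (1 / ((real n)\<^sup>2 * p ^ 3))"
      by (simp add: E_def add_divide_distrib mult.commute mult.left_commute)
    also have "\<dots> \<le> 432 / \<kappa> * (1 / (n * p)) + 432 / \<kappa> * (1 / ((real n)\<^sup>2 * p ^ 3))"
      using \<kappa> p by (intro add_mono mult_right_mono divide_right_mono) auto
    finally show "measure_pmf.prob (random_subset n p) {S. \<not> is_schur (A \<union> S)} \<le>
        432 / \<kappa> * (1 / (n * p) + 1 / ((real n)\<^sup>2 * p ^ 3))"
      by (simp only: distrib_left)
  qed
qed

section \<open>Stability of sets with few Schur triples\<close>

text \<open>The number of positions violating the rule that a shift by \<open>h\<close> preserves (\<open>b = True\<close>) or
  reverses (\<open>b = False\<close>) membership in \<open>A\<close>.\<close>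

definition mismatch :: "nat set \<Rightarrow> nat \<Rightarrow> bool \<Rightarrow> nat \<Rightarrow> nat" where
  "mismatch A n b h = card {y \<in> {1..n}. y + h \<le> n \<and> ((y \<in> A) = (y + h \<in> A)) \<noteq> b}"

text \<open>For \<open>a \<in> A\<close> these are the Schur triples of \<open>A\<close> with
  \<open>a\<close> as a fixed summand, so the sum over \<open>A\<close> counts all Schur triples of
  \<open>A\<close> as ordered pairs.\<close>

definition repetitions :: "nat set \<Rightarrow> nat \<Rightarrow> nat" where
  "repetitions A a = card {y \<in> A. y + a \<in> A}"

lemma card_shift_le:
  fixes S :: "nat set"
  assumes "finite S"
  shows "card {y. y + k \<in> S} \<le> card S"
  by (rule card_inj_on_le[of "\<lambda>y. y + k"]) (use assms in auto)

lemma card_unshift_le: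
  fixes S :: "nat set"
  assumes "finite S"
  shows "card {y. k < y \<and> y - k \<in> S} \<le> card S"
  by (rule card_inj_on_le[of "\<lambda>y. y - k"]) (use assms in \<open>auto intro!: inj_onI\<close>)

lemma mismatch_not: "h \<le> n \<Longrightarrow> mismatch A n b h + mismatch A n (\<not> b) h = n - h"
proof -
  assume h: "h \<le> n"
  let ?S = "\<lambda>b. {y \<in> {1..n}. y + h \<le> n \<and> ((y \<in> A) = (y + h \<in> A)) \<noteq> b}"
  have "{1..n - h} = ?S b \<union> ?S (\<not> b)" using h by auto
  moreover have "card (?S b \<union> ?S (\<not> b)) = card (?S b) + card (?S (\<not> b))"
    by (intro card_Un_disjoint) auto
  ultimately show ?thesis unfolding mismatch_def by (metis card_atLeastAtMost diff_Suc_1)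
qed

text \<open>\<open>b1 = b2\<close> multiplies signs: two reversals compose to a preservation. A
  failure for \<open>h1 + h2\<close> at \<open>y\<close> stems from one for \<open>h1\<close> at
  \<open>y\<close> or one for \<open>h2\<close> at \<open>y + h1\<close>.\<close>

lemma mismatch_add: "mismatch A n (b1 = b2) (h1 + h2) \<le> mismatch A n b1 h1 + mismatch A n b2 h2"
proof -
  let ?S = "\<lambda>b h. {y \<in> {1..n}. y + h \<le> n \<and> ((y \<in> A) = (y + h \<in> A)) \<noteq> b}"
  have "?S (b1 = b2) (h1 + h2) \<subseteq> ?S b1 h1 \<union> {y. y + h1 \<in> ?S b2 h2}"
    by (auto simp: add.assoc)
  moreover have "finite {y. y + h1 \<in> ?S b2 h2}" by (rule finite_subset[of _ "{..n}"]) auto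
  ultimately have "card (?S (b1 = b2) (h1 + h2)) \<le> card (?S b1 h1 \<union> {y. y + h1 \<in> ?S b2 h2})"
    by (intro card_mono) auto
  also have "\<dots> \<le> card (?S b1 h1) + card {y. y + h1 \<in> ?S b2 h2}" by (rule card_Un_le)
  also have "\<dots> \<le> card (?S b1 h1) + card (?S b2 h2)"
    by (intro add_left_mono card_shift_le) simp
  finally show ?thesis unfolding mismatch_def .
qed

text \<open>Compare \<open>y\<close> with \<open>y + h\<close> through \<open>y - k\<close>; the
  positions up to \<open>k\<close> have no such point and give the additive term.\<close>

lemma mismatch_diff: "mismatch A n (b1 = b2) h \<le> k + mismatch A n b1 (h + k) + mismatch A n b2 k"
proof -
  let ?S = "\<lambda>b h. {y \<in> {1..n}. y + h \<le> n \<and> ((y \<in> A) = (y + h \<in> A)) \<noteq> b}"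
  let ?U = "\<lambda>b h. {y. k < y \<and> y - k \<in> ?S b h}"
  have sub: "?S (b1 = b2) h \<subseteq> {1..k} \<union> (?U b1 (h + k) \<union> ?U b2 k)"
  proof
    fix y assume y: "y \<in> ?S (b1 = b2) h"
    show "y \<in> {1..k} \<union> (?U b1 (h + k) \<union> ?U b2 k)"
    proof (cases "y \<le> k")
      case True then show ?thesis using y by simp
    next
      case False
      then obtain z where z: "y = z + k" "0 < z" by (metis add.commute less_imp_add_positive not_le)
      have eq: "z + (h + k) = z + k + h" by simp
      show ?thesis using y z by (auto simp: eq)
    qed
  qed
  have fin: "finite (?U b h')" for b h' by (rule finite_subset[of _ "{..n + k}"]) auto
  have "card (?S (b1 = b2) h) \<le> card ({1..k} \<union> (?U b1 (h + k) \<union> ?U b2 k))"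
    using sub fin by (intro card_mono) auto
  also have "\<dots> \<le> card {1..k} + (card (?U b1 (h + k)) + card (?U b2 k))"
    by (meson add_le_mono card_Un_le le_refl le_trans)
  also have "\<dots> \<le> k + (card (?S b1 (h + k)) + card (?S b2 k))"
    by (intro add_mono card_unshift_le) auto
  finally show ?thesis unfolding mismatch_def by simp
qed

text \<open>Because \<open>A\<close> has at least half of the elements, the pairs \<open>y\<close>,
  \<open>y + a\<close> with both ends outside \<open>A\<close> exceed those with both ends inside by
  at most \<open>card (A \<inter> {1..a})\<close>. This follows by counting \<open>A\<close> once
  through lower ends and once through upper ends.\<close>

lemma mismatch_le_repetitions:
  assumes A: "A \<subseteq> {1..n}" and half: "n \<le> 2 * card A" and a: "a \<le> n"
  shows "mismatch A n False a \<le> card (A \<inter> {1..a}) + 2 * repetitions A a"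
proof -
  have finA: "finite A" using A finite_subset by blast
  let ?P = "\<lambda>b c. {y \<in> {1..n - a}. (y \<in> A) = b \<and> (y + a \<in> A) = c}"
  have fin: "finite (?P b c)" for b c by simp
  have e: "{1..n - a} = (?P True True \<union> ?P False False) \<union> (?P True False \<union> ?P False True)" by auto
  have "card ((?P True True \<union> ?P False False) \<union> (?P True False \<union> ?P False True))
      = card (?P True True \<union> ?P False False) + card (?P True False \<union> ?P False True)"
    using fin by (intro card_Un_disjoint) auto
  also have "card (?P True True \<union> ?P False False) = card (?P True True) + card (?P False False)"
    using fin by (intro card_Un_disjoint) auto
  also have "card (?P True False \<union> ?P False True) = card (?P True False) + card (?P False True)"
    using fin by (intro card_Un_disjoint) auto
  finally have "card {1..n - a} = (card (?P True True) + card (?P False False)) + (card (?P True False) + card (?P False True))"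
    by (subst e)
  then have 1: "n - a = (card (?P True True) + card (?P False False)) + (card (?P True False) + card (?P False True))"
    by (simp only: card_atLeastAtMost diff_Suc_1)
  have "{y \<in> {1..n}. y + a \<le> n \<and> ((y \<in> A) = (y + a \<in> A)) \<noteq> False} = ?P True True \<union> ?P False False"
    using a by auto
  then have m: "mismatch A n False a = card (?P True True) + card (?P False False)"
    unfolding mismatch_def by (simp only:) (rule card_Un_disjoint; auto)
  have r: "repetitions A a = card (?P True True)"
    unfolding repetitions_def using A by (intro arg_cong[where f = card]) force
  have "A \<inter> {1..n - a} = ?P True True \<union> ?P True False" by auto
  then have 2: "card (A \<inter> {1..n - a}) = card (?P True True) + card (?P True False)"
    by (simp add: card_Un_disjoint disjoint_iff)
  have "A \<inter> {a<..n} = (\<lambda>y. y + a) ` (?P True True \<union> ?P False True)"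
  proof
    show "A \<inter> {a<..n} \<subseteq> (\<lambda>y. y + a) ` (?P True True \<union> ?P False True)"
    proof
      fix z assume "z \<in> A \<inter> {a<..n}"
      then show "z \<in> (\<lambda>y. y + a) ` (?P True True \<union> ?P False True)"
        by (intro image_eqI[of _ _ "z - a"]) auto
    qed
  qed (use a in auto)
  then have 3: "card (A \<inter> {a<..n}) = card (?P True True) + card (?P False True)"
    by (simp add: card_image card_Un_disjoint disjoint_iff)
  have "A \<subseteq> (A \<inter> {1..n - a}) \<union> {n - a<..n}" using A by auto
  then have "card A \<le> card ((A \<inter> {1..n - a}) \<union> {n - a<..n})" by (intro card_mono) auto
  also have "\<dots> \<le> card (A \<inter> {1..n - a}) + card {n - a<..n}" by (rule card_Un_le)
  finally have 4: "card A \<le> card (A \<inter> {1..n - a}) + a" using a by simp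
  have "A = (A \<inter> {1..a}) \<union> (A \<inter> {a<..n})" using A by auto
  then have 5: "card A \<le> card (A \<inter> {1..a}) + card (A \<inter> {a<..n})" by (metis card_Un_le)
  show ?thesis using 1 2 3 4 5 m r half a by linarith
qed

text \<open>Markov's inequality, as the repetitions of the elements of \<open>A\<close> add up to
  the number of its Schur triples.\<close>

lemma card_bad_le:
  fixes e :: real
  assumes "finite A" "0 < e" and T: "card {(x, y). x \<in> A \<and> y \<in> A \<and> x + y \<in> A} \<le> e\<^sup>2"
  shows "card {a \<in> A. e < repetitions A a} \<le> e"
proof -
  let ?B = "{a \<in> A. e < repetitions A a}"
  have "e * card ?B = (\<Sum>a\<in>?B. e)" by simp
  also have "\<dots> \<le> (\<Sum>a\<in>?B. real (repetitions A a))" by (intro sum_mono) auto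
  also have "\<dots> = card (SIGMA a:?B. {y \<in> A. y + a \<in> A})"
    using assms(1) by (simp add: repetitions_def)
  also have "\<dots> \<le> card {(x, y). x \<in> A \<and> y \<in> A \<and> x + y \<in> A}"
  proof (intro of_nat_mono card_mono)
    show "finite {(x, y). x \<in> A \<and> y \<in> A \<and> x + y \<in> A}"
      by (rule finite_subset[of _ "A \<times> A"]) (use assms(1) in auto)
  qed (auto simp: add.commute)
  also have "\<dots> \<le> e * e" using T by (simp add: power2_eq_square)
  finally show ?thesis using assms(2) by simp
qed

lemma card_Un_le3: "card (A \<union> (B \<union> C)) \<le> card A + (card B + card C)"
  by (meson add_le_mono card_Un_le le_refl le_trans)

lemma card_Un_le4: "card (A \<union> (B \<union> (C \<union> D))) \<le> card A + (card B + (card C + card D))"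
  by (meson add_le_mono card_Un_le le_refl le_trans)

text \<open>A shift by \<open>a\<close> nearly reverses membership, so \<open>A\<close> nearly contains \<open>(a, 2a]\<close>, nearly avoids
  \<open>(2a, 3a]\<close> and nearly contains \<open>(3a, 4a]\<close>. If \<open>n\<close> exceeds \<open>3a\<close> this produces too many Schur triples.\<close>

lemma stability_large_min:
  fixes e :: real
  assumes A: "A \<subseteq> {1..n}" and half: "n \<le> 2 * card A" and a: "a \<in> A"
    and e: "real n = 10 ^ 11 * e" "100 \<le> e"
    and rep: "repetitions A a \<le> e" and low: "card (A \<inter> {1..<a}) \<le> e" and large: "100 * e < a"
    and T: "card {(x, y). x \<in> A \<and> y \<in> A \<and> x + y \<in> A} \<le> e\<^sup>2"
  shows "200 * card (A \<inter> {1..n div 2}) \<le> n"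
proof -
  have finA: "finite A" using A finite_subset by blast
  have an: "1 \<le> a" "a \<le> n" using a A by auto
  \<comment> \<open>The failures of reversal, indexed by the upper end, so that knowledge about one
    interval of length \<open>a\<close> passes to the next at the cost of
    \<open>card Z\<close>.\<close>
  define Z where "Z = {z. a < z \<and> z \<le> n \<and> (z \<in> A) = (z - a \<in> A)}"
  have finZ: "finite Z" unfolding Z_def by (rule finite_subset[of _ "{..n}"]) auto
  have pa: "card (A \<inter> {1..a}) \<le> e + 1"
  proof -
    have "A \<inter> {1..a} \<subseteq> insert a (A \<inter> {1..<a})" by auto
    then have "card (A \<inter> {1..a}) \<le> card (insert a (A \<inter> {1..<a}))" by (intro card_mono) auto
    also have "\<dots> = Suc (card (A \<inter> {1..<a}))" by simp
    finally show ?thesis using low by linarith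
  qed
  have "card Z \<le> mismatch A n False a"
    unfolding mismatch_def by (rule card_inj_on_le[of "\<lambda>z. z - a"]) (auto simp: Z_def intro!: inj_onI)
  then have Z: "card Z \<le> 4 * e"
    using mismatch_le_repetitions[OF A half an(2)] pa rep e by linarith
  define J1 where "J1 = {a<..min (2 * a) n} - A"
  define J2 where "J2 = {2 * a<..min (3 * a) n} \<inter> A"
  define J3 where "J3 = {3 * a<..min (4 * a) n} - A"
  have fin: "finite J1" "finite J2" "finite J3" unfolding J1_def J2_def J3_def by auto
  have shift: "card J' \<le> card Z + card J" if "J' \<subseteq> Z \<union> (\<lambda>y. y + a) ` J" "finite J" for J J' :: "nat set"
  proof -
    have "card J' \<le> card (Z \<union> (\<lambda>y. y + a) ` J)" using that finZ by (intro card_mono) auto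
    also have "\<dots> \<le> card Z + card ((\<lambda>y. y + a) ` J)" by (rule card_Un_le)
    also have "\<dots> \<le> card Z + card J" using card_image_le[OF that(2)] by simp
    finally show ?thesis .
  qed
  have "card J1 \<le> card Z + card (A \<inter> {1..a})"
  proof (rule shift, rule subsetI)
    fix y assume "y \<in> J1"
    then show "y \<in> Z \<union> (\<lambda>y. y + a) ` (A \<inter> {1..a})"
      unfolding J1_def Z_def by (cases "y - a \<in> A") (auto intro!: image_eqI[of _ _ "y - a"])
  qed simp
  then have J1: "card J1 \<le> 6 * e" using Z pa e by linarith
  have "card J2 \<le> card Z + card J1"
  proof (rule shift[OF _ fin(1)], rule subsetI)
    fix y assume "y \<in> J2"
    then show "y \<in> Z \<union> (\<lambda>y. y + a) ` J1"
      unfolding J1_def J2_def Z_def by (cases "y - a \<in> A") (auto intro!: image_eqI[of _ _ "y - a"])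
  qed
  then have J2: "card J2 \<le> 10 * e" using Z J1 by linarith
  have "card J3 \<le> card Z + card J2"
  proof (rule shift[OF _ fin(2)], rule subsetI)
    fix y assume "y \<in> J3"
    then show "y \<in> Z \<union> (\<lambda>y. y + a) ` J2"
      unfolding J3_def J2_def Z_def by (cases "y - a \<in> A") (auto intro!: image_eqI[of _ _ "y - a"])
  qed
  then have J3: "card J3 \<le> 14 * e" using Z J2 by linarith
  have "A \<inter> {1..n div 2} \<subseteq> (A \<inter> {1..<a}) \<union> {a..n div 2}" by auto
  then have "card (A \<inter> {1..n div 2}) \<le> card ((A \<inter> {1..<a}) \<union> {a..n div 2})"
    by (intro card_mono) auto
  also have "\<dots> \<le> card (A \<inter> {1..<a}) + card {a..n div 2}" by (rule card_Un_le)
  finally have cl: "card (A \<inter> {1..n div 2}) \<le> e + real (n div 2 + 1 - a)" using low by simp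
  \<comment> \<open>Counting \<open>A\<close> without its nearly empty stretch
    \<open>(2a, 3a]\<close> shows that \<open>a\<close> is at least about \<open>n / 2\<close> if
    \<open>n \<le> 3 * a\<close>, and that \<open>4 * a\<close> hardly exceeds \<open>n\<close>
    otherwise.\<close>
  have "A \<subseteq> (A \<inter> {1..<a}) \<union> ({a..2 * a} \<union> (J2 \<union> {3 * a<..n}))"
    using A unfolding J2_def by force
  then have "card A \<le> card ((A \<inter> {1..<a}) \<union> ({a..2 * a} \<union> (J2 \<union> {3 * a<..n})))"
    using fin by (intro card_mono) auto
  also have "\<dots> \<le> card (A \<inter> {1..<a}) + (card {a..2 * a} + (card J2 + card {3 * a<..n}))"
    by (rule card_Un_le4)
  finally have cA: "n / 2 \<le> e + (a + 1) + 10 * e + real (n - 3 * a)" using low J2 half by simp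
  show ?thesis
  proof (cases "n \<le> 3 * a")
    case True
    then have "n / 2 \<le> e + (a + 1) + 10 * e" using cA by simp
    then have "card (A \<inter> {1..n div 2}) \<le> 14 * e" using cl e by linarith
    then have "real (200 * card (A \<inter> {1..n div 2})) \<le> real n" using e by simp
    then show ?thesis by (simp only: of_nat_le_iff)
  next
    case False
    then have "n / 2 \<le> 12 * e + a + (real n - 3 * a)" using cA e by simp
    then have n4: "4 * real a \<le> n + 24 * e" by simp
    \<comment> \<open>For \<open>x\<close> among the last \<open>h\<close> numbers up to
      \<open>2 * a\<close> and \<open>z\<close> among the first \<open>h\<close> after
      \<open>3 * a\<close>, also \<open>z - x\<close> lies in \<open>(a, 2a]\<close>. All three
      positions are in nearly full intervals, so all but \<open>26 * e * h\<close> of the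
      \<open>h * h\<close> pairs give Schur triples, where \<open>26 = 6 + 6 + 14\<close>.\<close>
    define h where "h = a div 2"
    have h: "2 * h \<le> a" "a \<le> 2 * h + 1" unfolding h_def by auto
    have he: "40 * e \<le> h" using h(2) large e by linarith
    have n3: "3 * a + h \<le> n" using n4 h large by linarith
    define X where "X = {2 * a - h<..2 * a}"
    define Y where "Y = {3 * a<..3 * a + h}"
    define G where "G = {(x, z) \<in> X \<times> Y. x \<in> A \<and> z \<in> A \<and> z - x \<in> A}"
    have cXY: "card X = h" "card Y = h" unfolding X_def Y_def using h by auto
    have sub: "X \<times> Y \<subseteq> G \<union> (J1 \<times> Y \<union> (X \<times> J3 \<union> (\<lambda>(x, y). (x, x + y)) ` (X \<times> J1)))"
    proof
      fix q assume "q \<in> X \<times> Y"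
      then obtain x z where q: "q = (x, z)" "x \<in> X" "z \<in> Y" by auto
      have xz: "2 * a - h < x" "x \<le> 2 * a" "3 * a < z" "z \<le> 3 * a + h" using q unfolding X_def Y_def by auto
      have xA: "x \<in> J1 \<or> x \<in> A" and zA: "z \<in> J3 \<or> z \<in> A" and yA: "z - x \<in> J1 \<or> z - x \<in> A"
        using xz h n3 False unfolding J1_def J3_def by auto
      have "x \<le> z" using xz by linarith
      then have "z - x \<in> J1 \<Longrightarrow> q \<in> (\<lambda>(x, y). (x, x + y)) ` (X \<times> J1)"
        using q by (intro image_eqI[of _ _ "(x, z - x)"]) auto
      then show "q \<in> G \<union> (J1 \<times> Y \<union> (X \<times> J3 \<union> (\<lambda>(x, y). (x, x + y)) ` (X \<times> J1)))"
        using q xA zA yA unfolding G_def by blast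
    qed
    have finG: "finite G" by (rule finite_subset[of _ "X \<times> Y"]) (auto simp: G_def X_def Y_def)
    have finXY: "finite X" "finite Y" unfolding X_def Y_def by auto
    have "card (X \<times> Y) \<le> card (G \<union> (J1 \<times> Y \<union> (X \<times> J3 \<union> (\<lambda>(x, y). (x, x + y)) ` (X \<times> J1))))"
      using sub finG fin finXY by (intro card_mono) auto
    also have "\<dots> \<le> card G + (card (J1 \<times> Y) + (card (X \<times> J3) + card ((\<lambda>(x, y). (x, x + y)) ` (X \<times> J1))))"
      by (rule card_Un_le4)
    also have "\<dots> \<le> card G + (card (J1 \<times> Y) + (card (X \<times> J3) + card (X \<times> J1)))"
      using card_image_le[of "X \<times> J1"] fin finXY by simp
    finally have "h * h \<le> card G + (card J1 * h + (h * card J3 + h * card J1))"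
      by (simp add: card_cartesian_product cXY)
    then have "real (h * h) \<le> real (card G + (card J1 * h + (h * card J3 + h * card J1)))"
      by (rule of_nat_mono)
    then have "real h * h \<le> card G + h * (2 * real (card J1) + card J3)" by (simp add: algebra_simps)
    moreover have "h * (2 * real (card J1) + card J3) \<le> h * (26 * e)"
      using J1 J3 by (intro mult_left_mono) auto
    moreover have "card G \<le> e\<^sup>2"
    proof -
      have "finite {(x, y). x \<in> A \<and> y \<in> A \<and> x + y \<in> A}"
        by (rule finite_subset[of _ "A \<times> A"]) (use finA in auto)
      then have "card G \<le> card {(x, y). x \<in> A \<and> y \<in> A \<and> x + y \<in> A}"
      proof (rule card_inj_on_le[of "\<lambda>(x, z). (x, z - x)", rotated 2])
        show "inj_on (\<lambda>(x, z). (x, z - x)) G" "(\<lambda>(x, z). (x, z - x)) ` G \<subseteq> {(x, y). x \<in> A \<and> y \<in> A \<and> x + y \<in> A}"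
          unfolding inj_on_def G_def X_def Y_def by auto
      qed
      then show ?thesis using T by linarith
    qed
    ultimately have "h * (h - 26 * e) \<le> e * e" by (simp add: algebra_simps power2_eq_square)
    moreover have "(40 * e) * (14 * e) \<le> h * (h - 26 * e)" using he e by (intro mult_mono) auto
    ultimately have "559 * (e * e) \<le> 0" by simp
    moreover have "0 < e * e" using e by simp
    ultimately show ?thesis by linarith
  qed
qed

text \<open>Every \<open>h \<le> 2B\<close> nearly preserves or nearly reverses \<open>A\<close>, and the type is additive in \<open>h\<close>.
  As \<open>a\<close> reverses, so does \<open>1\<close>, hence the type of \<open>h\<close> is its parity. Then \<open>A\<close> has few
  pairs of opposite parity at distance at most \<open>2B\<close>, and the parity that dominates in the first
  block of length \<open>B\<close> dominates in all of them.\<close>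

lemma stability_small_min:
  fixes e :: real
  assumes A: "A \<subseteq> {1..n}" and half: "n \<le> 2 * card A" and a: "a \<in> A"
    and e: "real n = 10 ^ 11 * e" "100 \<le> e"
    and rep: "repetitions A a \<le> e" and small: "a \<le> 100 * e"
    and bad: "card {a \<in> A. e < repetitions A a} \<le> e"
  shows "200 * card {x \<in> A. even x} \<le> n"
proof -
  have finA: "finite A" using A finite_subset by blast
  have ge1: "1 \<le> x" "x \<le> n" if "x \<in> A" for x using A that by auto
  \<comment> \<open>Types will be certified by at most \<open>15 * B\<close> mismatches. Three such
    bounds add up to less than \<open>n - 2 * B\<close>, so a shift up to \<open>2 * B\<close> never
    has both types, even after one addition.\<close>
  define B where "B = n div 400"
  have B: "400 * B \<le> n" "n < 400 * B + 400" unfolding B_def by auto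
  have eN: "real n = 100000000000 * e" using e by simp
  have Be: "400 * real B \<le> 100000000000 * e" "100000000000 * e \<le> 401 * real B"
    using B eN e(2) by linarith+
  have aB: "a \<le> B" using small Be e(2) by linarith
  let ?M = "mismatch A n"
  define Bad where "Bad = {a \<in> A. e < repetitions A a}"
  define X where "X = {a \<in> A. repetitions A a \<le> e}"
  have AX: "A = Bad \<union> X" unfolding Bad_def X_def by auto
  have finBX: "finite Bad" "finite X" using finA unfolding Bad_def X_def by auto
  have cBad: "card Bad \<le> e" using bad unfolding Bad_def .
  have aX: "a \<in> X" using a rep by (simp add: X_def)
  have MX: "?M False x \<le> x + 2 * e" if "x \<in> X" for x
  proof -
    have "x \<le> n" using that ge1 by (auto simp: X_def)
    moreover have "card (A \<inter> {1..x}) \<le> card {1..x}" by (intro card_mono) auto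
    ultimately show ?thesis
      using mismatch_le_repetitions[OF A half, of x] that by (simp add: X_def)
  qed
  \<comment> \<open>Reversal by \<open>a\<close> fails here with both ends outside \<open>A\<close>;
    off \<open>U\<close>, one of \<open>z\<close> and \<open>z - a\<close> belongs to
    \<open>A\<close>.\<close>
  define U where "U = {y. a < y \<and> y \<le> n \<and> y \<notin> A \<and> y - a \<notin> A}"
  have finU: "finite U" unfolding U_def by (rule finite_subset[of _ "{..n}"]) auto
  have "card U \<le> ?M False a"
    unfolding mismatch_def by (rule card_inj_on_le[of "\<lambda>z. z - a"]) (auto simp: U_def intro!: inj_onI)
  then have U: "card U \<le> 102 * e" using MX[OF aX] small by linarith
  have type_ex: "\<exists>b. ?M b h \<le> 15 * B" if h: "h \<le> 2 * B" for h
  proof -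
    define S0 where "S0 = {y \<in> A. a < y \<and> y \<le> 2 * B}"
    have finS0: "finite S0" using finA unfolding S0_def by simp
    have "{a<..2 * B} \<subseteq> S0 \<union> ((\<lambda>y. y + a) ` ({1..a} \<union> S0) \<union> U)"
    proof
      fix y assume y: "y \<in> {a<..2 * B}"
      show "y \<in> S0 \<union> ((\<lambda>y. y + a) ` ({1..a} \<union> S0) \<union> U)"
      proof (cases "y - a \<in> A")
        case True
        then have "y - a \<in> {1..a} \<union> S0" using y by (auto simp: S0_def)
        then have "y \<in> (\<lambda>y. y + a) ` ({1..a} \<union> S0)" using y by (intro image_eqI[of _ _ "y - a"]) auto
        then show ?thesis by blast
      next
        case False
        then show ?thesis using y B by (auto simp: S0_def U_def)
      qed
    qed
    then have "card {a<..2 * B} \<le> card (S0 \<union> ((\<lambda>y. y + a) ` ({1..a} \<union> S0) \<union> U))"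
      using finS0 finU by (intro card_mono) auto
    also have "\<dots> \<le> card S0 + (card ((\<lambda>y. y + a) ` ({1..a} \<union> S0)) + card U)" by (rule card_Un_le3)
    also have "card ((\<lambda>y. y + a) ` ({1..a} \<union> S0)) \<le> card ({1..a} \<union> S0)"
      using finS0 by (intro card_image_le) auto
    also have "\<dots> \<le> a + card S0" using card_Un_le[of "{1..a}" S0] by simp
    finally have "2 * B - a \<le> card S0 + (a + card S0 + card U)" by simp
    then have S0: "2 * real B \<le> 2 * card S0 + 2 * a + 102 * e" using U aB by linarith
    \<comment> \<open>The unusable \<open>y\<close>. For any other \<open>y\<close> in
      \<open>S0\<close>, \<open>h\<close> is \<open>(y + h) - y\<close> or
      \<open>(y + h - a) + a - y\<close>, a combination of two or three good shifts, which are all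
      reversing.\<close>
    define Ex where "Ex = Bad \<union> ({y. y + h \<in> U} \<union> ({y. y + h \<in> Bad} \<union> {y. a < y + h \<and> y + h - a \<in> Bad}))"
    have "card Ex \<le> card Bad + (card {y. y + h \<in> U} + (card {y. y + h \<in> Bad} + card {y. a < y + h \<and> y + h - a \<in> Bad}))"
      unfolding Ex_def by (rule card_Un_le4)
    moreover have "card {y. y + h \<in> U} \<le> card U" "card {y. y + h \<in> Bad} \<le> card Bad"
      using finU finBX by (intro card_shift_le; simp)+
    moreover have "card {y. a < y + h \<and> y + h - a \<in> Bad} \<le> card Bad"
      by (rule card_inj_on_le[of "\<lambda>y. y + h - a"]) (use finBX in \<open>auto intro!: inj_onI\<close>)
    ultimately have Ex: "card Ex \<le> 105 * e" using cBad U by linarith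
    have finEx: "finite Ex"
      unfolding Ex_def using finBX finite_subset[of "{y. y + h \<in> U}" "{..n}"]
        finite_subset[of "{y. y + h \<in> Bad}" "{..n}"] finite_subset[of "{y. a < y + h \<and> y + h - a \<in> Bad}" "{..n + a}"]
        ge1 by (force simp: U_def Bad_def)
    have "real (card Ex) < card S0" using Ex S0 small Be e(2) by linarith
    then have "\<not> S0 \<subseteq> Ex" using card_mono[OF finEx, of S0] by linarith
    then obtain y where y: "y \<in> S0" "y \<notin> Ex" by auto
    have yX: "y \<in> X" "a < y" "y \<le> 2 * B" using y AX unfolding S0_def Ex_def by auto
    have "y + h \<notin> U" using y unfolding Ex_def by auto
    then consider "y + h \<in> A" | "y + h - a \<in> A" using yX h B unfolding U_def by auto
    then show ?thesis
    proof cases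
      case 1
      then have "y + h \<in> X" using y AX unfolding Ex_def by auto
      then have "?M False (h + y) \<le> (h + y) + 2 * e" using MX[of "y + h"] by (simp add: add.commute)
      moreover have "?M True h \<le> y + ?M False (h + y) + ?M False y"
        using mismatch_diff[of A n False False h y] by simp
      ultimately have "real (?M True h) \<le> 15 * real B" using MX[OF yX(1)] h yX Be e(2) by linarith
      then show ?thesis by (intro exI[of _ True]) linarith
    next
      case 2
      then have z: "y + h - a \<in> X" using y yX AX unfolding Ex_def by auto
      have "(y + h - a) + a = h + y" using yX by simp
      then have "?M True (h + y) \<le> ?M False (y + h - a) + ?M False a"
        using mismatch_add[of A n False False "y + h - a" a] by simp
      moreover have "?M False h \<le> y + ?M True (h + y) + ?M False y"
        using mismatch_diff[of A n True False h y] by simp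
      moreover have "real (y + h - a) \<le> 4 * real B" using yX h by linarith
      ultimately have "real (?M False h) \<le> 15 * real B"
        using MX[OF yX(1)] MX[OF z] MX[OF aX] small h yX Be e(2) by linarith
      then show ?thesis by (intro exI[of _ False]) linarith
    qed
  qed
  have step: "?M (b = b1) (h + 1) \<le> 15 * B"
    if "h + 1 \<le> 2 * B" "?M b h \<le> 15 * B" "?M b1 1 \<le> 15 * B" for b b1 h
  proof (rule ccontr)
    assume n: "\<not> ?thesis"
    have "\<exists>b'. ?M b' (h + 1) \<le> 15 * B" using type_ex[OF that(1)] .
    then obtain b' where b': "?M b' (h + 1) \<le> 15 * B" ..
    then have "b' = (\<not> (b = b1))" using n by (cases b'; cases "b = b1") auto
    then have "?M (\<not> (b = b1)) (h + 1) \<le> 15 * B" using b' by simp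
    moreover have "?M (b = b1) (h + 1) + ?M (\<not> (b = b1)) (h + 1) = n - (h + 1)"
      using that B by (intro mismatch_not) auto
    moreover have "?M (b = b1) (h + 1) \<le> ?M b h + ?M b1 1" by (rule mismatch_add)
    ultimately show False using that B aB a ge1(1)[OF a] by linarith
  qed
  have M0: "?M True 0 \<le> 15 * B" by (simp add: mismatch_def)
  have excl: False if "?M True h \<le> 15 * B" "?M False h \<le> 15 * B" "h \<le> 2 * B" for h
    using mismatch_not[of h n A True] that B aB ge1(1)[OF a] by auto
  have fa: "?M False a \<le> 15 * B" using MX[OF aX] small Be e(2) aB by linarith
  have "?M False 1 \<le> 15 * B"
  proof (rule ccontr)
    assume "\<not> ?thesis"
    have "(1::nat) \<le> 2 * B" using aB ge1(1)[OF a] by simp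
    then obtain b where b: "?M b 1 \<le> 15 * B" using type_ex by blast
    then have b: b using \<open>\<not> ?M False 1 \<le> 15 * B\<close> by (cases b) auto
    then have t: "?M True 1 \<le> 15 * B" using \<open>?M b 1 \<le> 15 * B\<close> by simp
    have "?M True h \<le> 15 * B" if "h \<le> 2 * B" for h
      using that
    proof (induction h)
      case (Suc h)
      then show ?case using step[of h True True] t by simp
    qed (rule M0)
    then show False using excl[of a] fa aB by simp
  qed
  then have par: "?M (even h) h \<le> 15 * B" if "h \<le> 2 * B" for h
    using that
  proof (induction h)
    case (Suc h)
    then show ?case using step[of h "even h" False] by simp
  qed (use M0 in simp)
  have odd_X: "odd x" if "x \<in> X" "x \<le> 2 * B" for x
  proof (rule ccontr)
    assume "\<not> odd x"
    then have "?M True x \<le> 15 * B" using par[OF that(2)] by simp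
    moreover have "?M False x \<le> 15 * B" using MX[OF that(1)] that(2) Be e(2) by linarith
    ultimately show False using excl that(2) by blast
  qed
  have odd_a: "odd a" using odd_X[OF aX] aB by simp
  define Oset where "Oset = {u \<in> {1..2 * B}. odd u}"
  have finOset: "finite Oset" unfolding Oset_def by simp
  \<comment> \<open>For an odd \<open>u\<close> outside \<open>A\<close>, \<open>u + a\<close> is
    even and hence not good, so it is bad or lies outside \<open>A\<close>; in the latter case it
    belongs to \<open>U\<close>.\<close>
  have OX: "card (Oset - X) \<le> 204 * e"
  proof -
    have "Oset - X \<subseteq> Bad \<union> ({2 * B - a<..2 * B} \<union> ({u. u + a \<in> U} \<union> {u. u + a \<in> Bad}))"
    proof
      fix u assume "u \<in> Oset - X"
      then have u: "odd u" "1 \<le> u" "u \<le> 2 * B" "u \<notin> X" by (auto simp: Oset_def)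
      show "u \<in> Bad \<union> ({2 * B - a<..2 * B} \<union> ({u. u + a \<in> U} \<union> {u. u + a \<in> Bad}))"
      proof (cases "u \<in> A \<or> 2 * B < u + a")
        case True
        then show ?thesis using u AX by auto
      next
        case False
        then have "u + a \<notin> X" using odd_X[of "u + a"] u odd_a by auto
        then show ?thesis using False u B AX by (auto simp: U_def)
      qed
    qed
    moreover have fin: "finite {u. u + a \<in> U}" "finite {u. u + a \<in> Bad}"
      using finite_vimageI[OF finU, of "\<lambda>u. u + a"] finite_vimageI[OF finBX(1), of "\<lambda>u. u + a"]
      by (auto simp: vimage_def)
    ultimately have "card (Oset - X) \<le> card (Bad \<union> ({2 * B - a<..2 * B} \<union> ({u. u + a \<in> U} \<union> {u. u + a \<in> Bad})))"
      using finBX by (intro card_mono) auto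
    also have "\<dots> \<le> card Bad + (card {2 * B - a<..2 * B} + (card {u. u + a \<in> U} + card {u. u + a \<in> Bad}))"
      by (rule card_Un_le4)
    finally show ?thesis
      using card_shift_le[OF finU, of a] card_shift_le[OF finBX(1), of a] cBad U small aB by simp
  qed
  define P where "P = {(v, w). v \<in> A \<and> w \<in> A \<and> v < w \<and> w \<le> v + 2 * B \<and> odd (w - v)}"
  \<comment> \<open>A distance from \<open>X\<close> occurs at most \<open>e\<close> times; the at
    most \<open>204 * e\<close> remaining odd distances are charged \<open>n\<close> each.\<close>
  have P: "card P \<le> 205 * e * n"
  proof -
    have "card P \<le> card (SIGMA h:Oset. {v \<in> A. v + h \<in> A})"
    proof (rule card_inj_on_le[of "\<lambda>(v, w). (w - v, v)"])
      show "inj_on (\<lambda>(v, w). (w - v, v)) P" "(\<lambda>(v, w). (w - v, v)) ` P \<subseteq> (SIGMA h:Oset. {v \<in> A. v + h \<in> A})"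
        unfolding inj_on_def P_def Oset_def by auto
      show "finite (SIGMA h:Oset. {v \<in> A. v + h \<in> A})" using finOset finA by auto
    qed
    also have "\<dots> = (\<Sum>h\<in>Oset. repetitions A h)" using finOset finA by (simp add: repetitions_def)
    finally have "real (card P) \<le> (\<Sum>h\<in>Oset. real (repetitions A h))" by (metis of_nat_mono of_nat_sum)
    also have "\<dots> \<le> (\<Sum>h\<in>Oset. e + (if h \<in> Oset - X then real n else 0))"
    proof (rule sum_mono)
      fix h assume "h \<in> Oset"
      have "repetitions A h \<le> card A" unfolding repetitions_def using finA by (intro card_mono) auto
      also have "\<dots> \<le> n" using card_mono[OF _ A] by simp
      finally show "real (repetitions A h) \<le> e + (if h \<in> Oset - X then real n else 0)"
        using \<open>h \<in> Oset\<close> e by (auto simp: X_def)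
    qed
    also have "\<dots> = card Oset * e + card (Oset - X) * n"
    proof -
      have "Oset \<inter> {h. h \<notin> X} = Oset - X" by auto
      then show ?thesis using finOset by (simp add: sum.distrib sum.If_cases)
    qed
    also have "\<dots> \<le> n * e + (204 * e) * n"
    proof (intro add_mono mult_right_mono)
      have "card Oset \<le> card {1..2 * B}" unfolding Oset_def by (intro card_mono) auto
      then show "real (card Oset) \<le> real n" using B by simp
    qed (use OX e in auto)
    finally show ?thesis by (simp add: algebra_simps)
  qed
  define ev where "ev = (\<lambda>i. card {x \<in> A. even x \<and> i * B < x \<and> x \<le> i * B + B})"
  \<comment> \<open>Few even elements in block \<open>i\<close> leave at least \<open>B / 4\<close>
    odd ones, and every even element of the next block forms a pair of \<open>P\<close> with each of
    them. Hence there are at most \<open>205 * e * n / (B / 4) \<le> 820 * 401 * e\<close> such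
    elements, a bound that does not grow with \<open>i\<close>.\<close>
  have ev_le: "ev i \<le> 330000 * e" if "i * B + B \<le> n" for i
    using that
  proof (induction i)
    case 0
    have "{x \<in> A. even x \<and> 0 * B < x \<and> x \<le> 0 * B + B} \<subseteq> Bad" using odd_X AX by force
    then have "ev 0 \<le> card Bad" unfolding ev_def using finBX by (intro card_mono) auto
    then show ?case using cBad e by linarith
  next
    case (Suc i)
    define J where "J = {x \<in> A. i * B < x \<and> x \<le> i * B + B}"
    define Od where "Od = {x \<in> A. odd x \<and> i * B < x \<and> x \<le> i * B + B}"
    define Ev' where "Ev' = {x \<in> A. even x \<and> Suc i * B < x \<and> x \<le> Suc i * B + B}"
    have fin: "finite J" "finite Od" "finite Ev'" using finA unfolding J_def Od_def Ev'_def by auto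
    have "{i * B + a<..i * B + B} \<subseteq> J \<union> ((\<lambda>y. y + a) ` J \<union> U)"
    proof
      fix y assume y: "y \<in> {i * B + a<..i * B + B}"
      show "y \<in> J \<union> ((\<lambda>y. y + a) ` J \<union> U)"
      proof (cases "y - a \<in> A")
        case True
        then have "y - a \<in> J" using y by (auto simp: J_def)
        then have "y \<in> (\<lambda>y. y + a) ` J" using y by (intro image_eqI[of _ _ "y - a"]) auto
        then show ?thesis by blast
      next
        case False
        then show ?thesis using y Suc.prems by (auto simp: J_def U_def)
      qed
    qed
    then have "card {i * B + a<..i * B + B} \<le> card (J \<union> ((\<lambda>y. y + a) ` J \<union> U))"
      using fin finU by (intro card_mono) auto
    also have "\<dots> \<le> card J + (card ((\<lambda>y. y + a) ` J) + card U)" by (rule card_Un_le3)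
    also have "\<dots> \<le> card J + (card J + card U)" using card_image_le[OF fin(1)] by simp
    finally have cJ: "B - a \<le> card J + (card J + card U)" by simp
    have "J = Od \<union> {x \<in> A. even x \<and> i * B < x \<and> x \<le> i * B + B}" unfolding J_def Od_def by auto
    then have "card J \<le> card Od + ev i" unfolding ev_def by (metis card_Un_le)
    moreover have "ev i \<le> 330000 * e" using Suc by simp
    ultimately have Od: "real B / 4 \<le> card Od" using cJ aB U small Be e(2) by linarith
    have "(\<lambda>(v, w). (v, w)) ` (Od \<times> Ev') \<subseteq> P"
      unfolding P_def Od_def Ev'_def by auto
    then have "card (Od \<times> Ev') \<le> card P"
    proof (intro card_mono)
      show "finite P" by (rule finite_subset[of _ "A \<times> A"]) (use finA in \<open>auto simp: P_def\<close>)
    qed simp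
    then have "real (card Od) * card Ev' \<le> 205 * e * n"
      using P by (simp add: card_cartesian_product flip: of_nat_mult)
    moreover have "real B / 4 * card Ev' \<le> real (card Od) * card Ev'" using Od by (intro mult_right_mono) auto
    moreover have "205 * e * n \<le> 205 * e * (401 * real B)" using Be eN e by (intro mult_left_mono) auto
    ultimately have "real B * card Ev' \<le> real B * (328820 * e)" by (simp add: algebra_simps)
    moreover have "0 < real B" using aB ge1(1)[OF a] by simp
    ultimately have "card Ev' \<le> 328820 * e" by simp
    then show ?case using e unfolding ev_def Ev'_def by linarith
  qed
  have "n div B \<le> 400"
  proof -
    have "400 \<le> real B" using Be e(2) by linarith
    then have "n < 401 * B" using B by simp
    then have "n div B < 401" by (simp add: less_mult_imp_div_less)
    then show ?thesis by simp
  qed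
  have B0: "0 < B" using aB ge1(1)[OF a] by simp
  have "{x \<in> A. even x} \<subseteq> (\<Union>i<n div B. {x \<in> A. even x \<and> i * B < x \<and> x \<le> i * B + B}) \<union> {n div B * B<..n}"
  proof
    fix x assume "x \<in> {x \<in> A. even x}"
    then have x: "x \<in> A" "even x" "1 \<le> x" "x \<le> n" using ge1 by auto
    define i where "i = (x - 1) div B"
    have "i * B \<le> x - 1" "x - 1 < i * B + B"
      unfolding i_def using B0 by (metis div_times_less_eq_dividend, metis add.commute dividend_less_div_times)
    then have i: "i * B < x" "x \<le> i * B + B" using x by auto
    show "x \<in> (\<Union>i<n div B. {x \<in> A. even x \<and> i * B < x \<and> x \<le> i * B + B}) \<union> {n div B * B<..n}"
    proof (cases "i < n div B")
      case True
      then show ?thesis using x i by auto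
    next
      case False
      then have "n div B * B \<le> i * B" by (intro mult_le_mono1) simp
      then have "n div B * B < x" using i(1) by (rule le_less_trans)
      then show ?thesis using x by simp
    qed
  qed
  then have "card {x \<in> A. even x} \<le> card ((\<Union>i<n div B. {x \<in> A. even x \<and> i * B < x \<and> x \<le> i * B + B}) \<union> {n div B * B<..n})"
    using finA by (intro card_mono) auto
  also have "\<dots> \<le> card (\<Union>i<n div B. {x \<in> A. even x \<and> i * B < x \<and> x \<le> i * B + B}) + card {n div B * B<..n}"
    by (rule card_Un_le)
  also have "\<dots> \<le> (\<Sum>i<n div B. ev i) + (n - n div B * B)"
    unfolding ev_def by (intro add_mono card_UN_le) auto
  finally have "real (card {x \<in> A. even x}) \<le> (\<Sum>i<n div B. real (ev i)) + real (n - n div B * B)"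
    by (metis of_nat_add of_nat_mono of_nat_sum)
  also have "\<dots> \<le> (\<Sum>i<n div B. 330000 * e) + real B"
  proof (intro add_mono sum_mono)
    fix i assume "i \<in> {..<n div B}"
    then have "i + 1 \<le> n div B" by simp
    then have "(i + 1) * B \<le> n" using B0 by (simp add: less_eq_div_iff_mult_less_eq)
    then show "ev i \<le> 330000 * e" by (intro ev_le) simp
  next
    have "n mod B < B" using B0 by simp
    then show "real (n - n div B * B) \<le> real B" by (simp add: minus_div_mult_eq_mod)
  qed
  also have "\<dots> \<le> 400 * (330000 * e) + real B"
  proof -
    have "real (n div B) * (330000 * e) \<le> 400 * (330000 * e)"
      using \<open>n div B \<le> 400\<close> e by (intro mult_right_mono) auto
    then show ?thesis by simp
  qed
  \<comment> \<open>The constant \<open>10 ^ 11\<close> makes room here: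
    \<open>200 * (400 * 330000 * e + B)\<close> has to stay below \<open>n\<close>.\<close>
  finally have "real (200 * card {x \<in> A. even x}) \<le> real n" using Be eN e(2) by simp
  then show ?thesis by (simp only: of_nat_le_iff)
qed

text \<open>Everything turns on the least element \<open>a\<close> of \<open>A\<close> with few
  repetitions. By Markov's inequality at most \<open>e\<close> elements precede it. A small
  \<open>a\<close> forces a parity pattern, a large one pushes \<open>A\<close> into the upper half.
  The bound \<open>10 ^ 13 \<le> n\<close> amounts to \<open>100 \<le> e\<close>.\<close>

lemma stability:
  assumes A: "A \<subseteq> {1..n}" and half: "n \<le> 2 * card A" and n: "10 ^ 13 \<le> n"
    and T: "card {(x, y). x \<in> A \<and> y \<in> A \<and> x + y \<in> A} \<le> (n / 10 ^ 11)\<^sup>2"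
  shows "200 * card (A \<inter> {1..n div 2}) \<le> n \<or> 200 * card {x \<in> A. even x} \<le> n"
proof -
  have finA: "finite A" using A finite_subset by blast
  define e where "e = real n / 10 ^ 11"
  have "real (10 ^ 13) \<le> real n" by (rule of_nat_mono[OF n])
  then have e: "real n = 10 ^ 11 * e" "100 \<le> e" by (simp_all add: e_def)
  define Bad where "Bad = {a \<in> A. e < repetitions A a}"
  have T': "card {(x, y). x \<in> A \<and> y \<in> A \<and> x + y \<in> A} \<le> e\<^sup>2" using T by (simp only: e_def)
  have e0: "0 < e" using e(2) by linarith
  have bad: "card Bad \<le> e" unfolding Bad_def by (rule card_bad_le[OF finA e0 T'])
  have finB: "finite Bad" "finite (A - Bad)" using finA by (auto simp: Bad_def)
  have "real n \<le> 2 * real (card A)" using half by linarith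
  then have "real (card Bad) < card A" using bad e by simp
  then have ne: "A - Bad \<noteq> {}" using card_mono[OF finB(1), of A] by auto
  have a: "Min (A - Bad) \<in> A - Bad" "\<And>x. x \<in> A - Bad \<Longrightarrow> Min (A - Bad) \<le> x"
    by (rule Min_in[OF finB(2) ne], rule Min_le[OF finB(2)])
  define a where "a = Min (A - Bad)"
  have aA: "a \<in> A" and rep: "repetitions A a \<le> e" using a(1) by (auto simp: Bad_def a_def)
  show ?thesis
  proof (cases "a \<le> 100 * e")
    case True
    show ?thesis
      using stability_small_min[OF A half aA e rep True] bad by (simp add: Bad_def)
  next
    case False
    have "A \<inter> {1..<a} \<subseteq> Bad" using a(2) unfolding a_def by fastforce
    then have "card (A \<inter> {1..<a}) \<le> card Bad" using finB by (intro card_mono) auto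
    then have "card (A \<inter> {1..<a}) \<le> e" using bad by linarith
    then show ?thesis
      using stability_large_min[OF A half aA e rep _ _ T'] False by simp
  qed
qed

section \<open>Ladders of exceptional elements\<close>

lemma exists_initial_part:
  fixes S :: "nat set"
  assumes "finite S" "k \<le> card S"
  shows "\<exists>L\<subseteq>S. card L = k \<and> (\<forall>l\<in>L. \<forall>x\<in>S - L. l < x)"
  using assms(2)
proof (induction k)
  case 0
  show ?case by (intro exI[of _ "{}"]) auto
next
  case (Suc k)
  then obtain L where L: "L \<subseteq> S" "card L = k" "\<forall>l\<in>L. \<forall>x\<in>S - L. l < x" by auto
  have fin: "finite L" "finite (S - L)" using assms(1) L finite_subset by auto
  have ne: "S - L \<noteq> {}" using L Suc.prems by auto
  have m: "Min (S - L) \<in> S - L" "\<And>x. x \<in> S - L \<Longrightarrow> Min (S - L) \<le> x"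
    by (rule Min_in[OF fin(2) ne], rule Min_le[OF fin(2)])
  show ?case
  proof (intro exI[of _ "insert (Min (S - L)) L"] conjI ballI)
    fix l x assume "l \<in> insert (Min (S - L)) L" "x \<in> S - insert (Min (S - L)) L"
    then show "l < x" using m(2)[of x] L(3) by (auto simp: le_less)
  qed (use m L fin in auto)
qed

lemma exists_median:
  fixes S :: "nat set"
  assumes "finite S" "S \<noteq> {}"
  shows "\<exists>u\<in>S. card S \<le> 2 * card {v \<in> S. v < u} + 2 \<and> card S \<le> 2 * card {v \<in> S. u < v} + 2"
proof -
  obtain L where L: "L \<subseteq> S" "card L = card S div 2" "\<forall>l\<in>L. \<forall>x\<in>S - L. l < x"
    using exists_initial_part[OF assms(1), of "card S div 2"] by auto
  have fin: "finite L" "finite (S - L)" using assms(1) L finite_subset by auto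
  have cS: "card S > 0" using assms by (simp add: card_gt_0_iff)
  have cd: "card (S - L) = card S - card S div 2" using L fin by (simp add: card_Diff_subset)
  have ne: "S - L \<noteq> {}"
  proof
    assume "S - L = {}"
    then have "card (S - L) = 0" by (simp only: card.empty)
    then show False using cd cS by simp
  qed
  have m: "Min (S - L) \<in> S - L" "\<And>x. x \<in> S - L \<Longrightarrow> Min (S - L) \<le> x"
    by (rule Min_in[OF fin(2) ne], rule Min_le[OF fin(2)])
  have "card L \<le> card {v \<in> S. v < Min (S - L)}"
    using L m assms by (intro card_mono) auto
  moreover have "card (S - L - {Min (S - L)}) \<le> card {v \<in> S. Min (S - L) < v}"
    using m assms by (intro card_mono) (auto simp: le_less)
  moreover have "card (S - L - {Min (S - L)}) = card (S - L) - 1" using m by simp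
  ultimately show ?thesis using m L cd by (intro bexI[of _ "Min (S - L)"]) auto
qed

text \<open>Union bound: by injectivity each map excludes at most \<open>card M\<close> candidates.
  The domains \<open>D\<close> are carried along because truncated subtraction is injective only on
  one side.\<close>

lemma exists_avoiding:
  fixes L :: "(nat set \<times> (nat \<Rightarrow> nat)) list"
  assumes "finite C" "finite M" and inj: "\<And>D g. (D, g) \<in> set L \<Longrightarrow> inj_on g D"
    and card: "length L * card M < card C"
  shows "\<exists>a\<in>C. \<forall>(D, g)\<in>set L. a \<in> D \<longrightarrow> g a \<notin> M"
proof (rule ccontr)
  assume "\<not> ?thesis"
  then have "C \<subseteq> {a \<in> C. \<exists>(D, g)\<in>set L. a \<in> D \<and> g a \<in> M}" by auto
  then have "card C \<le> card {a \<in> C. \<exists>(D, g)\<in>set L. a \<in> D \<and> g a \<in> M}"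
    using assms(1) by (intro card_mono) auto
  also have "\<dots> \<le> length L * card M"
    using inj
  proof (induction L)
    case (Cons p L)
    obtain D g where p: "p = (D, g)" by (cases p)
    have "card {a \<in> C. a \<in> D \<and> g a \<in> M} \<le> card M"
      by (rule card_inj_on_le[of g]) (use Cons.prems[of D g] p assms(2) in \<open>auto intro: inj_on_subset\<close>)
    moreover have "card {a \<in> C. \<exists>(D, g)\<in>set L. a \<in> D \<and> g a \<in> M} \<le> length L * card M"
      using Cons by auto
    moreover have "{a \<in> C. \<exists>(D, g)\<in>set (p # L). a \<in> D \<and> g a \<in> M} =
      {a \<in> C. a \<in> D \<and> g a \<in> M} \<union> {a \<in> C. \<exists>(D, g)\<in>set L. a \<in> D \<and> g a \<in> M}" by (auto simp: p)
    then have "card {a \<in> C. \<exists>(D, g)\<in>set (p # L). a \<in> D \<and> g a \<in> M} \<le>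
      card {a \<in> C. a \<in> D \<and> g a \<in> M} + card {a \<in> C. \<exists>(D, g)\<in>set L. a \<in> D \<and> g a \<in> M}"
      by (simp only: card_Un_le)
    ultimately show ?case by simp
  qed simp
  finally show False using card by simp
qed

text \<open>The middle element of the ladder is fixed as a median of \<open>U\<close>, so
  \<open>d1\<close> and \<open>d2\<close> only have to hit its distances to the smaller and to the
  larger elements. All three targets are then deterministic, and a union bound in a single round
  suffices.\<close>

lemma prob_schur_ladder:
  assumes A: "A \<subseteq> {1..n}" and U: "U \<subseteq> A" and D: "D \<subseteq> {1..n}" "k \<le> card D"
    and k: "0 < k" "2 * k + 2 \<le> card U" and p: "0 < p" "p \<le> 1"
    and H: "\<And>u1 d1 d2 f W. u1 \<in> U \<Longrightarrow> u1 + d1 \<in> U \<Longrightarrow> u1 + d1 + d2 \<in> U \<Longrightarrow> 0 < d1 \<Longrightarrow> 0 < d2 \<Longrightarrow> f \<in> D \<Longrightarrow>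
      {d1, d2, f} \<subseteq> W \<Longrightarrow> is_schur (A \<union> W)"
  shows "measure_pmf.prob (random_subset n p) {S. \<not> is_schur (A \<union> S)} \<le> 3 * exp (- p * k)"
proof -
  let ?P = "measure_pmf.prob (random_subset n p)"
  have Un: "U \<subseteq> {1..n}" using A U by blast
  then have finU: "finite U" using finite_subset by blast
  have "U \<noteq> {}" using k by auto
  then obtain u where u: "u \<in> U" "card U \<le> 2 * card {v \<in> U. v < u} + 2" "card U \<le> 2 * card {v \<in> U. u < v} + 2"
    using exists_median[OF finU] by auto
  define D1 where "D1 = (\<lambda>v. u - v) ` {v \<in> U. v < u}"
  define D2 where "D2 = (\<lambda>v. v - u) ` {v \<in> U. u < v}"
  have "card D1 = card {v \<in> U. v < u}" "card D2 = card {v \<in> U. u < v}"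
    unfolding D1_def D2_def by (intro card_image inj_onI; force)+
  then have c: "k \<le> card D1" "k \<le> card D2" using u k by linarith+
  have sub: "D1 \<subseteq> {1..n}" "D2 \<subseteq> {1..n}"
    using Un u(1) unfolding D1_def D2_def by fastforce+
  have hit: "?P {S. S \<inter> D = {}} \<le> exp (- p * k)" if "D \<subseteq> {1..n}" "k \<le> card D" for D
    using prob_miss_le[of p p D n k "\<lambda>S. S \<inter> D = {}"] that p by simp
  have "?P {S. \<not> is_schur (A \<union> S)} \<le> ?P ({S. S \<inter> D1 = {}} \<union> ({S. S \<inter> D2 = {}} \<union> {S. S \<inter> D = {}}))"
  proof (intro measure_pmf.finite_measure_mono subsetI)
    fix S assume n: "S \<in> {S. \<not> is_schur (A \<union> S)}"
    show "S \<in> {S. S \<inter> D1 = {}} \<union> ({S. S \<inter> D2 = {}} \<union> {S. S \<inter> D = {}})"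
    proof (rule ccontr)
      assume "S \<notin> {S. S \<inter> D1 = {}} \<union> ({S. S \<inter> D2 = {}} \<union> {S. S \<inter> D = {}})"
      then obtain d1 d2 f where d: "d1 \<in> S" "d1 \<in> D1" "d2 \<in> S" "d2 \<in> D2" "f \<in> S" "f \<in> D" by auto
      then obtain v w where vw: "v \<in> U" "v < u" "d1 = u - v" "w \<in> U" "u < w" "d2 = w - u"
        by (auto simp: D1_def D2_def)
      have "is_schur (A \<union> S)"
        by (rule H[of v d1 d2 f]) (use d vw u in auto)
      then show False using n by simp
    qed
  qed simp
  also have "\<dots> \<le> ?P {S. S \<inter> D1 = {}} + ?P ({S. S \<inter> D2 = {}} \<union> {S. S \<inter> D = {}})"
    by (rule measure_subadditive) auto
  also have "?P ({S. S \<inter> D2 = {}} \<union> {S. S \<inter> D = {}}) \<le> ?P {S. S \<inter> D2 = {}} + ?P {S. S \<inter> D = {}}"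
    by (rule measure_subadditive) auto
  finally show ?thesis using hit[OF sub(1) c(1)] hit[OF sub(2) c(2)] hit[OF D] by linarith
qed

text \<open>The base point is added to the ladder; meant for exceptional elements so low that these
  sums stay in \<open>[n]\<close>.\<close>

lemma is_schur_ladder_sum:
  fixes a u d1 d2 f :: nat
  assumes "{u, u + d1, u + d1 + d2, d1, d2, f} \<subseteq> V"
    and "\<And>s. s \<in> {0, u, u + d1, u + d1 + d2, d1, d2} \<Longrightarrow> a + s \<in> V \<and> a + s + f \<in> V"
  shows "is_schur V"
proof (rule is_schur_ladder[of u "u + d1" "u + d1 + d2" d1 d2 f
      a "a + u" "a + (u + d1)" "a + (u + d1 + d2)" "a + d1" "a + d2"
      "a + f" "a + u + f" "a + (u + d1) + f" "a + (u + d1 + d2) + f" "a + d1 + f" "a + d2 + f"])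
  have "a + s \<in> V" "a + s + f \<in> V" if "s \<in> {0, u, u + d1, u + d1 + d2, d1, d2}" for s
    using assms(2)[OF that] by auto
  from this(1)[of 0] this(2)[of 0] this(1)[of u] this(2)[of u] this(1)[of "u + d1"] this(2)[of "u + d1"]
    this(1)[of "u + d1 + d2"] this(2)[of "u + d1 + d2"] this(1)[of d1] this(2)[of d1] this(1)[of d2] this(2)[of d2]
    assms(1)
  show "{u, u + d1, u + d1 + d2, d1, d2, f, a, a + u, a + (u + d1), a + (u + d1 + d2), a + d1, a + d2, a + f,
     a + u + f, a + (u + d1) + f, a + (u + d1 + d2) + f, a + d1 + f, a + d2 + f} \<subseteq> V"
    by (simp only: insert_subset insert_iff simp_thms add_0_right)
qed (simp_all add: sum_triple_def)

definition gap :: "nat \<Rightarrow> nat \<Rightarrow> nat" where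
  "gap d a = (if a \<le> d then d - a else a - d)"

text \<open>The base point is subtracted; meant for exceptional elements too large for sums. Only
  the \<open>u\<close>s are known to exceed \<open>a + f\<close>, while \<open>d1\<close> and
  \<open>d2\<close> may lie on either side of it, hence the absolute difference
  \<open>gap\<close>.\<close>

lemma is_schur_ladder_diff:
  fixes a u d1 d2 f :: nat
  assumes V: "{u, u + d1, u + d1 + d2, d1, d2, f} \<subseteq> V" and a: "a + f \<le> u"
    and P: "\<And>b. b \<in> {a, a + f} \<Longrightarrow>
      {b, u - b, u + d1 - b, u + d1 + d2 - b, gap d1 b, gap d2 b} \<subseteq> V"
  shows "is_schur V"
proof (rule is_schur_ladder[of u "u + d1" "u + d1 + d2" d1 d2 f
      a "u - a" "u + d1 - a" "u + d1 + d2 - a" "gap d1 a" "gap d2 a"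
      "a + f" "u - (a + f)" "u + d1 - (a + f)" "u + d1 + d2 - (a + f)" "gap d1 (a + f)" "gap d2 (a + f)"])
  from P[of a] P[of "a + f"] V
  show "{u, u + d1, u + d1 + d2, d1, d2, f, a, u - a, u + d1 - a, u + d1 + d2 - a, gap d1 a, gap d2 a,
     a + f, u - (a + f), u + d1 - (a + f), u + d1 + d2 - (a + f), gap d1 (a + f), gap d2 (a + f)} \<subseteq> V"
    by (simp only: insert_subset insert_iff simp_thms)
qed (use a in \<open>auto simp: sum_triple_def gap_def\<close>)

section \<open>Sets of more than half of the integers\<close>

text \<open>The exceptional elements are the even ones, \<open>t\<close> more than the missing odd
  numbers \<open>M\<close>. With \<open>f\<close> even and \<open>a\<close> odd, all points of the
  ladder that involve \<open>a\<close> are odd, so only \<open>M\<close> can spoil them. At most 16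
  conditions with at most \<open>n / 200\<close> holes each face \<open>n div 8\<close> choices of
  \<open>a\<close>.\<close>

lemma prob_schur_near_odd:
  assumes A: "A \<subseteq> {1..n}" and card: "card A = n - n div 2 + t" and t: "100 \<le> t"
    and even: "200 * card {x \<in> A. even x} \<le> n" and p: "0 < p" "p \<le> 1"
  shows "measure_pmf.prob (random_subset n p) {S. \<not> is_schur (A \<union> S)} \<le> 3 * exp (- p * real (t div 20))"
proof -
  have finA: "finite A" using A finite_subset by blast
  define Ev where "Ev = {x \<in> A. even x}"
  define M where "M = {x \<in> {1..n}. odd x} - A"
  have finE: "finite Ev" "finite M" using finA by (auto simp: Ev_def M_def)
  have odds: "card {x \<in> {1..n}. odd x} = n - n div 2"
  proof -
    have "bij_betw (\<lambda>i. 2 * i + 1) {..<n - n div 2} {x \<in> {1..n}. odd x}"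
      by (rule bij_betwI[of _ _ _ "\<lambda>x. x div 2"]) (auto elim!: oddE)
    then show ?thesis using bij_betw_same_card by fastforce
  qed
  have "A = Ev \<union> {x \<in> A. odd x}" by (auto simp: Ev_def)
  moreover have "card (Ev \<union> {x \<in> A. odd x}) = card Ev + card {x \<in> A. odd x}"
    using finA by (intro card_Un_disjoint) (auto simp: Ev_def)
  moreover have "card {x \<in> {1..n}. odd x} = card (M \<union> {x \<in> A. odd x})"
    using A by (intro arg_cong[where f = card]) (auto simp: M_def)
  moreover have "card (M \<union> {x \<in> A. odd x}) = card M + card {x \<in> A. odd x}"
    using finA by (intro card_Un_disjoint) (auto simp: M_def)
  ultimately have EM: "card Ev = t + card M" using card odds by simp
  have E200: "200 * card Ev \<le> n" using even by (simp add: Ev_def)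
  have n: "20000 \<le> n" using E200 EM t by linarith
  \<comment> \<open>Even, to keep \<open>a + f\<close> odd, and at most \<open>n / 8\<close>, so
    that \<open>a + s + f \<le> n\<close> for \<open>a \<le> n / 4\<close> and
    \<open>s \<le> n / 2\<close>.\<close>
  define D where "D = (\<lambda>i. 2 * i) ` {1..n div 16}"
  have D: "D \<subseteq> {1..n}" "card D = n div 16" "\<And>f. f \<in> D \<Longrightarrow> even f \<and> 8 * f \<le> n"
    unfolding D_def by (auto simp: card_image inj_on_def)
  have inA: "x \<in> A" if "odd x" "1 \<le> x" "x \<le> n" "x \<notin> M" for x using that by (auto simp: M_def)
  have kD: "t div 20 \<le> card D" using D(2) E200 EM by simp
  define C where "C = (\<lambda>i. 2 * i + 1) ` {..<n div 8}"
  have C: "card C = n div 8" "finite C" "\<And>a. a \<in> C \<Longrightarrow> odd a \<and> 1 \<le> a \<and> 4 * a \<le> n"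
  proof -
    show "card C = n div 8" "finite C" unfolding C_def by (auto simp: card_image inj_on_def)
    fix a assume "a \<in> C"
    then obtain i where "a = 2 * i + 1" "i < n div 8" by (auto simp: C_def)
    then show "odd a \<and> 1 \<le> a \<and> 4 * a \<le> n" by auto
  qed
  define lo where "lo = {x \<in> Ev. x \<le> n div 2}"
  define hi where "hi = {x \<in> Ev. n div 2 < x}"
  have "Ev = lo \<union> hi" by (auto simp: lo_def hi_def)
  then have "card Ev \<le> card lo + card hi" by (metis card_Un_le)
  then consider "t \<le> 2 * card lo" | "t \<le> 2 * card hi" using EM by linarith
  then show ?thesis
  proof cases
    case 1
    show ?thesis
    proof (rule prob_schur_ladder[OF A _ D(1) kD _ _ p])
      show "lo \<subseteq> A" by (auto simp: lo_def Ev_def)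
      show "0 < t div 20" "2 * (t div 20) + 2 \<le> card lo" using 1 t by auto
      fix u d1 d2 f W
      assume u: "u \<in> lo" "u + d1 \<in> lo" "u + d1 + d2 \<in> lo" "0 < d1" "0 < d2" and f: "f \<in> D"
        and W: "{d1, d2, f} \<subseteq> W"
      define Off where "Off = [0, u, u + d1, u + d1 + d2, d1, d2]"
      define L where "L = map (\<lambda>s. (UNIV :: nat set, \<lambda>a. a + s)) Off @ map (\<lambda>s. (UNIV, \<lambda>a. a + s + f)) Off"
      have "length L * card M < card C" using E200 EM t C n by (simp add: L_def Off_def)
      moreover have "inj_on g Y" if "(Y, g) \<in> set L" for Y g
        using that by (auto simp: L_def inj_on_def)
      ultimately have "\<exists>a\<in>C. \<forall>(Y, g)\<in>set L. a \<in> Y \<longrightarrow> g a \<notin> M"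
        using C finE by (intro exists_avoiding) auto
      then obtain a where a: "a \<in> C" "\<forall>(Y, g)\<in>set L. a \<in> Y \<longrightarrow> g a \<notin> M" by blast
      have ev: "even u" "even d1" "even d2" "even f" "u + d1 + d2 \<le> n div 2" "8 * f \<le> n"
        using u D(3)[OF f] by (auto simp: lo_def Ev_def)
      have aC: "odd a" "1 \<le> a" "4 * a \<le> n" using C(3)[OF a(1)] by auto
      have s: "a + s \<in> A \<and> a + s + f \<in> A" if s: "s \<in> set Off" for s
      proof -
        have "(UNIV, \<lambda>a. a + s) \<in> set L" "(UNIV, \<lambda>a. a + s + f) \<in> set L" using s by (auto simp: L_def)
        from this[THEN bspec[OF a(2)]] have "a + s \<notin> M" "a + s + f \<notin> M" by simp_all
        moreover have "even s" "s \<le> n div 2" using s ev by (auto simp: Off_def)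
        ultimately show ?thesis using ev aC by (intro conjI inA) auto
      qed
      show "is_schur (A \<union> W)"
      proof (rule is_schur_ladder_sum[of u d1 d2 f _ a])
        show "{u, u + d1, u + d1 + d2, d1, d2, f} \<subseteq> A \<union> W"
          using u W by (auto simp: lo_def Ev_def)
      qed (use s in \<open>auto simp: Off_def\<close>)
    qed
  next
    case 2
    show ?thesis
    proof (rule prob_schur_ladder[OF A _ D(1) kD _ _ p])
      show "hi \<subseteq> A" by (auto simp: hi_def Ev_def)
      show "0 < t div 20" "2 * (t div 20) + 2 \<le> card hi" using 2 t by auto
      fix u d1 d2 f W
      assume u: "u \<in> hi" "u + d1 \<in> hi" "u + d1 + d2 \<in> hi" "0 < d1" "0 < d2" and f: "f \<in> D"
        and W: "{d1, d2, f} \<subseteq> W"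
      have ev: "even u" "even d1" "even d2" "even f" "n div 2 < u" "u + d1 + d2 \<le> n" "8 * f \<le> n"
        using u D(3)[OF f] A by (auto simp: hi_def Ev_def)
      \<comment> \<open>The points to keep out of \<open>M\<close> for base \<open>a\<close>; each
        \<open>gap\<close> is split into its two injective branches, and \<open>C\<close> is the
        domain where subtraction from \<open>u\<close> does not truncate. \<open>hs\<close> does the
        same for base \<open>a + f\<close>.\<close>
      define gs where "gs = [(UNIV, \<lambda>a. a), (C, \<lambda>a. u - a), (C, \<lambda>a. u + d1 - a), (C, \<lambda>a. u + d1 + d2 - a),
        ({..d1}, \<lambda>a. d1 - a), ({d1<..}, \<lambda>a. a - d1), ({..d2}, \<lambda>a. d2 - a), ({d2<..}, \<lambda>a. a - d2)]"
      define hs where "hs = [(UNIV, \<lambda>a. a + f), (C, \<lambda>a. u - (a + f)), (C, \<lambda>a. u + d1 - (a + f)), (C, \<lambda>a. u + d1 + d2 - (a + f)),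
        ({a. a + f \<le> d1}, \<lambda>a. d1 - (a + f)), ({a. d1 < a + f}, \<lambda>a. (a + f) - d1),
        ({a. a + f \<le> d2}, \<lambda>a. d2 - (a + f)), ({a. d2 < a + f}, \<lambda>a. (a + f) - d2)]"
      have Cu: "a + f \<le> u \<and> odd a \<and> 1 \<le> a \<and> 2 * (a + f) < n" if "a \<in> C" for a
      proof -
        have c: "odd a" "1 \<le> a" "4 * a \<le> n" using C(3)[OF that] by auto
        have "2 * a + 2 * f < n" using c(3) ev(7) n by linarith
        then show ?thesis using c ev(5) by auto
      qed
      have len: "length (gs @ hs) * card M < card C" using E200 EM t C n by (simp add: gs_def hs_def)
      have injs: "\<forall>(Y, g)\<in>set (gs @ hs). inj_on g Y"
      proof -
        have le: "a + f \<le> u" if "a \<in> C" for a using Cu[OF that] by blast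
        have "x = y" if "x \<in> C" "y \<in> C" "v - x = v - y \<or> v - (x + f) = v - (y + f)" "u \<le> v" for x y v
          using le[OF that(1)] le[OF that(2)] that(3,4) by linarith
        then have i: "inj_on (\<lambda>a. v - a) C" "inj_on (\<lambda>a. v - (a + f)) C" if "u \<le> v" for v
          using that by (auto intro!: inj_onI)
        have "u \<le> u" "u \<le> u + d1" "u \<le> u + d1 + d2" by simp_all
        note i1 = this[THEN i(1)] this[THEN i(2)]
        have i2: "inj_on (\<lambda>a. d - a) {..d}" "inj_on (\<lambda>a. a - d) {d<..}" "inj_on (\<lambda>a. d - (a + f)) {a. a + f \<le> d}"
          "inj_on (\<lambda>a. a + f - d) {a. d < a + f}" "inj_on (\<lambda>a. a) UNIV" "inj_on (\<lambda>a. a + f) UNIV" for d :: nat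
          by (auto intro!: inj_onI)
        show ?thesis unfolding gs_def hs_def by (simp only: set_append set_simps ball_Un ball_simps prod.case i1 i2 simp_thms)
      qed
      then have injs: "inj_on g Y" if "(Y, g) \<in> set (gs @ hs)" for Y g using bspec[OF injs that] by simp
      have "\<exists>a\<in>C. \<forall>(Y, g)\<in>set (gs @ hs). a \<in> Y \<longrightarrow> g a \<notin> M"
        by (rule exists_avoiding[OF C(2) finE(2) injs len])
      then obtain a where a: "a \<in> C" "\<forall>(Y, g)\<in>set (gs @ hs). a \<in> Y \<longrightarrow> g a \<notin> M" by blast
      note a' = a(2)[unfolded gs_def hs_def set_append list.set ball_Un ball_simps prod.case]
      have nM0: "a \<notin> M \<and> u - a \<notin> M \<and> u + d1 - a \<notin> M \<and> u + d1 + d2 - a \<notin> M \<and> gap d1 a \<notin> M \<and> gap d2 a \<notin> M"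
        using a' a(1) by (simp add: gap_def)
      have nM1: "a + f \<notin> M \<and> u - (a + f) \<notin> M \<and> u + d1 - (a + f) \<notin> M \<and> u + d1 + d2 - (a + f) \<notin> M \<and>
          gap d1 (a + f) \<notin> M \<and> gap d2 (a + f) \<notin> M"
        using a' a(1) by (simp add: gap_def)
      have nM: "b \<notin> M \<and> u - b \<notin> M \<and> u + d1 - b \<notin> M \<and> u + d1 + d2 - b \<notin> M \<and> gap d1 b \<notin> M \<and> gap d2 b \<notin> M"
        if "b \<in> {a, a + f}" for b
        using that nM0 nM1 by blast
      have od: "odd (u - b)" "odd (u + d1 - b)" "odd (u + d1 + d2 - b)" "odd (gap d1 b)" "odd (gap d2 b)" "odd b"
        "1 \<le> b" "b \<le> u" "2 * b < n" if "b \<in> {a, a + f}" for b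
        using Cu[OF a(1)] ev that by (auto simp: gap_def)
      show "is_schur (A \<union> W)"
      proof (rule is_schur_ladder_diff[of u d1 d2 f _ a])
        show "{u, u + d1, u + d1 + d2, d1, d2, f} \<subseteq> A \<union> W"
          using u W by (auto simp: hi_def Ev_def)
        show "a + f \<le> u" using Cu[OF a(1)] by simp
        fix b assume b: "b \<in> {a, a + f}"
        have "x \<in> A" if "x \<in> {b, u - b, u + d1 - b, u + d1 + d2 - b, gap d1 b, gap d2 b}" for x
        proof -
          have "odd x" "x \<notin> M" using that nM[OF b] od[OF b] by auto
          moreover have "1 \<le> x" using \<open>odd x\<close> by (cases x) auto
          moreover have "x \<le> n" using that od[OF b] ev by (auto simp: gap_def split: if_splits)
          ultimately show ?thesis by (intro inA)
        qed
        then show "{b, u - b, u + d1 - b, u + d1 + d2 - b, gap d1 b, gap d2 b} \<subseteq> A \<union> W" by blast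
      qed
    qed
  qed
qed

text \<open>For \<open>l\<close> in the lowest and \<open>h\<close> in the highest quarter of \<open>S\<close>, the sums \<open>l + y\<close> with \<open>y \<le> h\<close>
  and \<open>x + h\<close> with \<open>x > l\<close> are about \<open>3/2 \<bar>S\<bar>\<close> distinct numbers.\<close>

lemma card_pairs_sum_avoiding:
  fixes S M :: "nat set"
  assumes "finite S" "finite M" and M: "10 * card S \<ge> 9 * card M" and S: "40 \<le> card S"
  shows "(card S)\<^sup>2 \<le> 64 * card {(x, y). x \<in> S \<and> y \<in> S \<and> x + y \<notin> M}"
proof -
  let ?s = "card S"
  define k where "k = ?s div 4"
  have k: "4 * k \<le> ?s" "?s \<le> 4 * k + 3" unfolding k_def by auto
  define N where "N = (\<lambda>x. {y \<in> S. x + y \<notin> M})"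
  have finN: "finite (N x)" for x using assms(1) by (simp add: N_def)
  obtain Lo where Lo: "Lo \<subseteq> S" "card Lo = k" "\<forall>l\<in>Lo. \<forall>x\<in>S - Lo. l < x"
    using exists_initial_part[OF assms(1), of k] k by auto
  obtain Lo' where Lo': "Lo' \<subseteq> S" "card Lo' = ?s - k" "\<forall>l\<in>Lo'. \<forall>x\<in>S - Lo'. l < x"
    using exists_initial_part[OF assms(1), of "?s - k"] by auto
  define Hi where "Hi = S - Lo'"
  have fin: "finite Lo" "finite Lo'" "finite Hi" using Lo(1) Lo'(1) assms(1) finite_subset by (auto simp: Hi_def)
  have Hi: "Hi \<subseteq> S" "card Hi = k" using Lo' fin k by (auto simp: Hi_def card_Diff_subset)
  \<comment> \<open>The two families of sums are separated by \<open>l + h\<close> and have at least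
    \<open>3/2 * card S\<close> members in total, against at most \<open>10/9 * card S\<close>
    elements of \<open>M\<close>; the surplus exceeds \<open>card S / 4\<close>.\<close>
  have deg: "?s \<le> 4 * card (N l) + 4 * card (N h)" if l: "l \<in> Lo" and h: "h \<in> Hi" for l h
  proof -
    have "card (S - Lo) \<le> card {x \<in> S. l < x}"
      using Lo(3) l assms(1) by (intro card_mono) auto
    then have c1: "?s - k \<le> card {x \<in> S. l < x}" using Lo fin by (simp add: card_Diff_subset)
    have "card Lo' \<le> card {y \<in> S. y \<le> h}"
      using Lo'(1,3) h assms(1) by (intro card_mono) (auto simp: Hi_def less_imp_le)
    then have c2: "?s - k \<le> card {y \<in> S. y \<le> h}" using Lo' by simp
    let ?P = "(\<lambda>y. l + y) ` {y \<in> S. y \<le> h}" and ?Q = "(\<lambda>x. x + h) ` {x \<in> S. l < x}"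
    have "?P \<union> ?Q \<subseteq> M \<union> ((\<lambda>y. l + y) ` N l \<union> (\<lambda>x. x + h) ` N h)"
      by (auto simp: N_def add.commute)
    then have "card (?P \<union> ?Q) \<le> card (M \<union> ((\<lambda>y. l + y) ` N l \<union> (\<lambda>x. x + h) ` N h))"
      using assms(2) finN by (intro card_mono) auto
    also have "\<dots> \<le> card M + (card ((\<lambda>y. l + y) ` N l) + card ((\<lambda>x. x + h) ` N h))" by (rule card_Un_le3)
    also have "\<dots> \<le> card M + (card (N l) + card (N h))"
      by (intro add_mono card_image_le finN) auto
    also have "card (?P \<union> ?Q) = card ?P + card ?Q"
      using assms(1) by (intro card_Un_disjoint) auto
    also have "card ?P = card {y \<in> S. y \<le> h}" by (intro card_image) auto
    also have "card ?Q = card {x \<in> S. l < x}" by (intro card_image) auto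
    finally show ?thesis using c1 c2 k M S by linarith
  qed
  define G where "G = (SIGMA x:S. N x)"
  have G: "card G = (\<Sum>x\<in>S. card (N x))" unfolding G_def using assms(1) finN by simp
  have "\<exists>H. H \<subseteq> S \<and> card H = k \<and> (\<forall>x\<in>H. ?s \<le> 8 * card (N x))"
  proof (cases "\<forall>l\<in>Lo. ?s \<le> 8 * card (N l)")
    case True
    then show ?thesis using Lo by blast
  next
    case False
    then obtain l where l: "l \<in> Lo" "8 * card (N l) < ?s" by auto
    have "?s \<le> 8 * card (N h)" if "h \<in> Hi" for h using deg[OF l(1) that] l(2) by linarith
    then show ?thesis using Hi by blast
  qed
  then obtain H where H: "H \<subseteq> S" "card H = k" "\<And>x. x \<in> H \<Longrightarrow> ?s \<le> 8 * card (N x)" by blast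
  have "k * ?s = (\<Sum>x\<in>H. ?s)" using H by simp
  also have "\<dots> \<le> (\<Sum>x\<in>H. 8 * card (N x))" by (intro sum_mono H)
  also have "\<dots> \<le> (\<Sum>x\<in>S. 8 * card (N x))" using H(1) assms(1) by (intro sum_mono2) auto
  also have "\<dots> = 8 * card G" by (simp add: G sum_distrib_left)
  finally have "8 * k * ?s \<le> 64 * card G" by simp
  moreover have "?s * ?s \<le> 8 * k * ?s" using k S by (intro mult_right_mono) auto
  ultimately have "?s * ?s \<le> 64 * card G" by linarith
  moreover have "G = {(x, y). x \<in> S \<and> y \<in> S \<and> x + y \<notin> M}" by (auto simp: G_def N_def)
  ultimately show ?thesis by (simp add: power2_eq_square)
qed

text \<open>The exceptional elements are those up to \<open>m = n div 2\<close>, again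
  \<open>t\<close> more than the holes \<open>M\<close> above \<open>m\<close>. A tenth of them at
  distance at least \<open>26 * \<tau>\<close> from \<open>m\<close> leaves room for a ladder of
  sums. Otherwise nine tenths lie in a window of that length, and their pairwise sums fall into the
  nearly full upper half.\<close>

lemma prob_schur_near_top:
  "\<exists>\<delta>>0. \<forall>n t p A. A \<subseteq> {1..n} \<longrightarrow> card A = n - n div 2 + t \<longrightarrow> 200 * card (A \<inter> {1..n div 2}) \<le> n \<longrightarrow>
    0 < p \<longrightarrow> p \<le> 1 \<longrightarrow> 1 \<le> \<delta> * p * t \<longrightarrow> 100 \<le> t \<longrightarrow>
    measure_pmf.prob (random_subset n p) {S. \<not> is_schur (A \<union> S)} \<le> 3 * exp (- \<delta> * p * t)"
proof -
  obtain \<delta>0 where \<delta>0: "\<delta>0 > 0" and dense: "\<And>n L s s' p A T. 0 < p \<Longrightarrow> p \<le> 1 \<Longrightarrow> L \<le> n \<Longrightarrow> 1 \<le> \<delta>0 * p * real L \<Longrightarrow>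
    T \<subseteq> {(x, y). x \<in> A \<and> y \<in> A \<and> x + y \<in> A} \<Longrightarrow> T \<subseteq> {s<..s + L} \<times> {s'<..s' + L} \<Longrightarrow>
    (1 / 60000) * (real L)\<^sup>2 \<le> card T \<Longrightarrow>
    measure_pmf.prob (random_subset n p) {S. \<not> is_schur (A \<union> S)} \<le> 3 * exp (- \<delta>0 * p * real L)"
    using prob_schur_dense[of "1 / 60000"] by auto
  define \<delta> where "\<delta> = min \<delta>0 (1 / 100)"
  have \<delta>: "0 < \<delta>" "\<delta> \<le> \<delta>0" "\<delta> \<le> 1 / 100" using \<delta>0 by (auto simp: \<delta>_def)
  show ?thesis
  proof (rule exI[of _ \<delta>], intro conjI allI impI \<delta>(1))
    fix n t :: nat and p :: real and A :: "nat set"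
    assume A: "A \<subseteq> {1..n}" and card: "card A = n - n div 2 + t"
      and low: "200 * card (A \<inter> {1..n div 2}) \<le> n" and p: "0 < p" "p \<le> 1"
      and big: "1 \<le> \<delta> * p * t" and t: "100 \<le> t"
    have finA: "finite A" using A finite_subset by blast
    define m where "m = n div 2"
    have m: "2 * m \<le> n" "n \<le> 2 * m + 1" unfolding m_def by auto
    define T where "T = A \<inter> {1..m}"
    define \<tau> where "\<tau> = card T"
    define M where "M = {m<..n} - A"
    have fin: "finite T" "finite M" by (auto simp: T_def M_def)
    have "A = T \<union> (A \<inter> {m<..n})" using A by (auto simp: T_def)
    moreover have "card (T \<union> (A \<inter> {m<..n})) = card T + card (A \<inter> {m<..n})"
      by (intro card_Un_disjoint) (auto simp: T_def)
    moreover have "card {m<..n} = card (M \<union> (A \<inter> {m<..n}))"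
      by (intro arg_cong[where f = card]) (auto simp: M_def)
    moreover have "card (M \<union> (A \<inter> {m<..n})) = card M + card (A \<inter> {m<..n})"
      by (intro card_Un_disjoint) (auto simp: M_def)
    ultimately have \<tau>M: "\<tau> = t + card M" using card by (simp add: \<tau>_def m_def)
    have t200: "200 * \<tau> \<le> n" using low by (simp add: \<tau>_def T_def m_def)
    have inA: "x \<in> A" if "m < x" "x \<le> n" "x \<notin> M" for x using that by (auto simp: M_def)
    have tt: "26 * \<tau> \<le> m" using t200 m t \<tau>M by linarith
    \<comment> \<open>A ladder imposes 12 conditions, so \<open>13 * \<tau>\<close> candidates for
      \<open>a\<close> outnumber the excluded ones. With another \<open>13 * \<tau>\<close> for
      \<open>f\<close>, the choice \<open>r + 26 * \<tau> = m\<close> keeps \<open>a + s + f\<close>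
      at most \<open>2 * m\<close>.\<close>
    define r where "r = m - 26 * \<tau>"
    have r: "r + 26 * \<tau> = m" using tt by (simp add: r_def)
    define U where "U = {x \<in> T. x \<le> r}"
    define T' where "T' = {x \<in> T. r < x}"
    have "T = U \<union> T'" by (auto simp: U_def T'_def)
    then have UT: "\<tau> \<le> card U + card T'" unfolding \<tau>_def by (metis card_Un_le)
    have T'T: "card T' \<le> \<tau>" unfolding \<tau>_def T'_def using fin by (intro card_mono) auto
    show "measure_pmf.prob (random_subset n p) {S. \<not> is_schur (A \<union> S)} \<le> 3 * exp (- \<delta> * p * t)"
    proof (cases "\<tau> \<le> 10 * card U")
      case True
      have "measure_pmf.prob (random_subset n p) {S. \<not> is_schur (A \<union> S)} \<le> 3 * exp (- p * real (t div 40))"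
      proof (rule prob_schur_ladder[OF A _ _ _ _ _ p, where D = "{1..13 * \<tau>}"])
        show "U \<subseteq> A" by (auto simp: U_def T_def)
        show "{1..13 * \<tau>} \<subseteq> {1..n}" using t200 by auto
        show "t div 40 \<le> card {1..13 * \<tau>}" using \<tau>M by simp
        show "0 < t div 40" "2 * (t div 40) + 2 \<le> card U" using True t \<tau>M by auto
        fix u d1 d2 f W
        assume u: "u \<in> U" "u + d1 \<in> U" "u + d1 + d2 \<in> U" "0 < d1" "0 < d2" and f: "f \<in> {1..13 * \<tau>}"
          and W: "{d1, d2, f} \<subseteq> W"
        define Off where "Off = [0, u, u + d1, u + d1 + d2, d1, d2]"
        define L where "L = map (\<lambda>s. (UNIV :: nat set, \<lambda>a. a + s)) Off @ map (\<lambda>s. (UNIV, \<lambda>a. a + s + f)) Off"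
        define C where "C = {m<..m + 13 * \<tau>}"
        have len: "length L * card M < card C" using t \<tau>M by (simp add: L_def Off_def C_def)
        have injs: "inj_on g Y" if "(Y, g) \<in> set L" for Y g
          using that by (auto simp: L_def inj_on_def)
        have finC: "finite C" by (simp add: C_def)
        obtain a where a: "a \<in> C" "\<forall>(Y, g)\<in>set L. a \<in> Y \<longrightarrow> g a \<notin> M"
          using exists_avoiding[OF finC fin(2) injs len] by blast
        have ub: "u + d1 + d2 \<le> r" "f \<le> 13 * \<tau>" using u f by (auto simp: U_def)
        have aC: "m < a" "a \<le> m + 13 * \<tau>" using a(1) by (auto simp: C_def)
        have s: "a + s \<in> A \<and> a + s + f \<in> A" if s: "s \<in> set Off" for s
        proof -
          have "(UNIV, \<lambda>a. a + s) \<in> set L" "(UNIV, \<lambda>a. a + s + f) \<in> set L" using s by (auto simp: L_def)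
          from this[THEN bspec[OF a(2)]] have "a + s \<notin> M" "a + s + f \<notin> M" by simp_all
          moreover have "s \<le> r" using s ub by (auto simp: Off_def)
          ultimately show ?thesis using ub aC r m by (intro conjI inA) auto
        qed
        show "is_schur (A \<union> W)"
        proof (rule is_schur_ladder_sum[of u d1 d2 f _ a])
          show "{u, u + d1, u + d1 + d2, d1, d2, f} \<subseteq> A \<union> W"
            using u W by (auto simp: U_def T_def)
        qed (use s in \<open>auto simp: Off_def\<close>)
      qed
      also have "\<dots> \<le> 3 * exp (- \<delta> * p * t)"
      proof -
        have "real t \<le> 100 * real (t div 40)" using t by linarith
        then have "\<delta> * real t \<le> 1 / 100 * (100 * real (t div 40))"
          using \<delta> by (intro mult_mono) auto
        then have "p * (\<delta> * real t) \<le> p * real (t div 40)" using p by (intro mult_left_mono) auto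
        then show ?thesis by (simp add: mult.left_commute mult.commute)
      qed
      finally show ?thesis .
    next
      case False
      have s: "9 * \<tau> \<le> 10 * card T'" using False UT by linarith
      define P where "P = {(x, y). x \<in> T' \<and> y \<in> T' \<and> x + y \<notin> M}"
      have "40 \<le> card T'" using s \<tau>M t by linarith
      then have cP: "(card T')\<^sup>2 \<le> 64 * card P"
        unfolding P_def using fin s \<tau>M by (intro card_pairs_sum_avoiding) (auto simp: T'_def)
      have s': "9 * real \<tau> \<le> 10 * real (card T')" using s by linarith
      have "81 * (real \<tau> * \<tau>) = (9 * real \<tau>) * (9 * real \<tau>)" by simp
      also have "\<dots> \<le> (10 * real (card T')) * (10 * real (card T'))"
        by (rule mult_mono[OF s' s']) auto
      also have "\<dots> = 100 * real ((card T')\<^sup>2)" by (simp add: power2_eq_square)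
      also have "\<dots> \<le> 100 * real (64 * card P)" using cP by (intro mult_left_mono of_nat_mono) auto
      finally have "81 * (real \<tau> * \<tau>) \<le> 6400 * card P" by simp
      \<comment> \<open>At least \<open>(9/10 * \<tau>)^2 / 64\<close> pairs in a square of side
        \<open>26 * \<tau>\<close>: the density \<open>0.81 / (64 * 676)\<close> is above
        \<open>1 / 60000\<close>.\<close>
      then have c: "1 / 60000 * (real (26 * \<tau>))\<^sup>2 \<le> card P" by (simp add: power2_eq_square)
      have PA: "P \<subseteq> {(x, y). x \<in> A \<and> y \<in> A \<and> x + y \<in> A}"
      proof clarify
        fix x y assume "(x, y) \<in> P"
        then have xy: "x \<in> A" "y \<in> A" "r < x" "x \<le> m" "r < y" "y \<le> m" "x + y \<notin> M"
          by (auto simp: P_def T'_def T_def)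
        have "m \<le> 2 * r + 1" using r t200 m by linarith
        then have "x + y \<in> A" using xy m by (intro inA) auto
        then show "x \<in> A \<and> y \<in> A \<and> x + y \<in> A" using xy by simp
      qed
      have PL: "P \<subseteq> {r<..r + 26 * \<tau>} \<times> {r<..r + 26 * \<tau>}"
        unfolding r by (auto simp: P_def T'_def T_def)
      have le: "\<delta> * p * t \<le> \<delta>0 * p * real (26 * \<tau>)"
        using \<delta> p \<tau>M by (intro mult_mono) auto
      have "measure_pmf.prob (random_subset n p) {S. \<not> is_schur (A \<union> S)} \<le> 3 * exp (- \<delta>0 * p * real (26 * \<tau>))"
        using t200 le big by (intro dense[OF p _ _ PA PL c]) auto
      also have "\<dots> \<le> 3 * exp (- \<delta> * p * t)" using le by simp
      finally show ?thesis .
    qed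
  qed
qed

lemma prob_schur_excess:
  "\<exists>\<delta>>0. \<forall>n t p A. A \<subseteq> {1..n} \<longrightarrow> card A = n - n div 2 + t \<longrightarrow> 0 < p \<longrightarrow> p \<le> 1 \<longrightarrow> 1 \<le> \<delta> * p * real t \<longrightarrow>
    measure_pmf.prob (random_subset n p) {S. \<not> is_schur (A \<union> S)} \<le> 3 * exp (- \<delta> * p * real t)"
proof -
  define c :: real where "c = (1 / 10 ^ 11)\<^sup>2"
  have "0 < c" "c \<le> 1" by (simp_all add: c_def power2_eq_square)
  then obtain \<delta>0 where \<delta>0: "\<delta>0 > 0" and dense: "\<And>n L s s' p A T. 0 < p \<Longrightarrow> p \<le> 1 \<Longrightarrow> L \<le> n \<Longrightarrow> 1 \<le> \<delta>0 * p * real L \<Longrightarrow>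
    T \<subseteq> {(x, y). x \<in> A \<and> y \<in> A \<and> x + y \<in> A} \<Longrightarrow> T \<subseteq> {s<..s + L} \<times> {s'<..s' + L} \<Longrightarrow>
    c * (real L)\<^sup>2 \<le> card T \<Longrightarrow>
    measure_pmf.prob (random_subset n p) {S. \<not> is_schur (A \<union> S)} \<le> 3 * exp (- \<delta>0 * p * real L)"
    using prob_schur_dense[of c] by auto
  obtain \<delta>1 where \<delta>1: "\<delta>1 > 0" and top: "\<And>n t p A. A \<subseteq> {1..n} \<Longrightarrow> card A = n - n div 2 + t \<Longrightarrow>
    200 * card (A \<inter> {1..n div 2}) \<le> n \<Longrightarrow> 0 < p \<Longrightarrow> p \<le> 1 \<Longrightarrow> 1 \<le> \<delta>1 * p * real t \<Longrightarrow> 100 \<le> t \<Longrightarrow>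
    measure_pmf.prob (random_subset n p) {S. \<not> is_schur (A \<union> S)} \<le> 3 * exp (- \<delta>1 * p * real t)"
    using prob_schur_near_top by blast
  \<comment> \<open>The cap \<open>1 / 10 ^ 13\<close> turns \<open>1 \<le> \<delta> * p * t\<close>
    into \<open>t \<ge> 10 ^ 13\<close>, which supplies the lower bounds on \<open>t\<close> and
    \<open>n\<close> required by the three cases.\<close>
  define \<delta> where "\<delta> = min \<delta>0 (min \<delta>1 (1 / 10 ^ 13))"
  have \<delta>: "0 < \<delta>" "\<delta> \<le> \<delta>0" "\<delta> \<le> \<delta>1" "\<delta> \<le> 1 / 10 ^ 13"
    using \<delta>0 \<delta>1 by (auto simp: \<delta>_def)
  show ?thesis
  proof (rule exI[of _ \<delta>], intro conjI allI impI \<delta>(1))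
    fix n t :: nat and p :: real and A :: "nat set"
    assume A: "A \<subseteq> {1..n}" and card: "card A = n - n div 2 + t" and p: "0 < p" "p \<le> 1"
      and big: "1 \<le> \<delta> * p * real t"
    have "\<delta> * p * real t \<le> (1 / 10 ^ 13) * 1 * real t"
      using \<delta> p by (intro mult_mono) auto
    then have "real (10 ^ 13) \<le> real t" using big by simp
    then have t: "10 ^ 13 \<le> t" by (simp only: of_nat_le_iff)
    have "card A \<le> n" using card_mono[OF _ A] by simp
    then have tn: "t \<le> n" using card by linarith
    have t100: "100 \<le> t" by (rule order_trans[OF _ t]) simp
    have mono: "3 * exp (- \<delta>' * p * real s) \<le> 3 * exp (- \<delta> * p * real t)" "1 \<le> \<delta>' * p * real s"
      if "\<delta> \<le> \<delta>'" "t \<le> s" for \<delta>' s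
    proof -
      have "\<delta> * p * real t \<le> \<delta>' * p * real s" using that \<delta> p by (intro mult_mono) auto
      then show "3 * exp (- \<delta>' * p * real s) \<le> 3 * exp (- \<delta> * p * real t)" "1 \<le> \<delta>' * p * real s"
        using big by auto
    qed
    let ?T = "{(x, y). x \<in> A \<and> y \<in> A \<and> x + y \<in> A}"
    show "measure_pmf.prob (random_subset n p) {S. \<not> is_schur (A \<union> S)} \<le> 3 * exp (- \<delta> * p * real t)"
    proof (cases "card ?T \<le> (real n / 10 ^ 11)\<^sup>2")
      case False
      have "measure_pmf.prob (random_subset n p) {S. \<not> is_schur (A \<union> S)} \<le> 3 * exp (- \<delta>0 * p * real n)"
      proof (rule dense[OF p order_refl mono(2)[OF \<delta>(2) tn] order_refl])
        show "?T \<subseteq> {0<..0 + n} \<times> {0<..0 + n}" using A by auto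
        show "c * (real n)\<^sup>2 \<le> card ?T" using False unfolding c_def by (simp add: power_divide)
      qed
      also note mono(1)[OF \<delta>(2) tn]
      finally show ?thesis .
    next
      case True
      have half: "n \<le> 2 * card A" using card by linarith
      consider "200 * card (A \<inter> {1..n div 2}) \<le> n" | "200 * card {x \<in> A. even x} \<le> n"
        using stability[OF A half order_trans[OF t tn] True] by blast
      then show ?thesis
      proof cases
        case 1
        have "measure_pmf.prob (random_subset n p) {S. \<not> is_schur (A \<union> S)} \<le> 3 * exp (- \<delta>1 * p * real t)"
          by (rule top[OF A card 1 p mono(2)[OF \<delta>(3) order_refl] t100])
        also note mono(1)[OF \<delta>(3) order_refl]
        finally show ?thesis .
      next
        case 2
        have "measure_pmf.prob (random_subset n p) {S. \<not> is_schur (A \<union> S)} \<le> 3 * exp (- p * real (t div 20))"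
          by (rule prob_schur_near_odd[OF A card t100 2 p])
        also have "\<dots> \<le> 3 * exp (- \<delta> * p * real t)"
        proof -
          have "real t \<le> 100 * real (t div 20)" using t100 by linarith
          moreover have "\<delta> \<le> 1 / 100" using \<delta>(4) by simp
          ultimately have "\<delta> * real t \<le> 1 / 100 * (100 * real (t div 20))"
            using \<delta> by (intro mult_mono) auto
          then have "p * (\<delta> * real t) \<le> p * real (t div 20)" using p by (intro mult_left_mono) auto
          then show ?thesis by (simp add: mult.left_commute mult.commute)
        qed
        finally show ?thesis .
      qed
    qed
  qed
qed

section \<open>Error bounds for the interval and the two threshold statements\<close>

lemma prob_schur_interval_le:
  fixes a n t :: nat and p :: real
  assumes p: "0 \<le> p" "p \<le> 1" and a: "n < 5 * a" "n \<le> 2 * a + 2 * t"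
  shows "measure_pmf.prob (random_subset n p) {S. is_schur ({a..n} \<union> S)} \<le> 2 * t * p + (real n)\<^sup>2 * p ^ 3 + n * p\<^sup>2"
proof -
  let ?M = "random_subset n p" and ?P = "measure_pmf.prob (random_subset n p)"
  define I where "I = {1..n} \<inter> {1..2 * t}"
  define F where "F = {(x, y) \<in> {1..n} \<times> {1..n}. x + y \<le> n}"
  have fin: "finite I" "finite F"
    unfolding I_def F_def by (auto intro: finite_subset[of _ "{1..n} \<times> {1..n}"])
  have "?P {S. is_schur ({a..n} \<union> S)} = ?P ({S. is_schur ({a..n} \<union> S)} \<inter> set_pmf ?M)"
    by (rule measure_Int_set_pmf[symmetric])
  also have "\<dots> \<le> ?P ((\<Union>i\<in>I. {S. {i} \<subseteq> S}) \<union> (\<Union>(x, y)\<in>F. {S. {x, y, x + y} \<subseteq> S}))"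
  proof (intro measure_pmf.finite_measure_mono subsetI)
    fix S assume "S \<in> {S. is_schur ({a..n} \<union> S)} \<inter> set_pmf ?M"
    then have S: "is_schur ({a..n} \<union> S)" "S \<subseteq> {1..n}" using set_pmf_random_subset by auto
    show "S \<in> (\<Union>i\<in>I. {S. {i} \<subseteq> S}) \<union> (\<Union>(x, y)\<in>F. {S. {x, y, x + y} \<subseteq> S})"
    proof (rule ccontr)
      assume n: "S \<notin> (\<Union>i\<in>I. {S. {i} \<subseteq> S}) \<union> (\<Union>(x, y)\<in>F. {S. {x, y, x + y} \<subseteq> S})"
      have "S \<inter> {1..2 * t} = {}" using n S(2) by (auto simp: I_def)
      moreover have "x + y \<notin> S" if "x \<in> S" "y \<in> S" for x y
      proof
        assume "x + y \<in> S"
        then have "(x, y) \<in> F" using that S(2) by (auto simp: F_def)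
        then show False using n that \<open>x + y \<in> S\<close> by auto
      qed
      ultimately show False using not_schur_interval[OF a S(2)] S(1) by blast
    qed
  qed simp
  also have "\<dots> \<le> ?P (\<Union>i\<in>I. {S. {i} \<subseteq> S}) + ?P (\<Union>(x, y)\<in>F. {S. {x, y, x + y} \<subseteq> S})"
    by (rule measure_subadditive) auto
  also have "?P (\<Union>i\<in>I. {S. {i} \<subseteq> S}) \<le> (\<Sum>i\<in>I. ?P {S. {i} \<subseteq> S})"
    by (rule measure_pmf.finite_measure_subadditive_finite[OF fin(1)]) auto
  also have "\<dots> = (\<Sum>i\<in>I. p)"
  proof (intro sum.cong refl)
    fix i assume "i \<in> I"
    then have "{i} \<subseteq> {1..n}" by (auto simp: I_def)
    from prob_random_superset[OF p this] show "?P {S. {i} \<subseteq> S} = p" by simp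
  qed
  also have "\<dots> \<le> 2 * t * p"
  proof -
    have "card I \<le> card {1..2 * t}" unfolding I_def by (intro card_mono) auto
    then have "real (card I) \<le> 2 * real t" by simp
    then show ?thesis using p by (simp add: mult_right_mono)
  qed
  also have "?P (\<Union>(x, y)\<in>F. {S. {x, y, x + y} \<subseteq> S}) \<le> (\<Sum>f\<in>F. ?P (case f of (x, y) \<Rightarrow> {S. {x, y, x + y} \<subseteq> S}))"
    by (rule measure_pmf.finite_measure_subadditive_finite[OF fin(2)]) auto
  \<comment> \<open>Triples with \<open>x = y\<close> consist of two elements only and are charged
    \<open>p^2\<close>.\<close>
  also have "\<dots> \<le> (\<Sum>f\<in>F. p ^ 3 + (if f \<in> (\<lambda>x. (x, x)) ` {1..n} then p\<^sup>2 else 0))"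
  proof (intro sum_mono, clarify)
    fix x y assume "(x, y) \<in> F"
    then have xy: "1 \<le> x" "1 \<le> y" "x \<le> n" "{x, y, x + y} \<subseteq> {1..n}" by (auto simp: F_def)
    show "?P {S. {x, y, x + y} \<subseteq> S} \<le> p ^ 3 + (if (x, y) \<in> (\<lambda>x. (x, x)) ` {1..n} then p\<^sup>2 else 0)"
    proof (cases "x = y")
      case True
      then have "card {x, y, x + y} = 2" using xy by simp
      then show ?thesis using prob_random_superset[OF p xy(4)] True xy p by (auto simp: image_iff power2_eq_square)
    next
      case False
      then have "card {x, y, x + y} = 3" using xy by simp
      then show ?thesis using prob_random_superset[OF p xy(4)] p by simp
    qed
  qed
  also have "\<dots> \<le> (real n)\<^sup>2 * p ^ 3 + n * p\<^sup>2"
  proof -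
    have "card F \<le> card ({1..n} \<times> {1..n})" unfolding F_def by (intro card_mono) auto
    then have "real (card F) \<le> (real n)\<^sup>2" by (simp add: card_cartesian_product power2_eq_square flip: of_nat_mult)
    then have "real (card F) * p ^ 3 \<le> (real n)\<^sup>2 * p ^ 3" using p by (intro mult_right_mono) auto
    moreover have "(\<Sum>f\<in>F. if f \<in> (\<lambda>x. (x, x)) ` {1..n} then p\<^sup>2 else 0) = card (F \<inter> (\<lambda>x. (x, x)) ` {1..n}) * p\<^sup>2"
      using fin by (simp add: sum.If_cases)
    moreover have "card (F \<inter> (\<lambda>x. (x, x)) ` {1..n}) \<le> card ((\<lambda>x. (x, x)) ` {1..n})"
      by (intro card_mono) auto
    moreover have "card ((\<lambda>x. (x, x)) ` {1..n}) \<le> n"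
      using card_image_le[of "{1..n}" "\<lambda>x. (x, x)"] by simp
    ultimately show ?thesis using p by (simp add: sum.distrib mult_right_mono add_mono)
  qed
  finally show ?thesis by simp
qed

lemma whpI:
  assumes "\<And>\<epsilon>. 0 < \<epsilon> \<Longrightarrow> \<forall>\<^sub>F n in sequentially. measure_pmf.prob (M n) {x. \<not> E n x} \<le> \<epsilon>"
  shows "whp M E"
  unfolding whp_def
proof (rule tendstoI)
  fix \<epsilon> :: real assume "0 < \<epsilon>"
  then have "\<forall>\<^sub>F n in sequentially. measure_pmf.prob (M n) {x. \<not> E n x} \<le> \<epsilon> / 2"
    by (intro assms) simp
  then show "\<forall>\<^sub>F n in sequentially. dist (measure_pmf.prob (M n) {x. E n x}) 1 < \<epsilon>"
  proof eventually_elim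
    case (elim n)
    have "{x. \<not> E n x} = space (measure_pmf (M n)) - {x. E n x}" by auto
    then have "measure_pmf.prob (M n) {x. \<not> E n x} = 1 - measure_pmf.prob (M n) {x. E n x}"
      using measure_pmf.prob_compl[of "{x. E n x}" "M n"] by simp
    then show ?case using elim \<open>0 < \<epsilon>\<close> by (simp add: dist_real_def)
  qed
qed

lemma powr_two_thirds:
  fixes n :: nat and q :: real
  assumes "1 \<le> n"
  defines "q \<equiv> real n powr (- 2 / 3)"
  shows "0 < q" "(real n)\<^sup>2 * q ^ 3 = 1" "n * q\<^sup>2 \<le> 1" "1 \<le> n * q"
proof -
  show q: "0 < q" using assms by (simp add: q_def)
  have "q ^ 3 = real n powr (- 2)" using assms by (simp add: q_def powr_power)
  also have "\<dots> = 1 / (real n)\<^sup>2" using assms by (simp add: powr_minus_divide)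
  finally show 1: "(real n)\<^sup>2 * q ^ 3 = 1" using assms by simp
  have q1: "q \<le> 1"
    unfolding q_def using assms powr_mono[of "- 2 / 3" 0 "real n"] by simp
  have "(n * q\<^sup>2)\<^sup>2 = ((real n)\<^sup>2 * q ^ 3) * q" by (simp add: power2_eq_square eval_nat_numeral)
  also have "\<dots> \<le> 1\<^sup>2" using 1 q1 by simp
  finally show 2: "n * q\<^sup>2 \<le> 1" by (rule power2_le_imp_le) simp
  have "1 = (n * q) * (n * q\<^sup>2)" using 1 by (simp add: power2_eq_square eval_nat_numeral algebra_simps)
  also have "\<dots> \<le> (n * q) * 1" using 2 q by (intro mult_left_mono) auto
  finally show "1 \<le> n * q" by simp
qed

lemma ceiling_half: "\<lceil>real n / 2\<rceil> = int (n - n div 2)"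
  by (rule ceiling_unique) (auto simp: of_nat_diff real_of_nat_div; linarith)+

theorem theorem1p4:
  fixes t :: "nat \<Rightarrow> nat"
  assumes t_pos: "\<And>n. 0 < t n"
    and t_le: "\<forall>\<^sub>F n in sequentially. \<lceil>real n / 2\<rceil> + int (t n) \<le> \<lceil>4 * real n / 5\<rceil>"
  shows "(\<exists>A. admissible_sets t A \<and>
            (\<forall>p. prob_seq p \<and> p \<in> o(\<lambda>n. schur_threshold n (t n)) \<longrightarrow>
               whp (\<lambda>n. random_subset n (p n)) (\<lambda>n S. \<not> is_schur (A n \<union> S))))
       \<and> (\<forall>A. admissible_sets t A \<longrightarrow>
            (\<forall>p. prob_seq p \<and> p \<in> \<omega>(\<lambda>n. schur_threshold n (t n)) \<longrightarrow>
               whp (\<lambda>n. random_subset n (p n)) (\<lambda>n S. is_schur (A n \<union> S))))"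
proof (intro conjI exI allI impI)
  \<comment> \<open>For \<open>t n \<le> n div 2\<close> the interval from \<open>a n\<close> to
    \<open>n\<close> has \<open>n - n div 2 + t n\<close> elements; \<open>n < 5 * a n\<close> is
    what the bound by \<open>4 * n / 5\<close> provides.\<close>
  define a where "a = (\<lambda>n. n div 2 + 1 - t n)"
  have a: "\<forall>\<^sub>F n in sequentially. n < 5 * a n \<and> n \<le> 2 * a n + 2 * t n \<and> t n \<le> n div 2"
    using t_le
  proof eventually_elim
    case (elim n)
    have "of_int \<lceil>4 * real n / 5\<rceil> < 4 * real n / 5 + 1" by linarith
    moreover have "int (n - n div 2) + int (t n) \<le> \<lceil>4 * real n / 5\<rceil>" using elim unfolding ceiling_half .
    ultimately have "5 * (n - n div 2) + 5 * t n < 4 * n + 5" by linarith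
    then show ?case unfolding a_def by (intro conjI; linarith)
  qed
  show "admissible_sets t (\<lambda>n. {a n..n})"
    unfolding admissible_sets_def using a
    by eventually_elim (auto simp: ceiling_half a_def)
  fix p assume p: "prob_seq p \<and> p \<in> o(\<lambda>n. schur_threshold n (t n))"
  show "whp (\<lambda>n. random_subset n (p n)) (\<lambda>n S. \<not> is_schur ({a n..n} \<union> S))"
  proof (rule whpI)
    fix \<epsilon> :: real assume \<epsilon>: "0 < \<epsilon>"
    \<comment> \<open>The error has the term \<open>2 * t * p\<close>, at most \<open>2 * c\<close>,
      and two further terms of at most \<open>c\<close> each.\<close>
    define c where "c = min 1 (\<epsilon> / 4)"
    have c: "0 < c" "c \<le> 1" "4 * c \<le> \<epsilon>" using \<epsilon> by (auto simp: c_def)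
    have "\<forall>\<^sub>F n in sequentially. norm (p n) \<le> c * norm (schur_threshold n (t n))"
      using p c by (intro landau_o.smallD) auto
    then show "\<forall>\<^sub>F n in sequentially. measure_pmf.prob (random_subset n (p n)) {S. \<not> \<not> is_schur ({a n..n} \<union> S)} \<le> \<epsilon>"
      using a eventually_ge_at_top[of 1]
    proof eventually_elim
      case (elim n)
      define q where "q = real n powr (- 2 / 3)"
      note q = powr_two_thirds[OF elim(3), folded q_def]
      have p01: "0 \<le> p n" "p n \<le> 1" using p by (auto simp: prob_seq_def)
      have th: "0 \<le> schur_threshold n (t n)" "schur_threshold n (t n) \<le> q" "schur_threshold n (t n) \<le> inverse (t n)"
        by (auto simp: schur_threshold_def q_def)
      have pc: "p n \<le> c * schur_threshold n (t n)" using elim(1) p01 th(1) by simp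
      have pq: "p n \<le> c * q" using pc mult_left_mono[OF th(2), of c] c by linarith
      have "p n \<le> c * inverse (t n)" using pc mult_left_mono[OF th(3), of c] c by linarith
      then have 1: "t n * p n \<le> c" using t_pos[of n] by (simp add: field_simps)
      have cc: "c ^ 3 \<le> c" "c\<^sup>2 \<le> c" using c power_decreasing[of 1 3 c] power_decreasing[of 1 2 c] by auto
      have "(real n)\<^sup>2 * p n ^ 3 \<le> (real n)\<^sup>2 * (c * q) ^ 3" using pq p01 by (intro mult_left_mono power_mono) auto
      also have "\<dots> = c ^ 3 * ((real n)\<^sup>2 * q ^ 3)" by (simp add: power_mult_distrib)
      finally have 2: "(real n)\<^sup>2 * p n ^ 3 \<le> c" using q(2) cc by simp
      have "n * (p n)\<^sup>2 \<le> n * (c * q)\<^sup>2" using pq p01 by (intro mult_left_mono power_mono) auto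
      also have "\<dots> = c\<^sup>2 * (n * q\<^sup>2)" by (simp add: power_mult_distrib)
      also have "\<dots> \<le> c * 1" using cc q(3) c by (intro mult_mono) auto
      finally have 3: "n * (p n)\<^sup>2 \<le> c" by simp
      show ?case
        using prob_schur_interval_le[OF p01, of n "a n" "t n"] elim(2) 1 2 3 c(3) by simp
    qed
  qed
next
  fix A p
  assume A: "admissible_sets t A" and p: "prob_seq p \<and> p \<in> \<omega>(\<lambda>n. schur_threshold n (t n))"
  obtain C n0 where C: "0 < C" and half: "\<And>n A p. n0 \<le> n \<Longrightarrow> A \<subseteq> {1..n} \<Longrightarrow> n \<le> 2 * card A \<Longrightarrow> 0 < p \<Longrightarrow> p \<le> 1 \<Longrightarrow>
    measure_pmf.prob (random_subset n p) {S. \<not> is_schur (A \<union> S)} \<le> C * (1 / (n * p) + 1 / ((real n)\<^sup>2 * p ^ 3))"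
    using prob_schur_half by blast
  obtain \<delta> where \<delta>: "0 < \<delta>" and excess: "\<And>n t p A. A \<subseteq> {1..n} \<Longrightarrow> card A = n - n div 2 + t \<Longrightarrow> 0 < p \<Longrightarrow> p \<le> 1 \<Longrightarrow>
    1 \<le> \<delta> * p * real t \<Longrightarrow> measure_pmf.prob (random_subset n p) {S. \<not> is_schur (A \<union> S)} \<le> 3 * exp (- \<delta> * p * real t)"
    using prob_schur_excess by blast
  show "whp (\<lambda>n. random_subset n (p n)) (\<lambda>n S. is_schur (A n \<union> S))"
  proof (rule whpI)
    fix \<epsilon> :: real assume \<epsilon>: "0 < \<epsilon>"
    \<comment> \<open>The entry with \<open>C\<close> serves the second moment bound,
      \<open>1 / \<delta>\<close> the hypothesis of \<open>excess\<close>, and the last one its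
      exponential, estimated by \<open>exp (- x) \<le> 1 / x\<close>.\<close>
    define K where "K = Max {1, 2 * C / \<epsilon>, 1 / \<delta>, 3 / (\<delta> * \<epsilon>)}"
    have K: "1 \<le> K" "2 * C / \<epsilon> \<le> K" "1 / \<delta> \<le> K" "3 / (\<delta> * \<epsilon>) \<le> K" unfolding K_def by simp_all
    have "\<forall>\<^sub>F n in sequentially. K * norm (schur_threshold n (t n)) \<le> norm (p n)"
      using p K by (intro landau_omega.smallD) auto
    then show "\<forall>\<^sub>F n in sequentially. measure_pmf.prob (random_subset n (p n)) {S. \<not> is_schur (A n \<union> S)} \<le> \<epsilon>"
      using A[unfolded admissible_sets_def] eventually_ge_at_top[of 1] eventually_ge_at_top[of n0]
    proof eventually_elim
      case (elim n)
      define q where "q = real n powr (- 2 / 3)"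
      note q = powr_two_thirds[OF elim(3), folded q_def]
      have An: "A n \<subseteq> {1..n}" "card (A n) = n - n div 2 + t n" using elim(2) unfolding ceiling_half by linarith+
      have p01: "0 \<le> p n" "p n \<le> 1" using p by (auto simp: prob_seq_def)
      have th: "schur_threshold n (t n) = min q (inverse (t n))" by (simp add: schur_threshold_def q_def)
      have t0: "0 < inverse (real (t n))" using t_pos[of n] by simp
      have pK: "K * schur_threshold n (t n) \<le> p n" using elim(1) p01 th q(1) t0 by simp
      show ?case
      proof (cases "q \<le> inverse (t n)")
        case True
        then have pq: "K * q \<le> p n" using pK th by simp
        have p0: "0 < p n" using mult_pos_pos[of K q] K(1) q(1) pq by linarith
        have "K * 1 \<le> K * (n * q)" using K q by (intro mult_left_mono) auto
        also have "\<dots> \<le> n * p n" using mult_left_mono[OF pq, of "real n"] by (simp add: algebra_simps)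
        finally have 1: "K \<le> n * p n" by simp
        have "K \<le> K ^ 3 * ((real n)\<^sup>2 * q ^ 3)" using K(1) q(2) power_increasing[of 1 3 K] by simp
        also have "\<dots> = (real n)\<^sup>2 * (K * q) ^ 3" by (simp add: power_mult_distrib)
        also have "\<dots> \<le> (real n)\<^sup>2 * p n ^ 3" using pq K(1) q(1) by (intro mult_left_mono power_mono) auto
        finally have 2: "K \<le> (real n)\<^sup>2 * p n ^ 3" .
        have "measure_pmf.prob (random_subset n (p n)) {S. \<not> is_schur (A n \<union> S)} \<le>
            C * (1 / (n * p n) + 1 / ((real n)\<^sup>2 * p n ^ 3))"
          using An p0 p01 elim by (intro half) auto
        also have "\<dots> \<le> C * (1 / K + 1 / K)"
          using 1 2 K(1) C by (intro mult_left_mono add_mono divide_left_mono) auto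
        also have "\<dots> \<le> \<epsilon>" using K(1,2) \<epsilon> by (simp add: field_simps)
        finally show ?thesis .
      next
        case False
        then have "K * inverse (t n) \<le> p n" using pK th by simp
        then have pt: "K \<le> p n * t n" using t_pos[of n] by (simp add: field_simps)
        have p0: "0 < p n" using pt K(1) p01 by (cases "p n = 0") auto
        have "1 \<le> \<delta> * K" using K(3) \<delta> by (simp add: field_simps)
        also have \<delta>K: "\<dots> \<le> \<delta> * p n * t n" using mult_left_mono[OF pt, of \<delta>] \<delta> by (simp add: algebra_simps)
        finally have 1: "1 \<le> \<delta> * p n * t n" .
        have "measure_pmf.prob (random_subset n (p n)) {S. \<not> is_schur (A n \<union> S)} \<le> 3 * exp (- \<delta> * p n * t n)"
          by (rule excess[OF An p0 p01(2) 1])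
        also have "\<dots> \<le> 3 * exp (- (\<delta> * K))" using \<delta>K by simp
        also have "\<dots> \<le> 3 * (1 / (\<delta> * K))"
        proof -
          have "\<delta> * K \<le> exp (\<delta> * K)" using exp_ge_add_one_self[of "\<delta> * K"] by linarith
          moreover have "0 < \<delta> * K" using \<delta> K(1) by simp
          ultimately show ?thesis by (simp add: exp_minus field_simps)
        qed
        also have "\<dots> \<le> \<epsilon>" using K(1,4) \<epsilon> \<delta> by (simp add: field_simps)
        finally show ?thesis .
      qed
    qed
  qed
qed

end
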